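(* Let $F$ be $L$-smooth and $l$-lower smooth, and let $\theta^*$ be an optimal solution of $\min_{\theta\in\Omega}F(\theta)$. Run the NCGS algorithm (defined in the context) for $N$ iterations from the initial point $\theta_0$. (Option I) If $\alpha_k=\frac{2}{k+1}$, $\beta_k=\frac{1}{2L}$, $\lambda_k=\beta_k$, $\eta_k=\frac1N$ and option I is used, then $$\min_{k=1,\dots,N}\|g(\theta_{k-1},\nabla F(\theta_k^{md}),\lambda_k)\|^2\le \frac{12L\,(F(\theta_0)-F(\theta^* ))+16L}{N}.$$ (Option II) If $\alpha_k=\frac{2}{k+1}$, $\beta_k=\frac{1}{2L}$, $\lambda_k=\frac{k\beta_k}{2}$, $\eta_k=\frac1N$, $\chi_k=\frac1N$ and option II is used, then $$\min_{k=1,\dots,N}\|g(\theta_{k-1},\nabla F(\theta_k^{md}),\beta_k)\|^2\le 48L\left(\frac{4L\|\theta_0-\theta^*\|^2}{N^2(N+1)}+\frac{l}{N}\big(\|\theta^*\|^2+2M^2\big)+\frac{2}{N}\right).$$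
   Context: The problem is $\min_{\theta\in\Omega}F(\theta)$, where $\Omega\subset\mathbb{R}^p$ is the constraint set and $F$ is smooth and possibly non-convex. $F$ is $L$-smooth if $\|\nabla F(\theta_1)-\nabla F(\theta_2)\|\le L\|\theta_1-\theta_2\|$ for all $\theta_1,\theta_2\in\Omega$. $F$ is $l$-lower smooth if $-\frac{l}{2}\|\theta_1-\theta_2\|^2\le F(\theta_1)-F(\theta_2)-\langle\nabla F(\theta_2),\theta_1-\theta_2\rangle$ for all $\theta_1,\theta_2\in\Omega$ (so $L$-smoothness alone gives $l=L$). Define $\psi(x,\omega,\gamma)=\arg\min_{\theta\in\Omega}\langle\omega,\theta\rangle+\frac{1}{2\gamma}\|\theta-x\|^2$, and the gradient mapping $g(x,\omega,\gamma)=\frac1\gamma\big(x-\psi(x,\omega,\gamma)\big)$. It is assumed that $\|\psi(x,\omega,\gamma)\|\le M$ for all $\gamma\in(0,\infty)$, $x\in\Omega$ and $\omega\in\mathbb{R}^p$. Procedure $u^+=condg(w,u,\lambda,\eta)$: set $u_1=u$. For $t=1,2,\dots$: let $v_t$ be an optimal solution of $V(u_t)=\max_{x\in\Omega}\langle w+\frac1\lambda(u_t-u),u_t-x\rangle$; if $V(u_t)\le\eta$, return $u^+=u_t$ and stop; otherwise set $u_{t+1}=(1-\xi_t)u_t+\xi_tv_t$ with $\xi_t=\min\Big\{1,\frac{\langle\frac1\lambda(u-u_t)-w,\,v_t-u_t\rangle}{\frac1\lambda\|v_t-u_t\|^2}\Big\}$. NCGS algorithm with parameters $\alpha_k,\lambda_k,\beta_k,\eta_k,\chi_k$: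 set $\theta_0^{ag}=\theta_0$. For $k=1,\dots,N$: - $\theta_k^{md}=(1-\alpha_k)\theta_{k-1}^{ag}+\alpha_k\theta_{k-1}$; - $\theta_k=condg(\nabla F(\theta_k^{md}),\theta_{k-1},\lambda_k,\eta_k)$; - option I: $\theta_k^{ag}=\theta_k^{md}-\beta_k\frac{\theta_{k-1}-\theta_k}{\lambda_k}$; option II: $\theta_k^{ag}=condg(\nabla F(\theta_k^{md}),\theta_k^{md},\beta_k,\chi_k)$. *)

theory Defs
  imports "HOL-Analysis.Analysis"
begin

text \<open>The gradient is the Riesz representative of the derivative; it is meaningful at points
  where the function is differentiable.\<close>

definition gradient :: "('a::euclidean_space \<Rightarrow> real) \<Rightarrow> 'a \<Rightarrow> 'a" where
  "gradient F x = (THE D. GDERIV F x :> D)"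

lemma GDERIV_gradient:
  assumes "F differentiable (at x)"
  shows "GDERIV F x :> gradient F x"
proof -
  obtain f' where f': "(F has_derivative f') (at x)"
    using assms unfolding differentiable_def by blast
  then have lin: "linear f'"
    by (rule has_derivative_linear)
  define D where "D = adjoint f' 1"
  have f'_eq: "f' = (\<lambda>h. inner h D)"
  proof
    show "f' h = inner h D" for h
      using adjoint_works[OF lin, of h 1] by (simp only: D_def inner_real_def mult_1_right)
  qed
  have D: "GDERIV F x :> D"
    using f' unfolding gderiv_def f'_eq .
  moreover have "D' = D" if "GDERIV F x :> D'" for D'
  proof -
    have "(\<lambda>h. inner h D') = (\<lambda>h. inner h D)"
      using that D unfolding gderiv_def by (rule has_derivative_unique)
    then have "\<forall>h. inner h D' = inner h D"
      by (simp add: fun_eq_iff)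
    then show ?thesis
      by (rule iffD1[OF vector_eq_ldot])
  qed
  ultimately show ?thesis
    unfolding gradient_def by (rule theI)
qed

definition L_smooth_on :: "'a::euclidean_space set \<Rightarrow> ('a \<Rightarrow> real) \<Rightarrow> real \<Rightarrow> bool" where
  "L_smooth_on \<Omega> F L \<longleftrightarrow>
    (\<forall>x\<in>\<Omega>. \<forall>y\<in>\<Omega>. norm (gradient F x - gradient F y) \<le> L * norm (x - y))"

definition lower_smooth_on :: "'a::euclidean_space set \<Rightarrow> ('a \<Rightarrow> real) \<Rightarrow> real \<Rightarrow> bool" where
  "lower_smooth_on \<Omega> F l \<longleftrightarrow>
    (\<forall>x\<in>\<Omega>. \<forall>y\<in>\<Omega>. - (l / 2) * (norm (x - y))\<^sup>2 \<le> F x - F y - inner (gradient F y) (x - y))"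

text \<open>For closed convex nonempty \<open>\<Omega>\<close> and \<open>\<gamma> > 0\<close> the minimiser selected by
  \<open>arg_min_on\<close> exists and is unique.\<close>

definition prox_point :: "'a::euclidean_space set \<Rightarrow> 'a \<Rightarrow> 'a \<Rightarrow> real \<Rightarrow> 'a" where
  "prox_point \<Omega> x \<omega> \<gamma> =
    arg_min_on (\<lambda>\<theta>. inner \<omega> \<theta> + 1 / (2 * \<gamma>) * (norm (\<theta> - x))\<^sup>2) \<Omega>"

definition grad_map :: "'a::euclidean_space set \<Rightarrow> 'a \<Rightarrow> 'a \<Rightarrow> real \<Rightarrow> 'a" where
  "grad_map \<Omega> x \<omega> \<gamma> = (1 / \<gamma>) *\<^sub>R (x - prox_point \<Omega> x \<omega> \<gamma>)"

definition condg_obj :: "'a::euclidean_space \<Rightarrow> 'a \<Rightarrow> real \<Rightarrow> 'a \<Rightarrow> 'a \<Rightarrow> real" where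
  "condg_obj w u lam ut x = inner (w + (1 / lam) *\<^sub>R (ut - u)) (ut - x)"

text \<open>On a nonempty compact \<open>\<Omega>\<close> the supremum is the maximum.\<close>

definition condg_V :: "'a::euclidean_space set \<Rightarrow> 'a \<Rightarrow> 'a \<Rightarrow> real \<Rightarrow> 'a \<Rightarrow> real" where
  "condg_V \<Omega> w u lam ut = (SUP x\<in>\<Omega>. condg_obj w u lam ut x)"

definition condg_step :: "'a::euclidean_space \<Rightarrow> 'a \<Rightarrow> real \<Rightarrow> 'a \<Rightarrow> 'a \<Rightarrow> real" where
  "condg_step w u lam ut v =
    min 1 (inner ((1 / lam) *\<^sub>R (u - ut) - w) (v - ut) / (1 / lam * (norm (v - ut))\<^sup>2))"

text \<open>The linear subproblem may have several optimal solutions and any of them may be chosen, so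
  \<open>condg\<close> is a relation: \<open>condg \<Omega> w u lam \<eta> u'\<close> says that some run of the procedure on input
  \<open>(w, u, lam, \<eta>)\<close> stops and returns \<open>u'\<close>. The points \<open>u\<^sub>t\<close> of the runs are exactly those
  satisfying \<open>condg_iterate\<close>.\<close>

inductive condg_iterate ::
  "'a::euclidean_space set \<Rightarrow> 'a \<Rightarrow> 'a \<Rightarrow> real \<Rightarrow> real \<Rightarrow> 'a \<Rightarrow> bool"
  for \<Omega> w u lam \<eta>
where
  start: "condg_iterate \<Omega> w u lam \<eta> u"
| step: "condg_iterate \<Omega> w u lam \<eta> ut \<Longrightarrow>
    is_arg_max (condg_obj w u lam ut) (\<lambda>x. x \<in> \<Omega>) v \<Longrightarrow>
    \<not> condg_V \<Omega> w u lam ut \<le> \<eta> \<Longrightarrow>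
    \<xi> = condg_step w u lam ut v \<Longrightarrow>
    condg_iterate \<Omega> w u lam \<eta> ((1 - \<xi>) *\<^sub>R ut + \<xi> *\<^sub>R v)"

definition condg ::
  "'a::euclidean_space set \<Rightarrow> 'a \<Rightarrow> 'a \<Rightarrow> real \<Rightarrow> real \<Rightarrow> 'a \<Rightarrow> bool" where
  "condg \<Omega> w u lam \<eta> u' \<longleftrightarrow> condg_iterate \<Omega> w u lam \<eta> u' \<and> condg_V \<Omega> w u lam u' \<le> \<eta>"

datatype ncgs_variant = Option_I | Option_II

text \<open>\<open>\<theta>\<close>, \<open>md\<close>, \<open>ag\<close> are the sequences \<open>\<theta>\<^sub>k\<close>, \<open>\<theta>\<^sub>k\<^sup>m\<^sup>d\<close>, \<open>\<theta>\<^sub>k\<^sup>a\<^sup>g\<close> produced by some run of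
  \<open>N\<close> iterations from \<open>\<theta>0\<close>. Values at indices above \<open>N\<close>, and \<open>md 0\<close>, are irrelevant, and so is
  \<open>chi\<close> for \<open>Option_I\<close>.\<close>

definition ncgs_run ::
  "ncgs_variant \<Rightarrow> 'a::euclidean_space set \<Rightarrow> ('a \<Rightarrow> real) \<Rightarrow>
   (nat \<Rightarrow> real) \<Rightarrow> (nat \<Rightarrow> real) \<Rightarrow> (nat \<Rightarrow> real) \<Rightarrow> (nat \<Rightarrow> real) \<Rightarrow> (nat \<Rightarrow> real) \<Rightarrow>
   nat \<Rightarrow> 'a \<Rightarrow> (nat \<Rightarrow> 'a) \<Rightarrow> (nat \<Rightarrow> 'a) \<Rightarrow> (nat \<Rightarrow> 'a) \<Rightarrow> bool" where
  "ncgs_run opt \<Omega> F \<alpha> lam \<beta> \<eta> chi N \<theta>0 \<theta> md ag \<longleftrightarrow>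
    \<theta> 0 = \<theta>0 \<and> ag 0 = \<theta>0 \<and>
    (\<forall>k\<in>{1..N}.
      md k = (1 - \<alpha> k) *\<^sub>R ag (k - 1) + \<alpha> k *\<^sub>R \<theta> (k - 1) \<and>
      condg \<Omega> (gradient F (md k)) (\<theta> (k - 1)) (lam k) (\<eta> k) (\<theta> k) \<and>
      (case opt of
         Option_I \<Rightarrow> ag k = md k - \<beta> k *\<^sub>R ((1 / lam k) *\<^sub>R (\<theta> (k - 1) - \<theta> k))
       | Option_II \<Rightarrow> condg \<Omega> (gradient F (md k)) (md k) (\<beta> k) (chi k) (ag k)))"

end

theory Submission
  imports Defs
begin

text \<open>
  Option I. Here \<open>md k = \<theta> (k - 1)\<close> and \<open>ag k = \<theta> k\<close>, so the method is an inexact projected gradient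
  descent: the descent lemma bounds the sum of the squared steps, and each step differs from the
  exact projection step by an error controlled by the tolerance.

  Option II. Let \<open>e k = ag k - md k\<close> and let \<open>A k\<close> be \<open>2 / (k + 1)\<close> times the step of \<open>\<theta>\<close>. The usual
  accelerated energy with weights \<open>k (k + 1) / 2\<close> decreases up to the lower curvature and the
  tolerances, and it leaves the slack \<open>|A - e|^2 + |e|^2 / 2 + |A|^2 / k\<close>. This slack does not control
  the gradient mapping when successive steps almost cancel. Two further inequalities exclude that:
  the normal vectors at \<open>ag (k - 1)\<close> and \<open>ag k\<close> are monotone, which is summed by parts with cubic
  weights, and the gradient is cocoercive along the segment from \<open>md (k - 1)\<close> to \<open>md k\<close>, up to the
  factor \<open>ln (1 + R) / R\<close> paid because all test points have to lie in \<open>\<Omega>\<close>. Together they dominate the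
  gradient mapping by a positive semidefinite form at each iteration. This covers \<open>5 \<le> N\<close> and
  \<open>l \<le> L / 2\<close>. For larger \<open>l\<close> and \<open>6 \<le> N\<close> the Lipschitz bound is enough, and for the remaining small \<open>N\<close>
  the gradient mapping is compared with the displacements of \<open>\<theta>\<close>, which the slack bounds directly.
\<close>

text \<open>The gradient increment \<open>\<delta> k\<close> enters linearly in three places:
  against \<open>e\<close> in the decrease of the model, against \<open>P\<close> when
  \<open>\<psi> k\<close> is compared with the previous step of \<open>\<theta>\<close>, and against
  \<open>D\<close> and \<open>e + v\<close> in the monotonicity of the normals. In the refined
  estimate its norm is not bounded; the terms are collected into one direction \<open>w\<close>, and
  this is why cocoercivity is stated with a free direction instead of in its usual quadratic form.
  The multipliers 4/5 and 1/25 of the first and the third source are design parameters. Their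
  quotient is R = 20, and positivity of the form that remains decides the constant in front of the
  gradient mapping. The negative curvature produces terms in \<open>v\<close>. They cost nothing
  beyond |xs|^2 + M^2: \<open>md k\<close> is a convex combination of two points of the ball of
  radius M, so its squared norm falls short of M^2 by a multiple of the squared distance of these
  points, and the shortfall pays for \<open>v\<close>. The cubic weights have to be divided by N + 1
  to be comparable with the quadratic weights of the energy. In the first iterations the term |A|^2
  / k is large, and the form stays positive only because this division leaves most of the slack
  untouched there; hence 5 <= N.\<close>

section \<open>Cocoercivity along segments\<close>

text \<open>A gradient estimate along a segment in \<open>S\<close> needs test points off the segment. For a direction
  with this property the segment can be moved slightly towards \<open>c\<close>, so that small shifts by \<open>w\<close> on
  either side stay in \<open>S\<close>; differences of points of \<open>S\<close> have it, and it is stable under linear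
  combinations.\<close>

definition two_sided :: "'a::real_vector set \<Rightarrow> 'a \<Rightarrow> bool" where
  "two_sided S w \<longleftrightarrow> (\<exists>c r. r > 0 \<and> c + r *\<^sub>R w \<in> S \<and> c - r *\<^sub>R w \<in> S)"

lemma convex_between:
  assumes "convex S" "p + q \<in> S" "p - q \<in> S" "\<bar>a\<bar> \<le> (1::real)"
  shows "p + a *\<^sub>R q \<in> S"
proof -
  have "((1 + a) / 2) *\<^sub>R (p + q) + ((1 - a) / 2) *\<^sub>R (p - q) \<in> S"
    using assms by (intro convexD) (auto simp: field_simps)
  moreover have "((1 + a) / 2) *\<^sub>R (p + q) + ((1 - a) / 2) *\<^sub>R (p - q)
      = ((1 + a) / 2 + (1 - a) / 2) *\<^sub>R p + ((1 + a) / 2 - (1 - a) / 2) *\<^sub>R q"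
    by (simp only: scaleR_add_right scaleR_diff_right scaleR_add_left scaleR_diff_left algebra_simps)
  moreover have "(1 + a) / 2 + (1 - a) / 2 = 1" "(1 + a) / 2 - (1 - a) / 2 = a"
    by (auto simp: field_simps)
  ultimately show ?thesis by simp
qed

lemma two_sided_diff:
  assumes "convex S" "p \<in> S" "q \<in> S"
  shows "two_sided S (p - q)"
proof -
  have "(1/2) *\<^sub>R (p + q) + (1/2) *\<^sub>R (p - q) = p" "(1/2) *\<^sub>R (p + q) - (1/2) *\<^sub>R (p - q) = q"
    by (simp_all flip: scaleR_add_right scaleR_diff_right add: scaleR_2[symmetric])
  then show ?thesis
    unfolding two_sided_def using assms by (metis zero_less_divide_1_iff zero_less_numeral)
qed

lemma two_sided_scaleR:
  assumes "convex S" "two_sided S w"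
  shows "two_sided S (a *\<^sub>R w)"
proof -
  obtain c r where r: "r > 0" "c + r *\<^sub>R w \<in> S" "c - r *\<^sub>R w \<in> S"
    using assms(2) by (auto simp: two_sided_def)
  define t where "t = r / (1 + \<bar>a\<bar>)"
  have t: "t > 0" using r by (simp add: t_def add_pos_nonneg)
  have "\<bar>a / (1 + \<bar>a\<bar>)\<bar> \<le> 1" by (simp add: field_simps)
  then have "c + (a / (1 + \<bar>a\<bar>)) *\<^sub>R (r *\<^sub>R w) \<in> S" "c + (- (a / (1 + \<bar>a\<bar>))) *\<^sub>R (r *\<^sub>R w) \<in> S"
    by (intro convex_between[OF assms(1) r(2,3)]; simp)+
  then have "c + t *\<^sub>R (a *\<^sub>R w) \<in> S" "c - t *\<^sub>R (a *\<^sub>R w) \<in> S"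
    by (simp_all add: t_def mult.commute)
  then show ?thesis using t by (auto simp: two_sided_def)
qed

lemma two_sided_add:
  assumes "convex S" "two_sided S v" "two_sided S w"
  shows "two_sided S (v + w)"
proof -
  obtain c r where r: "r > 0" "c + r *\<^sub>R v \<in> S" "c - r *\<^sub>R v \<in> S"
    using assms(2) by (auto simp: two_sided_def)
  obtain c' r' where r': "r' > 0" "c' + r' *\<^sub>R w \<in> S" "c' - r' *\<^sub>R w \<in> S"
    using assms(3) by (auto simp: two_sided_def)
  define t where "t = min r r'"
  have t: "t > 0" "\<bar>t / r\<bar> \<le> 1" "\<bar>t / r'\<bar> \<le> 1" "\<bar>- (t / r)\<bar> \<le> 1" "\<bar>- (t / r')\<bar> \<le> 1"
    using r(1) r'(1) by (auto simp: t_def field_simps)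
  have a: "c + t *\<^sub>R v \<in> S" "c + (- t) *\<^sub>R v \<in> S" "c' + t *\<^sub>R w \<in> S" "c' + (- t) *\<^sub>R w \<in> S"
    using convex_between[OF assms(1) r(2,3) t(2)] convex_between[OF assms(1) r(2,3) t(4)]
      convex_between[OF assms(1) r'(2,3) t(3)] convex_between[OF assms(1) r'(2,3) t(5)] r(1) r'(1)
    by simp_all
  have "(1/2) *\<^sub>R (c + t *\<^sub>R v) + (1/2) *\<^sub>R (c' + t *\<^sub>R w) \<in> S"
    using a assms(1) by (intro convexD) auto
  moreover have "(1/2) *\<^sub>R (c + (-t) *\<^sub>R v) + (1/2) *\<^sub>R (c' + (-t) *\<^sub>R w) \<in> S"
    using a assms(1) by (intro convexD) auto
  ultimately have "(1/2) *\<^sub>R (c + c') + (t/2) *\<^sub>R (v + w) \<in> S" "(1/2) *\<^sub>R (c + c') - (t/2) *\<^sub>R (v + w) \<in> S"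
    by (simp_all add: algebra_simps)
  then show ?thesis unfolding two_sided_def using t(1) by (meson half_gt_zero)
qed

text \<open>Two upper and two lower bounds at the points \<open>x + h + u/2\<close> and
  \<open>x - u/2\<close> are added, and all values of \<open>f\<close> cancel. For
  \<open>\<kappa> = 0\<close> the choice \<open>u = -2 (G (x + h) - G x)\<close> would give the
  usual cocoercivity, but the test points must lie in \<open>S\<close>, so \<open>u\<close> stays
  free.\<close>

lemma local_cocoercive:
  fixes S :: "'a::real_inner set"
  assumes up: "\<And>x y. x \<in> S \<Longrightarrow> y \<in> S \<Longrightarrow> f y \<le> f x + G x \<bullet> (y - x) + (y - x) \<bullet> (y - x) / 2"
    and low: "\<And>x y. x \<in> S \<Longrightarrow> y \<in> S \<Longrightarrow> f x + G x \<bullet> (y - x) - \<kappa> / 2 * ((y - x) \<bullet> (y - x)) \<le> f y"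
    and mem: "x \<in> S" "x + h \<in> S" "x + h + (1/2) *\<^sub>R u \<in> S" "x - (1/2) *\<^sub>R u \<in> S"
  shows "(G (x + h) - G x) \<bullet> h + (G (x + h) - G x) \<bullet> u
      \<ge> - (1/4) * (u \<bullet> u) - \<kappa> * ((h + (1/2) *\<^sub>R u) \<bullet> (h + (1/2) *\<^sub>R u))"
proof -
  have "f (x + h + (1/2) *\<^sub>R u) \<le> f (x + h) + (1/2) * (G (x + h) \<bullet> u) + (u \<bullet> u) / 8"
    using up[OF mem(2,3)] by simp
  moreover have "f x + G x \<bullet> (h + (1/2) *\<^sub>R u) - \<kappa> / 2 * ((h + (1/2) *\<^sub>R u) \<bullet> (h + (1/2) *\<^sub>R u))
      \<le> f (x + h + (1/2) *\<^sub>R u)"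
    using low[OF mem(1,3)] by (simp add: add.assoc)
  moreover have "f (x - (1/2) *\<^sub>R u) \<le> f x - (1/2) * (G x \<bullet> u) + (u \<bullet> u) / 8"
    using up[OF mem(1,4)] by simp
  moreover have "f (x + h) - G (x + h) \<bullet> (h + (1/2) *\<^sub>R u) - \<kappa> / 2 * ((h + (1/2) *\<^sub>R u) \<bullet> (h + (1/2) *\<^sub>R u))
      \<le> f (x - (1/2) *\<^sub>R u)"
  proof -
    have eq: "x - (1/2) *\<^sub>R u - (x + h) = - (h + (1/2) *\<^sub>R u)" by (simp add: algebra_simps)
    show ?thesis using low[OF mem(2,4)] unfolding eq by (simp only: inner_minus_left inner_minus_right minus_minus)
  qed
  ultimately show ?thesis
    by (simp add: inner_diff_left inner_add_right)
qed

lemma sum_weights: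
  "(\<Sum>i<n. R * (real n - 1 - real i) + real n) = R * (real n * (real n - 1) / 2) + real n * real n"
proof -
  have "(\<Sum>i<n. R * (c - 1 - real i) + d) = R * (real n * (c - 1) - real n * (real n - 1) / 2) + real n * d" for c d
    by (induction n) (auto simp: field_simps)
  from this[of "real n" "real n"] show ?thesis by (simp add: field_simps)
qed

text \<open>In reversed order this is a Riemann sum of 1 / (1 + R t) over [0, 1], whose integral is
  \<open>ln (1 + R) / R\<close>. The integrand decreases, so all terms but the first lie below the
  integral, and the first is the error 1 / n.\<close>

lemma sum_inverse_weights:
  assumes "R > 0" "n > 0"
  shows "(\<Sum>i<n. 1 / (R * (real n - 1 - real i) + real n)) \<le> ln (1 + R) / R + 1 / real n"
proof -
  have "(\<Sum>i<n. 1 / (R * (real n - 1 - real i) + real n)) = (\<Sum>i<n. 1 / (R * real i + real n))"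
  proof (rule sum.reindex_bij_witness[of _ "\<lambda>i. n - 1 - i" "\<lambda>i. n - 1 - i"])
  qed (auto simp: of_nat_diff)
  moreover have "(\<Sum>i<Suc m. 1 / (R * real i + real n)) \<le> 1 / real n + ln ((R * real m + real n) / real n) / R" for m
  proof (induction m)
    case 0
    then show ?case by simp
  next
    case (Suc m)
    have p: "R * real m + real n > 0" "R * real (Suc m) + real n > 0"
      using assms by (auto intro: add_nonneg_pos)
    have "ln ((R * real m + real n) / (R * real (Suc m) + real n)) \<le> (R * real m + real n) / (R * real (Suc m) + real n) - 1"
      using p by (intro ln_le_minus_one) simp
    also have "\<dots> = - R / (R * real (Suc m) + real n)"
      using p by (simp add: field_simps)
    finally have "R / (R * real (Suc m) + real n) \<le> ln (R * real (Suc m) + real n) - ln (R * real m + real n)"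
      using p by (simp add: ln_div)
    then have "1 / (R * real (Suc m) + real n) \<le> (ln (R * real (Suc m) + real n) - ln (R * real m + real n)) / R"
      using assms(1) by (simp add: field_simps)
    moreover have "ln ((R * real (Suc m) + real n) / real n) = ln (R * real (Suc m) + real n) - ln (real n)"
      "ln ((R * real m + real n) / real n) = ln (R * real m + real n) - ln (real n)"
      using p assms by (simp_all add: ln_div del: of_nat_Suc)
    ultimately show ?case using Suc
      by (simp add: diff_divide_distrib add_divide_distrib)
  qed
  from this[of "n - 1"] have "(\<Sum>i<n. 1 / (R * real i + real n)) \<le> 1 / real n + ln ((R * real (n - 1) + real n) / real n) / R"
    using assms by simp
  moreover have "(R * real (n - 1) + real n) / real n \<le> 1 + R"
    using assms by (simp add: field_simps)
  then have "ln ((R * real (n - 1) + real n) / real n) \<le> ln (1 + R)"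
    using assms by (subst ln_le_cancel_iff) (auto intro!: divide_pos_pos add_nonneg_pos)
  then have "ln ((R * real (n - 1) + real n) / real n) / R \<le> ln (1 + R) / R"
    using assms by (simp add: divide_right_mono)
  ultimately show ?thesis by linarith
qed

lemma sum_increments:
  fixes c :: "nat \<Rightarrow> real"
  shows "(\<Sum>i<n. c i - c 0) = (\<Sum>i<n. (real n - 1 - real i) * (c (Suc i) - c i))"
proof (induction n)
  case (Suc n)
  have "(\<Sum>i<n. c (Suc i) - c i) = c n - c 0" by (rule sum_lessThan_telescope)
  moreover have "(\<Sum>i<n. (real n - real i) * (c (Suc i) - c i))
     = (\<Sum>i<n. (real n - 1 - real i) * (c (Suc i) - c i)) + (\<Sum>i<n. c (Suc i) - c i)"
    by (simp add: sum.distrib[symmetric] algebra_simps)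
  ultimately show ?case using Suc by simp
qed simp

text \<open>The segment is cut into \<open>n\<close> pieces, and on the piece \<open>i\<close> the local estimate is used with the
  direction \<open>- w / \<omega> i\<close>. The weights \<open>\<omega> i\<close> are those with which the increments \<open>D i\<close> enter the left-hand
  side, and the sum of their inverses gives the constant \<open>ln (1 + R) / R\<close>.\<close>

lemma segment_cocoercive:
  fixes S :: "'a::real_inner set"
  assumes S: "convex S"
    and up: "\<And>x y. x \<in> S \<Longrightarrow> y \<in> S \<Longrightarrow> f y \<le> f x + G x \<bullet> (y - x) + (y - x) \<bullet> (y - x) / 2"
    and low: "\<And>x y. x \<in> S \<Longrightarrow> y \<in> S \<Longrightarrow> f x + G x \<bullet> (y - x) - \<kappa> / 2 * ((y - x) \<bullet> (y - x)) \<le> f y"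
    and \<kappa>: "\<kappa> \<ge> 0" and R: "R > 0" and n: "n > 0"
    and mem: "x + (1 / real n) *\<^sub>R w \<in> S" "x - (1 / real n) *\<^sub>R w \<in> S"
      "y + (1 / real n) *\<^sub>R w \<in> S" "y - (1 / real n) *\<^sub>R w \<in> S"
  shows "R * (f x - f y - G y \<bullet> (x - y)) + (G y - G x) \<bullet> (y - x) + (G y - G x) \<bullet> w
      \<ge> - (1 + \<kappa>) * (ln (1 + R) / R + 1 / real n) / 4 * (w \<bullet> w) - \<kappa> * ((y - x) \<bullet> w)
        - \<kappa> * (R / 2 + 1) * ((y - x) \<bullet> (y - x))"
proof -
  define h where "h = (1 / real n) *\<^sub>R (x - y)"
  define z where "z i = y + real i *\<^sub>R h" for i
  define D where "D i = G (z (Suc i)) - G (z i)" for i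
  define \<omega> where "\<omega> i = R * (real n - 1 - real i) + real n" for i
  have zn: "z n = x" "z 0 = y" "z (Suc i) = z i + h" for i
  proof -
    show "z n = x" using n by (simp add: z_def h_def)
  qed (simp_all add: z_def algebra_simps)
  have \<omega>: "\<omega> i \<ge> real n" "\<omega> i > 0" if "i < n" for i
  proof -
    have "R * (real n - 1 - real i) \<ge> 0" using that R by (intro mult_nonneg_nonneg) auto
    then show "\<omega> i \<ge> real n" "\<omega> i > 0" using n by (auto simp: \<omega>_def intro: add_nonneg_pos)
  qed
  have zS: "z i + a *\<^sub>R w \<in> S" if "i \<le> n" "\<bar>a\<bar> \<le> 1 / real n" for i a
  proof -
    have "\<bar>a * real n\<bar> \<le> 1" using that(2) n by (simp add: abs_mult field_simps)
    then have "x + (a * real n) *\<^sub>R ((1 / real n) *\<^sub>R w) \<in> S" "y + (a * real n) *\<^sub>R ((1 / real n) *\<^sub>R w) \<in> S"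
      using convex_between[OF S mem(1,2)] convex_between[OF S mem(3,4)] by blast+
    then have "x + a *\<^sub>R w \<in> S" "y + a *\<^sub>R w \<in> S" using n by simp_all
    then have "(real i / real n) *\<^sub>R (x + a *\<^sub>R w) + (1 - real i / real n) *\<^sub>R (y + a *\<^sub>R w) \<in> S"
      using that n S by (intro convexD) (auto simp: field_simps)
    moreover have "(real i / real n) *\<^sub>R (x + a *\<^sub>R w) + (1 - real i / real n) *\<^sub>R (y + a *\<^sub>R w) = z i + a *\<^sub>R w"
      by (simp add: z_def h_def algebra_simps)
    ultimately show ?thesis by simp
  qed
  have zS0: "z i \<in> S" if "i \<le> n" for i using zS[OF that, of 0] by simp
  have loc: "\<omega> i * (D i \<bullet> h) - D i \<bullet> w
      \<ge> - (1 + \<kappa>) / 4 * (w \<bullet> w) * (1 / \<omega> i) - \<kappa> * (\<omega> i * (h \<bullet> h)) + \<kappa> * (h \<bullet> w)" if i: "i < n" for i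
  proof -
    define u where "u = - (1 / \<omega> i) *\<^sub>R w"
    have a: "\<bar>- (1 / (2 * \<omega> i))\<bar> \<le> 1 / real n" "\<bar>1 / (2 * \<omega> i)\<bar> \<le> 1 / real n"
      using \<omega>[OF i] n by (auto simp: field_simps)
    have m: "z i \<in> S" "z i + h \<in> S" "z i + h + (1/2) *\<^sub>R u \<in> S" "z i - (1/2) *\<^sub>R u \<in> S"
      using zS0[of i] zS0[of "Suc i"] i zS[of "Suc i", OF _ a(1)] zS[of i, OF _ a(2)]
      by (auto simp: zn u_def mult.commute)
    have "- (1/4) * (u \<bullet> u) - \<kappa> * ((h + (1/2) *\<^sub>R u) \<bullet> (h + (1/2) *\<^sub>R u)) \<le> D i \<bullet> h + D i \<bullet> u"
      using local_cocoercive[of S f G \<kappa>, OF up low m] by (simp add: D_def zn)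
    moreover have "- (1/4) * (u \<bullet> u) - \<kappa> * ((h + (1/2) *\<^sub>R u) \<bullet> (h + (1/2) *\<^sub>R u))
       = - (1 + \<kappa>) / 4 * (u \<bullet> u) - \<kappa> * (h \<bullet> h) - \<kappa> * (h \<bullet> u)"
      by (simp add: inner_add_left inner_add_right inner_commute field_simps)
    ultimately have "\<omega> i * (- (1 + \<kappa>) / 4 * (u \<bullet> u) - \<kappa> * (h \<bullet> h) - \<kappa> * (h \<bullet> u)) \<le> \<omega> i * (D i \<bullet> h + D i \<bullet> u)"
      using \<omega>[OF i] by (intro mult_left_mono) auto
    moreover have "\<omega> i * (D i \<bullet> h + D i \<bullet> u) = \<omega> i * (D i \<bullet> h) - D i \<bullet> w"
      using \<omega>[OF i] by (simp add: u_def algebra_simps)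
    moreover have "\<omega> i * (- (1 + \<kappa>) / 4 * (u \<bullet> u) - \<kappa> * (h \<bullet> h) - \<kappa> * (h \<bullet> u))
       = - (1 + \<kappa>) / 4 * (w \<bullet> w) * (1 / \<omega> i) - \<kappa> * (\<omega> i * (h \<bullet> h)) + \<kappa> * (h \<bullet> w)"
      using \<omega>[OF i] by (simp add: u_def field_simps)
    ultimately show ?thesis by simp
  qed
  have hn: "real n *\<^sub>R h = x - y" "real n * (h \<bullet> w) = - ((y - x) \<bullet> w)"
    "real n * (real n * (h \<bullet> h)) = (y - x) \<bullet> (y - x)"
    using n by (auto simp: h_def inner_diff_left inner_diff_right inner_commute field_simps)
  have tel: "(\<Sum>i<n. D i) = G x - G y"
    unfolding D_def using sum_lessThan_telescope[of "\<lambda>i. G (z i)" n] by (simp add: zn)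
  \<comment> \<open>\<open>G (z i) - G y\<close> is the sum of the first \<open>i\<close>
    increments, so \<open>D i\<close> is counted once for each later piece, \<open>n - 1 - i\<close>
    times. With the \<open>n\<close> copies from \<open>(G y - G x) \<bullet> (y - x)\<close> this
    produces the weight \<open>\<omega> i\<close>.\<close>
  have low_sum: "f x - f y - G y \<bullet> (x - y) \<ge> (\<Sum>i<n. (real n - 1 - real i) * (D i \<bullet> h)) - real n * (\<kappa> / 2 * (h \<bullet> h))"
  proof -
    have "f (z (Suc i)) - f (z i) \<ge> G (z i) \<bullet> h - \<kappa> / 2 * (h \<bullet> h)" if "i < n" for i
      using low[of "z i" "z (Suc i)"] zS0[of i] zS0[of "Suc i"] that by (simp add: zn)
    then have "(\<Sum>i<n. f (z (Suc i)) - f (z i)) \<ge> (\<Sum>i<n. G (z i) \<bullet> h - \<kappa> / 2 * (h \<bullet> h))"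
      by (intro sum_mono) auto
    moreover have "(\<Sum>i<n. f (z (Suc i)) - f (z i)) = f x - f y"
      by (subst sum_lessThan_telescope) (simp add: zn)
    moreover have "(\<Sum>i<n. G (z i) \<bullet> h - \<kappa> / 2 * (h \<bullet> h))
        = (\<Sum>i<n. G (z i) \<bullet> h - G (z 0) \<bullet> h) + real n * (G y \<bullet> h) - real n * (\<kappa> / 2 * (h \<bullet> h))"
      by (simp add: sum_subtractf zn)
    moreover have "real n * (G y \<bullet> h) = G y \<bullet> (x - y)"
      by (simp flip: hn(1))
    moreover have "(\<Sum>i<n. G (z i) \<bullet> h - G (z 0) \<bullet> h) = (\<Sum>i<n. (real n - 1 - real i) * (D i \<bullet> h))"
      using sum_increments[of "\<lambda>i. G (z i) \<bullet> h" n] by (simp add: D_def inner_diff_left)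
    ultimately show ?thesis by linarith
  qed
  have "(\<Sum>i<n. - (1 + \<kappa>) / 4 * (w \<bullet> w) * (1 / \<omega> i) - \<kappa> * (\<omega> i * (h \<bullet> h)) + \<kappa> * (h \<bullet> w))
      \<le> (\<Sum>i<n. \<omega> i * (D i \<bullet> h) - D i \<bullet> w)"
    using loc by (intro sum_mono) auto
  also have "\<dots> = R * (\<Sum>i<n. (real n - 1 - real i) * (D i \<bullet> h)) + real n * (\<Sum>i<n. D i \<bullet> h) - (\<Sum>i<n. D i \<bullet> w)"
    by (simp add: \<omega>_def sum_subtractf sum.distrib algebra_simps sum_distrib_left)
  also have "\<dots> = R * (\<Sum>i<n. (real n - 1 - real i) * (D i \<bullet> h)) + (G y - G x) \<bullet> (y - x) + (G y - G x) \<bullet> w"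
  proof -
    have "real n * (\<Sum>i<n. D i \<bullet> h) = (G x - G y) \<bullet> (real n *\<^sub>R h)"
      by (simp add: tel flip: inner_sum_left)
    moreover have "(\<Sum>i<n. D i \<bullet> w) = (G x - G y) \<bullet> w"
      by (simp add: tel flip: inner_sum_left)
    ultimately show ?thesis by (simp add: hn(1) inner_diff_left inner_diff_right)
  qed
  also have "(\<Sum>i<n. - (1 + \<kappa>) / 4 * (w \<bullet> w) * (1 / \<omega> i) - \<kappa> * (\<omega> i * (h \<bullet> h)) + \<kappa> * (h \<bullet> w))
     = - (1 + \<kappa>) / 4 * (w \<bullet> w) * (\<Sum>i<n. 1 / \<omega> i) - \<kappa> * ((h \<bullet> h) * (\<Sum>i<n. \<omega> i)) + \<kappa> * (real n * (h \<bullet> w))"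
    unfolding sum_subtractf sum.distrib sum_distrib_left[symmetric] sum_distrib_right[symmetric]
    by (simp add: mult_ac)
  finally have main: "- (1 + \<kappa>) / 4 * (w \<bullet> w) * (\<Sum>i<n. 1 / \<omega> i) - \<kappa> * ((h \<bullet> h) * (\<Sum>i<n. \<omega> i)) + \<kappa> * (real n * (h \<bullet> w))
     \<le> R * (\<Sum>i<n. (real n - 1 - real i) * (D i \<bullet> h)) + (G y - G x) \<bullet> (y - x) + (G y - G x) \<bullet> w" .
  have "(1 + \<kappa>) / 4 * (w \<bullet> w) * (\<Sum>i<n. 1 / \<omega> i) \<le> (1 + \<kappa>) / 4 * (w \<bullet> w) * (ln (1 + R) / R + 1 / real n)"
    unfolding \<omega>_def using sum_inverse_weights[OF R n] \<kappa> by (intro mult_left_mono) auto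
  moreover have "\<kappa> * ((h \<bullet> h) * (\<Sum>i<n. \<omega> i)) + R * (real n * (\<kappa> / 2 * (h \<bullet> h)))
      = \<kappa> * (R / 2 + 1) * ((y - x) \<bullet> (y - x))"
    unfolding \<omega>_def sum_weights hn(3)[symmetric] by (simp add: field_simps)
  moreover have "R * (f x - f y - G y \<bullet> (x - y))
     \<ge> R * ((\<Sum>i<n. (real n - 1 - real i) * (D i \<bullet> h)) - real n * (\<kappa> / 2 * (h \<bullet> h)))"
    using low_sum R by (intro mult_left_mono) auto
  moreover have neg: "- (1 + \<kappa>) * a / 4 * b = - ((1 + \<kappa>) / 4 * b * a)" for a b
    by (simp add: field_simps)
  moreover have "R * ((\<Sum>i<n. (real n - 1 - real i) * (D i \<bullet> h)) - real n * (\<kappa> / 2 * (h \<bullet> h)))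
      = R * (\<Sum>i<n. (real n - 1 - real i) * (D i \<bullet> h)) - R * (real n * (\<kappa> / 2 * (h \<bullet> h)))"
    by (rule right_diff_distrib)
  moreover have "\<kappa> * (real n * (h \<bullet> w)) = - (\<kappa> * ((y - x) \<bullet> w))"
    by (simp add: hn(2))
  moreover have "- (1 + \<kappa>) * (ln (1 + R) / R + 1 / real n) / 4 * (w \<bullet> w)
      = - ((1 + \<kappa>) / 4 * (w \<bullet> w) * (ln (1 + R) / R + 1 / real n))"
    by (rule neg)
  moreover have "- (1 + \<kappa>) / 4 * (w \<bullet> w) * (\<Sum>i<n. 1 / \<omega> i) = - ((1 + \<kappa>) / 4 * (w \<bullet> w) * (\<Sum>i<n. 1 / \<omega> i))"
    by (simp only: mult_minus_left minus_divide_left[symmetric])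
  ultimately show ?thesis using main by linarith
qed

text \<open>Limit of \<open>segment_cocoercive\<close>. Moving both endpoints by the fraction
  \<open>t m\<close> towards \<open>c\<close> makes room for shifts along \<open>w\<close> of order
  \<open>t m\<close>, so the number of pieces may grow like 1 / \<open>t m\<close> and the error 1 /
  n disappears.\<close>

lemma weighted_cocoercive:
  fixes S :: "'a::real_inner set"
  assumes S: "convex S"
    and up: "\<And>x y. x \<in> S \<Longrightarrow> y \<in> S \<Longrightarrow> f y \<le> f x + G x \<bullet> (y - x) + (y - x) \<bullet> (y - x) / 2"
    and low: "\<And>x y. x \<in> S \<Longrightarrow> y \<in> S \<Longrightarrow> f x + G x \<bullet> (y - x) - \<kappa> / 2 * ((y - x) \<bullet> (y - x)) \<le> f y"
    and cont: "continuous_on S f" "continuous_on S G"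
    and \<kappa>: "\<kappa> \<ge> 0" and R: "R > 0" and mem: "x \<in> S" "y \<in> S" and w: "two_sided S w"
  shows "R * (f x - f y - G y \<bullet> (x - y)) + (G y - G x) \<bullet> (y - x) + (G y - G x) \<bullet> w
      \<ge> - (1 + \<kappa>) * (ln (1 + R) / R) / 4 * (w \<bullet> w) - \<kappa> * ((y - x) \<bullet> w)
        - \<kappa> * (R / 2 + 1) * ((y - x) \<bullet> (y - x))"
proof -
  obtain c r where r: "r > 0" "c + r *\<^sub>R w \<in> S" "c - r *\<^sub>R w \<in> S"
    using w by (auto simp: two_sided_def)
  have cS: "c \<in> S" using convex_between[OF S r(2,3), of 0] by simp
  obtain n0 where n0: "n0 > 0" "1 / real n0 \<le> r"
    using r(1) by (metis less_imp_le nat_approx_posE zero_less_Suc)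
  define t where "t m = 1 / real (Suc m)" for m
  define X where "X m = (1 - t m) *\<^sub>R x + t m *\<^sub>R c" for m
  define Y where "Y m = (1 - t m) *\<^sub>R y + t m *\<^sub>R c" for m
  have t: "0 \<le> t m" "t m \<le> 1" for m by (auto simp: t_def)
  have XS: "X m \<in> S" "Y m \<in> S" for m
    unfolding X_def Y_def using t[of m] S mem cS by (auto intro!: convexD)
  have t0: "t \<longlonglongrightarrow> 0" unfolding t_def by (rule LIMSEQ_Suc[OF lim_1_over_n])
  have Xl: "X \<longlonglongrightarrow> x" "Y \<longlonglongrightarrow> y"
    unfolding X_def Y_def by (rule tendsto_eq_intros t0 refl | simp)+
  \<comment> \<open>The shift \<open>w / n0\<close> allowed at \<open>c\<close> shrinks by the same
    factor \<open>t m\<close> with which \<open>c\<close> is mixed in; this fixes the number of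
    pieces as \<open>n0 * Suc m\<close>.\<close>
  have shift: "(1 - t m) *\<^sub>R p + t m *\<^sub>R c + (1 / real (n0 * Suc m)) *\<^sub>R w \<in> S"
    "(1 - t m) *\<^sub>R p + t m *\<^sub>R c - (1 / real (n0 * Suc m)) *\<^sub>R w \<in> S" if "p \<in> S" for p m
  proof -
    have "\<bar>1 / (r * real n0)\<bar> \<le> 1" "\<bar>- (1 / (r * real n0))\<bar> \<le> 1"
      using n0 r(1) by (auto simp: field_simps abs_mult)
    then have "c + (1 / (r * real n0)) *\<^sub>R (r *\<^sub>R w) \<in> S" "c + (- (1 / (r * real n0))) *\<^sub>R (r *\<^sub>R w) \<in> S"
      by (blast intro: convex_between[OF S r(2,3)])+
    then have "c + (1 / real n0) *\<^sub>R w \<in> S" "c + (- (1 / real n0)) *\<^sub>R w \<in> S" using r(1) by simp_all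
    then have "(1 - t m) *\<^sub>R p + t m *\<^sub>R (c + (1 / real n0) *\<^sub>R w) \<in> S"
        "(1 - t m) *\<^sub>R p + t m *\<^sub>R (c + (- (1 / real n0)) *\<^sub>R w) \<in> S"
      using t[of m] S that by (auto intro!: convexD)
    then show "(1 - t m) *\<^sub>R p + t m *\<^sub>R c + (1 / real (n0 * Suc m)) *\<^sub>R w \<in> S"
      "(1 - t m) *\<^sub>R p + t m *\<^sub>R c - (1 / real (n0 * Suc m)) *\<^sub>R w \<in> S"
      by (simp_all add: t_def algebra_simps)
  qed
  have fl: "(\<lambda>m. f (X m)) \<longlonglongrightarrow> f x" "(\<lambda>m. f (Y m)) \<longlonglongrightarrow> f y"
    "(\<lambda>m. G (X m)) \<longlonglongrightarrow> G x" "(\<lambda>m. G (Y m)) \<longlonglongrightarrow> G y"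
    using XS Xl mem by (auto intro!: continuous_on_tendsto_compose[OF cont(1)] continuous_on_tendsto_compose[OF cont(2)])
  have nl: "(\<lambda>m. 1 / real (n0 * Suc m)) \<longlonglongrightarrow> 0"
  proof -
    have "(\<lambda>m. (1 / real n0) * t m) \<longlonglongrightarrow> (1 / real n0) * 0" by (intro tendsto_mult tendsto_const t0)
    then show ?thesis by (simp only: t_def mult_zero_right of_nat_mult times_divide_times_eq mult_1)
  qed
  show ?thesis
  proof (rule LIMSEQ_le)
    show "\<exists>M. \<forall>m\<ge>M. - (1 + \<kappa>) * (ln (1 + R) / R + 1 / real (n0 * Suc m)) / 4 * (w \<bullet> w) - \<kappa> * ((Y m - X m) \<bullet> w)
        - \<kappa> * (R / 2 + 1) * ((Y m - X m) \<bullet> (Y m - X m))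
       \<le> R * (f (X m) - f (Y m) - G (Y m) \<bullet> (X m - Y m)) + (G (Y m) - G (X m)) \<bullet> (Y m - X m) + (G (Y m) - G (X m)) \<bullet> w"
    proof (intro exI allI impI)
      fix m :: nat
      show "- (1 + \<kappa>) * (ln (1 + R) / R + 1 / real (n0 * Suc m)) / 4 * (w \<bullet> w) - \<kappa> * ((Y m - X m) \<bullet> w)
        - \<kappa> * (R / 2 + 1) * ((Y m - X m) \<bullet> (Y m - X m))
       \<le> R * (f (X m) - f (Y m) - G (Y m) \<bullet> (X m - Y m)) + (G (Y m) - G (X m)) \<bullet> (Y m - X m) + (G (Y m) - G (X m)) \<bullet> w"
        using n0(1) shift[OF mem(1), of m] shift[OF mem(2), of m]
        by (intro segment_cocoercive[OF S up low \<kappa> R]) (auto simp: X_def Y_def)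
    qed
  next
    show "(\<lambda>m. - (1 + \<kappa>) * (ln (1 + R) / R + 1 / real (n0 * Suc m)) / 4 * (w \<bullet> w) - \<kappa> * ((Y m - X m) \<bullet> w)
        - \<kappa> * (R / 2 + 1) * ((Y m - X m) \<bullet> (Y m - X m)))
       \<longlonglongrightarrow> - (1 + \<kappa>) * (ln (1 + R) / R) / 4 * (w \<bullet> w) - \<kappa> * ((y - x) \<bullet> w) - \<kappa> * (R / 2 + 1) * ((y - x) \<bullet> (y - x))"
      by (rule tendsto_eq_intros Xl nl refl | simp)+
  next
    show "(\<lambda>m. R * (f (X m) - f (Y m) - G (Y m) \<bullet> (X m - Y m)) + (G (Y m) - G (X m)) \<bullet> (Y m - X m) + (G (Y m) - G (X m)) \<bullet> w)
       \<longlonglongrightarrow> R * (f x - f y - G y \<bullet> (x - y)) + (G y - G x) \<bullet> (y - x) + (G y - G x) \<bullet> w"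
      by (intro tendsto_intros Xl fl)
  qed
qed

section \<open>Positive semidefinite forms\<close>

text \<open>The quadratic form left over in one iteration after weighted cocoercivity is applied with
  \<open>R = 20\<close> (so \<open>ln 21 / 20 \<le> 77/500\<close>) in the direction \<open>w\<close>; \<open>A\<close>, \<open>e\<close>, \<open>v\<close> stand for the vectors
  of those names below, \<open>D\<close> for the increment of \<open>e\<close> and \<open>P\<close> for the rescaled gradient mapping. It is
  affine in each parameter, so positivity is checked at the corners, where the explicit sums of
  squares are \<open>LDL\<close> factorisations.\<close>

definition step_form :: "real \<Rightarrow> real \<Rightarrow> real \<Rightarrow> real \<Rightarrow> 'a::real_inner \<Rightarrow> 'a \<Rightarrow> 'a \<Rightarrow> 'a \<Rightarrow> 'a \<Rightarrow> real" where
  "step_form \<kappa> \<tau> s K A e D v P =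
    (1 + s) * ((A - e) \<bullet> (A - e) + e \<bullet> e / 2) + 2/5 * (e \<bullet> e) + 24/25 * \<tau> * (A \<bullet> A) - 2/25 * (e \<bullet> A)
    + (D \<bullet> D) / 25 + 9/10 * \<kappa> * (v \<bullet> v) + 2 * (1 + \<tau>) * (A \<bullet> P) + K * (P \<bullet> P)
    - (let w = D - 20 *\<^sub>R e - 25 *\<^sub>R P; u = e + v
       in (1 + \<kappa>) * (77/2000) * (w \<bullet> w) + \<kappa> * (u \<bullet> w) + 11 * \<kappa> * (u \<bullet> u)) / 25"

text \<open>The squared norm of \<open>a A + b e + c D + d v + p P\<close>, kept multiplied out so
  that the factorisations below become linear identities in fifteen inner products.\<close>

definition square_form :: "real \<Rightarrow> real \<Rightarrow> real \<Rightarrow> real \<Rightarrow> real \<Rightarrow> 'a::real_inner \<Rightarrow> 'a \<Rightarrow> 'a \<Rightarrow> 'a \<Rightarrow> 'a \<Rightarrow> real" where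
  "square_form a b c d p A e D v P =
    a * a * (A \<bullet> A) + b * b * (e \<bullet> e) + c * c * (D \<bullet> D) + d * d * (v \<bullet> v) + p * p * (P \<bullet> P)
    + 2 * (a * b) * (A \<bullet> e) + 2 * (a * c) * (A \<bullet> D) + 2 * (a * d) * (A \<bullet> v) + 2 * (a * p) * (A \<bullet> P)
    + 2 * (b * c) * (e \<bullet> D) + 2 * (b * d) * (e \<bullet> v) + 2 * (b * p) * (e \<bullet> P)
    + 2 * (c * d) * (D \<bullet> v) + 2 * (c * p) * (D \<bullet> P) + 2 * (d * p) * (v \<bullet> P)"

lemma square_form_nonneg: "0 \<le> square_form a b c d p A e D v P"
proof -
  define z where "z = a *\<^sub>R A + b *\<^sub>R e + c *\<^sub>R D + d *\<^sub>R v + p *\<^sub>R P"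
  have "0 \<le> z \<bullet> z" by simp
  then show ?thesis
    unfolding z_def square_form_def inner_add_left inner_add_right inner_scaleR_left inner_scaleR_right
    by (simp add: inner_commute algebra_simps)
qed

lemma step_form_expand:
  fixes A e D v P :: "'a::real_inner"
  shows "step_form \<kappa> \<tau> s K A e D v P =
    (1 + s) * (A \<bullet> A - 2 * (A \<bullet> e) + 3/2 * (e \<bullet> e)) + 2/5 * (e \<bullet> e) + 24/25 * \<tau> * (A \<bullet> A) - 2/25 * (A \<bullet> e)
    + (D \<bullet> D) / 25 + 9/10 * \<kappa> * (v \<bullet> v) + 2 * (1 + \<tau>) * (A \<bullet> P) + K * (P \<bullet> P)
    - (1 + \<kappa>) * (77/50000) * (D \<bullet> D + 400 * (e \<bullet> e) + 625 * (P \<bullet> P) - 40 * (e \<bullet> D) - 50 * (D \<bullet> P) + 1000 * (e \<bullet> P))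
    - \<kappa> / 25 * (e \<bullet> D + D \<bullet> v - 20 * (e \<bullet> e) - 20 * (e \<bullet> v) - 25 * (e \<bullet> P) - 25 * (v \<bullet> P))
    - 11 / 25 * \<kappa> * (e \<bullet> e + 2 * (e \<bullet> v) + v \<bullet> v)"
  unfolding step_form_def Let_def inner_add_left inner_add_right inner_diff_left inner_diff_right inner_scaleR_left inner_scaleR_right
  by (simp add: inner_commute field_simps)

text \<open>\<open>P\<close> is eliminated last, so the coefficient of \<open>P \<bullet> P\<close>
  enters only the last pivot. For either curvature this pivot is smallest at
  \<open>\<tau> = s = 1\<close>, where it is barely positive; that corner governs the choice of
  261/100 and 67/20.\<close>

lemma step_form_vertices:
  fixes A e D v P :: "'a::real_inner"
  shows "0 \<le> step_form 0 0 0 (261/100) A e D v P"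
    and "0 \<le> step_form 0 (1/4) 0 (261/100) A e D v P"
    and "0 \<le> step_form 0 1 1 (261/100) A e D v P"
    and "0 \<le> step_form (1/2) 0 0 (67/20) A e D v P"
    and "0 \<le> step_form (1/2) (1/4) 0 (67/20) A e D v P"
    and "0 \<le> step_form (1/2) 1 1 (67/20) A e D v P"
proof -
  note expand = step_form_expand square_form_def
  show "0 \<le> step_form 0 0 0 (261/100) A e D v P"
  proof -
    have "step_form 0 0 0 (261/100) A e D v P =
      1923/50000 * square_form (0) (1540/1923) (1) (0) (1925/1923) A e D v P
      + 1 * square_form (1) (-26/25) (0) (0) (1) A e D v P
      + 427229/2403750 * square_form (0) (1) (0) (0) (574900/427229) A e D v P
      + 12266769/42722900 * square_form (0) (0) (0) (0) (1) A e D v P"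
      unfolding expand by (simp add: algebra_simps add_divide_distrib diff_divide_distrib)
    then show ?thesis by (simp add: square_form_nonneg)
  qed
  show "0 \<le> step_form 0 (1/4) 0 (261/100) A e D v P"
  proof -
    have "step_form 0 (1/4) 0 (261/100) A e D v P =
      1923/50000 * square_form (0) (1540/1923) (1) (0) (1925/1923) A e D v P
      + 31/25 * square_form (1) (-26/31) (0) (0) (125/124) A e D v P
      + 1153739/2980650 * square_form (0) (1) (0) (0) (737875/1153739) A e D v P
      + 87940391/461495600 * square_form (0) (0) (0) (0) (1) A e D v P"
      unfolding expand by (simp add: algebra_simps add_divide_distrib diff_divide_distrib)
    then show ?thesis by (simp add: square_form_nonneg)
  qed
  show "0 \<le> step_form 0 1 1 (261/100) A e D v P"
  proof -
    have "step_form 0 1 1 (261/100) A e D v P =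
      1923/50000 * square_form (0) (1540/1923) (1) (0) (1925/1923) A e D v P
      + 74/25 * square_form (1) (-51/74) (0) (0) (25/37) A e D v P
      + 4814747/3557550 * square_form (0) (1) (0) (0) (2054650/4814747) A e D v P
      + 5366467/481474700 * square_form (0) (0) (0) (0) (1) A e D v P"
      unfolding expand by (simp add: algebra_simps add_divide_distrib diff_divide_distrib)
    then show ?thesis by (simp add: square_form_nonneg)
  qed
  show "0 \<le> step_form (1/2) 0 0 (67/20) A e D v P"
  proof -
    have "step_form (1/2) 0 0 (67/20) A e D v P =
      3769/100000 * square_form (0) (3620/3769) (1) (-1000/3769) (5775/3769) A e D v P
      + 85687/376900 * square_form (0) (-3918/85687) (0) (1) (100000/85687) A e D v P
      + 1 * square_form (1) (-26/25) (0) (0) (1) A e D v P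
      + 2096963/53554375 * square_form (0) (1) (0) (0) (4909050/2096963) A e D v P
      + 12310521/41939260 * square_form (0) (0) (0) (0) (1) A e D v P"
      unfolding expand by (simp add: algebra_simps add_divide_distrib diff_divide_distrib)
    then show ?thesis by (simp add: square_form_nonneg)
  qed
  show "0 \<le> step_form (1/2) (1/4) 0 (67/20) A e D v P"
  proof -
    have "step_form (1/2) (1/4) 0 (67/20) A e D v P =
      3769/100000 * square_form (0) (3620/3769) (1) (-1000/3769) (5775/3769) A e D v P
      + 85687/376900 * square_form (0) (-3918/85687) (0) (1) (100000/85687) A e D v P
      + 31/25 * square_form (1) (-26/31) (0) (0) (125/124) A e D v P
      + 16502093/66407425 * square_form (0) (1) (0) (0) (13288375/33004186) A e D v P
      + 274275049/1320167440 * square_form (0) (0) (0) (0) (1) A e D v P"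
      unfolding expand by (simp add: algebra_simps add_divide_distrib diff_divide_distrib)
    then show ?thesis by (simp add: square_form_nonneg)
  qed
  show "0 \<le> step_form (1/2) 1 1 (67/20) A e D v P"
  proof -
    have "step_form (1/2) 1 1 (67/20) A e D v P =
      3769/100000 * square_form (0) (3620/3769) (1) (-1000/3769) (5775/3769) A e D v P
      + 85687/376900 * square_form (0) (-3918/85687) (0) (1) (100000/85687) A e D v P
      + 74/25 * square_form (1) (-51/74) (0) (0) (25/37) A e D v P
      + 96286404/79260475 * square_form (0) (1) (0) (0) (34085425/96286404) A e D v P
      + 545848/120358005 * square_form (0) (0) (0) (0) (1) A e D v P"
      unfolding expand by (simp add: algebra_simps add_divide_distrib diff_divide_distrib)
    then show ?thesis by (simp add: square_form_nonneg)
  qed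
qed

text \<open>The form increases with \<open>s\<close>, so only the lower boundary of the admissible
  region matters. It is a broken line in the plane of \<open>(\<tau>, s)\<close> with vertices (0,
  0), (1/4, 0), (1, 1), along whose pieces the form is affine.\<close>

lemma step_form_nonneg:
  fixes A e D v P :: "'a::real_inner"
  assumes "0 \<le> \<kappa>" "\<kappa> \<le> 1/2" "0 \<le> \<tau>" "\<tau> \<le> 1" "0 \<le> s" "4 * \<tau> - 1 \<le> 3 * s"
  shows "0 \<le> step_form \<kappa> \<tau> s (261/100 + 37/25 * \<kappa>) A e D v P"
proof -
  have aff: "step_form k ((1 - a) * t1 + a * t2) ((1 - a) * s1 + a * s2) K A e D v P
      = (1 - a) * step_form k t1 s1 K A e D v P + a * step_form k t2 s2 K A e D v P" for k a t1 t2 s1 s2 K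
    unfolding step_form_expand by (simp add: field_simps)
  have pos: "0 \<le> step_form k \<tau> s K A e D v P"
    if v: "0 \<le> step_form k 0 0 K A e D v P" "0 \<le> step_form k (1/4) 0 K A e D v P" "0 \<le> step_form k 1 1 K A e D v P" for k K
  proof -
    define b where "b = max 0 (4/3 * (\<tau> - 1/4))"
    have "0 \<le> step_form k \<tau> b K A e D v P"
    proof (cases "\<tau> \<le> 1/4")
      case True
      have "step_form k \<tau> b K A e D v P = (1 - 4 * \<tau>) * step_form k 0 0 K A e D v P + 4 * \<tau> * step_form k (1/4) 0 K A e D v P"
        using aff[of k "4 * \<tau>" 0 "1/4" 0 0 K] True by (simp add: b_def)
      then show ?thesis using v True assms(3) by simp
    next
      case False
      define a where "a = 4/3 * (\<tau> - 1/4)"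
      have "\<tau> = (1 - a) * (1/4) + a * 1" by (simp add: a_def field_simps)
      then have "step_form k \<tau> b K A e D v P = (1 - a) * step_form k (1/4) 0 K A e D v P + a * step_form k 1 1 K A e D v P"
        using aff[of k a "1/4" 1 0 1 K] False by (simp add: b_def a_def)
      moreover have "0 \<le> a" "a \<le> 1" using False assms(4) by (auto simp: a_def)
      ultimately show ?thesis using v by simp
    qed
    also have "\<dots> \<le> step_form k \<tau> s K A e D v P"
    proof -
      have "b \<le> s" using assms by (auto simp: b_def)
      then have "(1 + b) * ((A - e) \<bullet> (A - e) + e \<bullet> e / 2) \<le> (1 + s) * ((A - e) \<bullet> (A - e) + e \<bullet> e / 2)"
        by (intro mult_right_mono) (auto intro: add_nonneg_nonneg)
      then show ?thesis unfolding step_form_def by linarith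
    qed
    finally show ?thesis .
  qed
  \<comment> \<open>The constant is affine in \<open>\<kappa>\<close>, with value 67/20 at 1/2, so
    the form stays affine in \<open>\<kappa>\<close> when the constant moves along.\<close>
  have "step_form \<kappa> \<tau> s (261/100 + 37/25 * \<kappa>) A e D v P
      = (1 - 2 * \<kappa>) * step_form 0 \<tau> s (261/100) A e D v P + 2 * \<kappa> * step_form (1/2) \<tau> s (67/20) A e D v P"
    unfolding step_form_expand by (simp add: field_simps)
  moreover have "0 \<le> step_form 0 \<tau> s (261/100) A e D v P" "0 \<le> step_form (1/2) \<tau> s (67/20) A e D v P"
    by (intro pos step_form_vertices)+
  ultimately show ?thesis using assms by simp
qed

text \<open>The analogue for \<open>1/2 \<le> \<kappa>\<close>, where the Lipschitz bound on the gradient increment, now called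
  \<open>D\<close>, replaces cocoercivity.\<close>

definition coarse_form :: "real \<Rightarrow> real \<Rightarrow> real \<Rightarrow> 'a::real_inner \<Rightarrow> 'a \<Rightarrow> 'a \<Rightarrow> 'a \<Rightarrow> 'a \<Rightarrow> real" where
  "coarse_form \<kappa> \<tau> K A e D v P =
    (A - e) \<bullet> (A - e) + 13/20 * (e \<bullet> e) + \<tau> * (A \<bullet> A) - 3/10 * (D \<bullet> e) + 2/25 * (D \<bullet> D)
    - (3/20 * \<kappa> + 2/25) * ((e + v) \<bullet> (e + v)) + 13/20 * \<kappa> * (v \<bullet> v)
    + 2 * (1 + \<tau>) * (A \<bullet> P) - D \<bullet> P + K * (P \<bullet> P)"

lemma coarse_form_expand:
  fixes A e D v P :: "'a::real_inner"
  shows "coarse_form \<kappa> \<tau> K A e D v P =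
    A \<bullet> A - 2 * (A \<bullet> e) + 33/20 * (e \<bullet> e) + \<tau> * (A \<bullet> A) - 3/10 * (e \<bullet> D) + 2/25 * (D \<bullet> D)
    - (3/20 * \<kappa> + 2/25) * (e \<bullet> e + 2 * (e \<bullet> v) + v \<bullet> v) + 13/20 * \<kappa> * (v \<bullet> v)
    + 2 * (1 + \<tau>) * (A \<bullet> P) - D \<bullet> P + K * (P \<bullet> P)"
  unfolding coarse_form_def inner_add_left inner_add_right inner_diff_left inner_diff_right
  by (simp add: inner_commute field_simps)

lemma coarse_form_vertices:
  fixes A e D v P :: "'a::real_inner"
  shows "0 \<le> coarse_form (1/2) 0 (419/100) A e D v P"
    and "0 \<le> coarse_form (1/2) 1 (257/50) A e D v P"
    and "0 \<le> coarse_form 1 0 (111/25) A e D v P"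
    and "0 \<le> coarse_form 1 1 (257/50) A e D v P"
proof -
  note expand = coarse_form_expand square_form_def
  show "0 \<le> coarse_form (1/2) 0 (419/100) A e D v P"
  proof -
    have "coarse_form (1/2) 0 (419/100) A e D v P =
      17/100 * square_form (0) (-31/34) (0) (1) (0) A e D v P
      + 2/25 * square_form (0) (-15/8) (1) (0) (-25/4) A e D v P
      + 1 * square_form (1) (-1) (0) (0) (1) A e D v P
      + 197/2720 * square_form (0) (1) (0) (0) (170/197) A e D v P
      + 109/9850 * square_form (0) (0) (0) (0) (1) A e D v P"
      unfolding expand by (simp add: field_simps)
    then show ?thesis by (simp add: square_form_nonneg)
  qed
  show "0 \<le> coarse_form (1/2) 1 (257/50) A e D v P"
  proof -
    have "coarse_form (1/2) 1 (257/50) A e D v P =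
      17/100 * square_form (0) (-31/34) (0) (1) (0) A e D v P
      + 2/25 * square_form (0) (-15/8) (1) (0) (-25/4) A e D v P
      + 2 * square_form (1) (-1/2) (0) (0) (1) A e D v P
      + 1557/2720 * square_form (0) (1) (0) (0) (170/1557) A e D v P
      + 1273/155700 * square_form (0) (0) (0) (0) (1) A e D v P"
      unfolding expand by (simp add: field_simps)
    then show ?thesis by (simp add: square_form_nonneg)
  qed
  show "0 \<le> coarse_form 1 0 (111/25) A e D v P"
  proof -
    have "coarse_form 1 0 (111/25) A e D v P =
      21/50 * square_form (0) (-23/42) (0) (1) (0) A e D v P
      + 2/25 * square_form (0) (-15/8) (1) (0) (-25/4) A e D v P
      + 1 * square_form (1) (-1) (0) (0) (1) A e D v P
      + 43/3360 * square_form (0) (1) (0) (0) (210/43) A e D v P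
      + 21/2150 * square_form (0) (0) (0) (0) (1) A e D v P"
      unfolding expand by (simp add: field_simps)
    then show ?thesis by (simp add: square_form_nonneg)
  qed
  show "0 \<le> coarse_form 1 1 (257/50) A e D v P"
  proof -
    have "coarse_form 1 1 (257/50) A e D v P =
      21/50 * square_form (0) (-23/42) (0) (1) (0) A e D v P
      + 2/25 * square_form (0) (-15/8) (1) (0) (-25/4) A e D v P
      + 2 * square_form (1) (-1/2) (0) (0) (1) A e D v P
      + 1723/3360 * square_form (0) (1) (0) (0) (210/1723) A e D v P
      + 318/43075 * square_form (0) (0) (0) (0) (1) A e D v P"
      unfolding expand by (simp add: field_simps)
    then show ?thesis by (simp add: square_form_nonneg)
  qed
qed

text \<open>The constant contains the product of \<open>\<kappa>\<close> and \<open>\<tau>\<close>,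
  but it is affine in each of them. Bilinear interpolation therefore reproduces the form from the
  four corners.\<close>

lemma coarse_form_nonneg:
  fixes A e D v P :: "'a::real_inner"
  assumes "1/2 \<le> \<kappa>" "\<kappa> \<le> 1" "0 \<le> \<tau>" "\<tau> \<le> 1"
  shows "0 \<le> coarse_form \<kappa> \<tau> (197/50 + \<kappa> / 2 + (6/5 - \<kappa> / 2) * \<tau>) A e D v P"
proof -
  have "coarse_form \<kappa> \<tau> (197/50 + \<kappa> / 2 + (6/5 - \<kappa> / 2) * \<tau>) A e D v P
     = (2 - 2 * \<kappa>) * ((1 - \<tau>) * coarse_form (1/2) 0 (419/100) A e D v P + \<tau> * coarse_form (1/2) 1 (257/50) A e D v P)
     + (2 * \<kappa> - 1) * ((1 - \<tau>) * coarse_form 1 0 (111/25) A e D v P + \<tau> * coarse_form 1 1 (257/50) A e D v P)"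
    unfolding coarse_form_expand by (simp add: field_simps)
  moreover have "0 \<le> \<dots>"
    using assms by (intro add_nonneg_nonneg mult_nonneg_nonneg coarse_form_vertices) auto
  ultimately show ?thesis by simp
qed

section \<open>The normalised iteration\<close>

text \<open>The energy after \<open>k\<close> iterations carries \<open>W (Suc k)\<close>, that is k
  (k + 1) / 2. Since \<open>W 1 = 0\<close>, nothing is required of function values at the
  start.\<close>

definition W :: "nat \<Rightarrow> real" where "W k = real k * (real k - 1) / 2"

lemma W_nonneg: "0 \<le> W k"
  by (cases k) (auto simp: W_def)

text \<open>Option II rescaled to \<open>L = 1\<close>: here \<open>f = F / L\<close>, \<open>G\<close> is the gradient of \<open>f\<close>, \<open>\<kappa> = min l L / L\<close>,
  \<open>\<epsilon> = 1 / (N L)\<close>, and \<open>\<psi> k\<close> is the projection point defining the gradient mapping. Only the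
  approximate variational inequalities certified by the stopping rule are kept of the inner loop.\<close>

locale ncgs_normalized =
  fixes S :: "'a::real_inner set" and f :: "'a \<Rightarrow> real" and G :: "'a \<Rightarrow> 'a"
    and \<kappa> M \<epsilon> :: real and N :: nat and \<theta> md ag \<psi> :: "nat \<Rightarrow> 'a" and xs :: 'a
  assumes conv: "convex S"
    and up: "\<And>x y. x \<in> S \<Longrightarrow> y \<in> S \<Longrightarrow> f y \<le> f x + G x \<bullet> (y - x) + (y - x) \<bullet> (y - x) / 2"
    and low: "\<And>x y. x \<in> S \<Longrightarrow> y \<in> S \<Longrightarrow> f x + G x \<bullet> (y - x) - \<kappa> / 2 * ((y - x) \<bullet> (y - x)) \<le> f y"
    and lip: "\<And>x y. x \<in> S \<Longrightarrow> y \<in> S \<Longrightarrow> norm (G x - G y) \<le> norm (x - y)"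
    and contf: "continuous_on S f"
    and \<kappa>: "0 \<le> \<kappa>" "\<kappa> \<le> 1" and \<epsilon>: "0 \<le> \<epsilon>"
    and bound: "\<And>x. x \<in> S \<Longrightarrow> norm x \<le> M"
    and start: "ag 0 = \<theta> 0"
    and \<theta>_mem: "\<And>k. k \<le> N \<Longrightarrow> \<theta> k \<in> S" and ag_mem: "\<And>k. k \<le> N \<Longrightarrow> ag k \<in> S"
    and md_eq: "\<And>k. k < N \<Longrightarrow> md (Suc k) = (1 - 2 / (real k + 2)) *\<^sub>R ag k + (2 / (real k + 2)) *\<^sub>R \<theta> k"
    and \<theta>_opt: "\<And>k x. k < N \<Longrightarrow> x \<in> S \<Longrightarrow>
      (G (md (Suc k)) + (4 / (real k + 1)) *\<^sub>R (\<theta> (Suc k) - \<theta> k)) \<bullet> (\<theta> (Suc k) - x) \<le> \<epsilon>"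
    and ag_opt: "\<And>k x. k < N \<Longrightarrow> x \<in> S \<Longrightarrow>
      (G (md (Suc k)) + 2 *\<^sub>R (ag (Suc k) - md (Suc k))) \<bullet> (ag (Suc k) - x) \<le> \<epsilon>"
    and \<psi>_mem: "\<And>k. k < N \<Longrightarrow> \<psi> (Suc k) \<in> S"
    and \<psi>_opt: "\<And>k x. k < N \<Longrightarrow> x \<in> S \<Longrightarrow>
      (G (md (Suc k)) + 2 *\<^sub>R (\<psi> (Suc k) - \<theta> k)) \<bullet> (\<psi> (Suc k) - x) \<le> 0"
    and xs_mem: "xs \<in> S" and xs_min: "\<And>x. x \<in> S \<Longrightarrow> f xs \<le> f x"
begin

section \<open>Energy and its decrease\<close>

definition e where "e k = ag k - md k"
definition A where "A k = (2 / (real k + 1)) *\<^sub>R (\<theta> k - \<theta> (k - 1))"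
definition v where "v k = md k - ag (k - 1)"
text \<open>The quadratic upper model at \<open>md k\<close>, evaluated at \<open>ag k\<close>. With
  it in place of \<open>f (ag k)\<close> the energy involves \<open>f\<close> only at the points
  \<open>md\<close>, which makes \<open>model_eq\<close> an identity.\<close>

definition B where "B k = f (md k) + G (md k) \<bullet> e k + (e k \<bullet> e k) / 2"
definition cost where
  "cost k = (A k - e k) \<bullet> (A k - e k) + (e k \<bullet> e k) / 2 + (A k \<bullet> A k) / real k"
definition energy where
  "energy k = W (Suc k) * (B k - f xs) + 2 * ((\<theta> k - xs) \<bullet> (\<theta> k - xs))"
definition budget where
  "budget k = 2 * ((\<theta> 0 - xs) \<bullet> (\<theta> 0 - xs)) + \<kappa> * (real k * (real k + 1) / 2) * (xs \<bullet> xs + M\<^sup>2)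
     + \<epsilon> * (real k * (real k + 1) * (real k + 5) / 6)"
definition model where "model k = f (md k) + G (md k) \<bullet> (ag (k - 1) - md k)"
definition \<delta> where "\<delta> k = G (md k) - G (md (k - 1))"
text \<open>The Bregman divergence of \<open>f\<close> between consecutive points \<open>md\<close>;
  it is the term multiplied by \<open>R\<close> in \<open>weighted_cocoercive\<close>.\<close>

definition Q where "Q k = f (md (k - 1)) - f (md k) - G (md k) \<bullet> (md (k - 1) - md k)"

lemma md_mem: "k < N \<Longrightarrow> md (Suc k) \<in> S"
  using convexD[OF conv ag_mem[of k] \<theta>_mem[of k], of "1 - 2 / (real k + 2)" "2 / (real k + 2)"] md_eq[of k]
  by simp

lemma inner_le_M: "x \<in> S \<Longrightarrow> x \<bullet> x \<le> M\<^sup>2"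
  using bound[of x] by (simp add: power2_norm_eq_inner[symmetric] power_mono)

lemma v_eq: "k < N \<Longrightarrow> v (Suc k) = (2 / (real k + 2)) *\<^sub>R (\<theta> k - ag k)"
  using md_eq[of k] by (simp add: v_def algebra_simps)

lemma B_ge: assumes "k < N" shows "f (ag (Suc k)) \<le> B (Suc k)"
  using up[OF md_mem[OF assms] ag_mem[of "Suc k"]] assms by (simp add: B_def e_def)

lemma cost_nonneg: "0 \<le> cost k"
  unfolding cost_def by (intro add_nonneg_nonneg) auto

text \<open>An estimate-sequence step. The step size 1 / (2 L) regularises with twice the curvature
  of the upper model. This surplus and the term 2 |d|^2 of the three-point identity for
  \<open>\<theta>\<close> combine into \<open>cost\<close>, which is kept instead of being
  dropped.\<close>

lemma energy_step:
  assumes k: "k < N"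
  shows "energy (Suc k) + W (Suc (Suc k)) * cost (Suc k) \<le> W (Suc k) * (model (Suc k) - f xs)
    + 2 * ((\<theta> k - xs) \<bullet> (\<theta> k - xs))
    + (real k + 1) * (\<kappa> / 2 * ((xs - md (Suc k)) \<bullet> (xs - md (Suc k))))
    + (W (Suc (Suc k)) + (real k + 1)) * \<epsilon>"
proof -
  define K where "K = real k + 1"
  define g where "g = G (md (Suc k))"
  define a where "a = A (Suc k)"
  define ee where "ee = e (Suc k)"
  define d where "d = \<theta> (Suc k) - \<theta> k"
  define w where "w = W (Suc (Suc k))"
  have K: "K > 0" by (simp add: K_def)
  have w: "w = K * (K + 1) / 2" "w \<ge> 0" "W (Suc k) = w - K"
    by (auto simp: w_def K_def W_def field_simps)
  have a: "a = (2 / (K + 1)) *\<^sub>R d" by (simp add: a_def A_def d_def K_def add.commute)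
  have "(K + 1) / 2 * (2 / (K + 1)) = 1" using K by simp
  then have da: "d = ((K + 1) / 2) *\<^sub>R a" by (simp only: a scaleR_scaleR scaleR_one)
  \<comment> \<open>Test point for \<open>ag (Suc k)\<close>: the convex combination that defines
    \<open>md (Suc k)\<close>, with \<open>\<theta> k\<close> replaced by its successor. Its
    difference from \<open>ag (Suc k)\<close> is \<open>e - A\<close>.\<close>
  have x: "(1 - 2 / (K + 1)) *\<^sub>R ag k + (2 / (K + 1)) *\<^sub>R \<theta> (Suc k) \<in> S"
    using K k by (intro convexD[OF conv ag_mem \<theta>_mem]) (auto simp: K_def)
  have md: "md (Suc k) = (1 - 2 / (K + 1)) *\<^sub>R ag k + (2 / (K + 1)) *\<^sub>R \<theta> k"
    using md_eq[OF k] by (simp add: K_def add.assoc)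
  have diff: "ag (Suc k) - ((1 - 2 / (K + 1)) *\<^sub>R ag k + (2 / (K + 1)) *\<^sub>R \<theta> (Suc k)) = ee - a"
    unfolding ee_def e_def md a d_def by (simp add: algebra_simps)
  have "(g + 2 *\<^sub>R ee) \<bullet> (ee - a) \<le> \<epsilon>"
    using ag_opt[OF k x] unfolding diff by (simp add: g_def ee_def e_def)
  then have "w * (g \<bullet> ee - g \<bullet> a + 2 * (ee \<bullet> ee) - 2 * (ee \<bullet> a)) \<le> w * \<epsilon>"
    using w(2) by (intro mult_left_mono) (auto simp: inner_simps algebra_simps)
  moreover have "(g + (4 / K) *\<^sub>R d) \<bullet> (\<theta> (Suc k) - xs) \<le> \<epsilon>"
    using \<theta>_opt[OF k xs_mem] by (simp add: g_def d_def K_def)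
  then have "K * (g \<bullet> \<theta> (Suc k) - g \<bullet> xs) + 4 * (d \<bullet> (\<theta> (Suc k) - xs)) \<le> K * \<epsilon>"
    using K mult_left_mono[of _ \<epsilon> K] by (fastforce simp: inner_simps algebra_simps)
  moreover have "4 * (d \<bullet> (\<theta> (Suc k) - xs)) = 2 * ((\<theta> (Suc k) - xs) \<bullet> (\<theta> (Suc k) - xs))
      - 2 * ((\<theta> k - xs) \<bullet> (\<theta> k - xs)) + 2 * (d \<bullet> d)"
    unfolding d_def by (simp add: inner_simps inner_commute algebra_simps)
  moreover have "2 * (d \<bullet> d) = w * ((a \<bullet> a) + (a \<bullet> a) / K)"
    using K unfolding da w(1) by (simp add: field_simps)
  moreover have "w * (g \<bullet> a) = K * (g \<bullet> \<theta> (Suc k) - g \<bullet> \<theta> k)"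
  proof -
    have "w * (2 / (K + 1)) = K" using K by (simp add: w(1))
    then have "w * ((2 / (K + 1)) * (g \<bullet> d)) = K * (g \<bullet> d)" by (simp only: mult.assoc[symmetric])
    then show ?thesis by (simp add: a d_def inner_diff_right)
  qed
  moreover have "(w - K) * (g \<bullet> ag k) + K * (g \<bullet> \<theta> k) = w * (g \<bullet> md (Suc k))"
  proof -
    have "w * (1 - 2 / (K + 1)) = w - K" "w * (2 / (K + 1)) = K" using K by (simp_all add: w(1) field_simps)
    then have "(w * (1 - 2 / (K + 1))) * (g \<bullet> ag k) + (w * (2 / (K + 1))) * (g \<bullet> \<theta> k)
        = (w - K) * (g \<bullet> ag k) + K * (g \<bullet> \<theta> k)" by (simp only:)
    then show ?thesis by (simp add: md inner_add_right distrib_left mult.assoc)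
  qed
  moreover have "K * (f (md (Suc k)) + g \<bullet> xs - g \<bullet> md (Suc k) - \<kappa> / 2 * ((xs - md (Suc k)) \<bullet> (xs - md (Suc k)))) \<le> K * f xs"
    using low[OF md_mem[OF k] xs_mem] K by (intro mult_left_mono) (auto simp: inner_simps g_def)
  ultimately have *: "w * (f (md (Suc k)) + g \<bullet> ee + (ee \<bullet> ee) / 2 - f xs) + 2 * ((\<theta> (Suc k) - xs) \<bullet> (\<theta> (Suc k) - xs))
     + w * ((ee \<bullet> ee) / 2 + (a \<bullet> a + ee \<bullet> ee - 2 * (ee \<bullet> a)) + (a \<bullet> a) / K)
    \<le> (w - K) * (f (md (Suc k)) + (g \<bullet> ag k - g \<bullet> md (Suc k)) - f xs) + 2 * ((\<theta> k - xs) \<bullet> (\<theta> k - xs))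
     + K * (\<kappa> / 2 * ((xs - md (Suc k)) \<bullet> (xs - md (Suc k)))) + (w + K) * \<epsilon>"
    by (simp add: algebra_simps)
  have "cost (Suc k) = (ee \<bullet> ee) / 2 + (a \<bullet> a + ee \<bullet> ee - 2 * (ee \<bullet> a)) + (a \<bullet> a) / K"
    unfolding cost_def a_def ee_def K_def by (simp add: inner_simps inner_commute add.commute)
  then show ?thesis
    using * unfolding energy_def B_def model_def w(3) w_def[symmetric] g_def[symmetric] ee_def[symmetric] K_def[symmetric]
    by (simp only: diff_Suc_1 inner_diff_right[of g])
qed

lemma model_le: assumes "Suc k < N"
  shows "model (Suc (Suc k)) \<le> B (Suc k) + \<kappa> / 2 * (v (Suc (Suc k)) \<bullet> v (Suc (Suc k)))"
proof -
  have eq: "ag (Suc k) - md (Suc (Suc k)) = - v (Suc (Suc k))" by (simp add: v_def)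
  show ?thesis
    using low[OF md_mem[OF assms] ag_mem[of "Suc k"]] B_ge[of k] assms
    by (simp add: model_def eq)
qed

text \<open>Exact counterpart of \<open>model_le\<close>. The bracket is the additional decrease of
  the energy, and it is where \<open>\<delta> \<bullet> e\<close> and \<open>Q\<close> come
  from.\<close>

lemma model_eq: "model (Suc (Suc k)) = B (Suc k)
    - ((e (Suc k) \<bullet> e (Suc k)) / 2 - \<delta> (Suc (Suc k)) \<bullet> e (Suc k) + Q (Suc (Suc k)))"
  by (simp add: model_def B_def Q_def \<delta>_def e_def inner_simps)

lemma Q_ge: assumes "Suc k < N"
  shows "Q (Suc (Suc k)) \<ge> - (\<kappa> / 2 * ((e (Suc k) + v (Suc (Suc k))) \<bullet> (e (Suc k) + v (Suc (Suc k)))))"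
proof -
  have eq: "md (Suc k) - md (Suc (Suc k)) = - (e (Suc k) + v (Suc (Suc k)))" by (simp add: e_def v_def)
  have "f (md (Suc (Suc k))) + G (md (Suc (Suc k))) \<bullet> (md (Suc k) - md (Suc (Suc k)))
      - \<kappa> / 2 * ((e (Suc k) + v (Suc (Suc k))) \<bullet> (e (Suc k) + v (Suc (Suc k)))) \<le> f (md (Suc k))"
    using low[OF md_mem[OF assms] md_mem[of k]] assms unfolding eq inner_minus_left inner_minus_right by simp
  then show ?thesis by (simp add: Q_def)
qed

text \<open>The shortfall M^2 - |md|^2 dominates a multiple of |\<theta> - ag|^2, and its product
  with k + 1 dominates \<open>W (Suc k)\<close> |v|^2. The other term costs at most |xs|^2 + |md|^2,
  by |xs - md|^2 <= 2 |xs|^2 + 2 |md|^2. At \<open>c = 2\<close> the two occurrences of |md|^2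
  cancel completely, hence the upper limit on \<open>c\<close>.\<close>

lemma charge:
  assumes k: "k < N" and c: "0 \<le> c" "c \<le> 2"
  shows "(real k + 1) * (\<kappa> / 2 * ((xs - md (Suc k)) \<bullet> (xs - md (Suc k))))
    + c * (\<kappa> / 2) * (W (Suc k) * (v (Suc k) \<bullet> v (Suc k))) \<le> \<kappa> * ((real k + 1) * (xs \<bullet> xs + M\<^sup>2))"
proof -
  define K where "K = real k + 1"
  define m where "m = md (Suc k)"
  have K: "K > 0" by (simp add: K_def)
  have "0 \<le> (xs + m) \<bullet> (xs + m)" by simp
  then have 1: "(xs - m) \<bullet> (xs - m) \<le> 2 * (xs \<bullet> xs) + 2 * (m \<bullet> m)"
    by (simp add: inner_simps inner_commute)
  have convex_comb: "((1 - a) *\<^sub>R p + a *\<^sub>R q) \<bullet> ((1 - a) *\<^sub>R p + a *\<^sub>R q)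
      = (1 - a) * (p \<bullet> p) + a * (q \<bullet> q) - a * (1 - a) * ((q - p) \<bullet> (q - p))" for a and p q :: 'a
    by (simp add: inner_simps inner_commute algebra_simps)
  have md: "m = (1 - 2 / (K + 1)) *\<^sub>R ag k + (2 / (K + 1)) *\<^sub>R \<theta> k"
    using md_eq[OF k] by (simp add: K_def m_def add.assoc)
  have "m \<bullet> m = (1 - 2 / (K + 1)) * (ag k \<bullet> ag k) + 2 / (K + 1) * (\<theta> k \<bullet> \<theta> k)
      - (2 / (K + 1)) * (1 - 2 / (K + 1)) * ((\<theta> k - ag k) \<bullet> (\<theta> k - ag k))"
    unfolding md by (rule convex_comb)
  moreover have "(1 - 2 / (K + 1)) * (ag k \<bullet> ag k) + 2 / (K + 1) * (\<theta> k \<bullet> \<theta> k)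
      \<le> (1 - 2 / (K + 1)) * M\<^sup>2 + 2 / (K + 1) * M\<^sup>2"
    using K inner_le_M[OF ag_mem[of k]] inner_le_M[OF \<theta>_mem[of k]] k
    by (intro add_mono mult_left_mono) (auto simp: field_simps K_def)
  moreover have "(1 - 2 / (K + 1)) * M\<^sup>2 + 2 / (K + 1) * M\<^sup>2 = M\<^sup>2" by (simp add: algebra_simps)
  ultimately have 2: "(2 / (K + 1)) * (1 - 2 / (K + 1)) * ((\<theta> k - ag k) \<bullet> (\<theta> k - ag k)) \<le> M\<^sup>2 - m \<bullet> m"
    by linarith
  have "W (Suc k) * (v (Suc k) \<bullet> v (Suc k)) = K * ((2 / (K + 1)) * (1 - 2 / (K + 1)) * ((\<theta> k - ag k) \<bullet> (\<theta> k - ag k)))"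
  proof -
    have "W (Suc k) * ((2 / (K + 1)) * (2 / (K + 1))) = K * ((2 / (K + 1)) * (1 - 2 / (K + 1)))"
    proof -
      define t where "t = 2 / (K + 1)"
      have "K * t = 2 - t" using K by (simp add: t_def field_simps)
      moreover have "W (Suc k) = K * (K - 1) / 2" by (simp add: W_def K_def)
      ultimately show ?thesis unfolding t_def[symmetric] by algebra
    qed
    moreover have "v (Suc k) \<bullet> v (Suc k) = (2 / (K + 1)) * (2 / (K + 1)) * ((\<theta> k - ag k) \<bullet> (\<theta> k - ag k))"
      by (simp add: v_eq[OF k] K_def add.assoc)
    ultimately show ?thesis by (simp only: mult.assoc[symmetric])
  qed
  also have "\<dots> \<le> K * (M\<^sup>2 - m \<bullet> m)" using 2 K by (intro mult_left_mono) auto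
  finally have 3: "W (Suc k) * (v (Suc k) \<bullet> v (Suc k)) \<le> K * (M\<^sup>2 - m \<bullet> m)" .
  have nn: "0 \<le> M\<^sup>2 - m \<bullet> m" using inner_le_M[OF md_mem[OF k]] by (simp add: m_def)
  have "c * (\<kappa> / 2) * (W (Suc k) * (v (Suc k) \<bullet> v (Suc k))) \<le> 2 * (\<kappa> / 2) * (K * (M\<^sup>2 - m \<bullet> m))"
    using c \<kappa> W_nonneg[of "Suc k"] by (intro mult_mono[OF _ 3]) (auto simp: mult.commute[of c] intro: mult_left_mono)
  moreover have "K * (\<kappa> / 2 * ((xs - m) \<bullet> (xs - m))) \<le> K * (\<kappa> / 2 * (2 * (xs \<bullet> xs) + 2 * (m \<bullet> m)))"
    using 1 K \<kappa> by (intro mult_left_mono) auto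
  ultimately show ?thesis unfolding K_def[symmetric] m_def[symmetric] by (simp add: algebra_simps)
qed

lemma budget_Suc: "budget (Suc k) = budget k + \<kappa> * ((real k + 1) * (xs \<bullet> xs + M\<^sup>2))
    + (W (Suc (Suc k)) + (real k + 1)) * \<epsilon>"
  by (simp add: budget_def W_def field_simps)

lemma budget_mono: "j \<le> k \<Longrightarrow> budget j \<le> budget k"
proof (rule lift_Suc_mono_le[of budget])
  show "budget n \<le> budget (Suc n)" for n
    unfolding budget_Suc using \<kappa> \<epsilon> W_nonneg[of "Suc (Suc n)"] by (auto intro!: mult_nonneg_nonneg)
qed

lemma energy_bound:
  "k \<le> N \<Longrightarrow> energy k + (\<Sum>j=1..k. W (Suc j) * cost j) \<le> budget k"
proof (induction k)
  case 0
  then show ?case by (simp add: energy_def budget_def W_def)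
next
  case (Suc k)
  then have k: "k < N" by simp
  have "W (Suc k) * (model (Suc k) - f xs) \<le> W (Suc k) * (B k - f xs) + \<kappa> / 2 * (W (Suc k) * (v (Suc k) \<bullet> v (Suc k)))"
  proof (cases k)
    case (Suc j)
    have "W (Suc k) * model (Suc k) \<le> W (Suc k) * (B k + \<kappa> / 2 * (v (Suc k) \<bullet> v (Suc k)))"
      using model_le[of j] k Suc W_nonneg by (intro mult_left_mono) auto
    then show ?thesis by (simp add: algebra_simps)
  qed (simp add: W_def)
  \<comment> \<open>Only \<open>c = 1\<close> is spent here, the amount lost in
    \<open>model_le\<close>. The refined estimates draw on the rest.\<close>
  moreover have "(real k + 1) * (\<kappa> / 2 * ((xs - md (Suc k)) \<bullet> (xs - md (Suc k))))
    + 1 * (\<kappa> / 2) * (W (Suc k) * (v (Suc k) \<bullet> v (Suc k))) \<le> \<kappa> * ((real k + 1) * (xs \<bullet> xs + M\<^sup>2))"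
    by (rule charge[OF k]) auto
  ultimately show ?case
    using energy_step[OF k] Suc.IH k unfolding budget_Suc energy_def[of k] by simp
qed

lemma energy_nonneg: assumes "k \<le> N" shows "0 \<le> W (Suc k) * (B k - f xs)"
proof (cases k)
  case (Suc j)
  then show ?thesis
    using B_ge[of j] xs_min[OF ag_mem[of k]] assms W_nonneg by (intro mult_nonneg_nonneg) auto
qed (simp add: W_def)

lemma cost_sum_le: "k \<le> N \<Longrightarrow> 2 * ((\<theta> k - xs) \<bullet> (\<theta> k - xs)) + (\<Sum>j=1..k. W (Suc j) * cost j) \<le> budget k"
  using energy_bound[of k] energy_nonneg[of k] by (simp add: energy_def)

section \<open>A priori distances, monotone normals and the prox inequality\<close>

definition P where "P k = \<theta> (k - 1) - \<psi> k"
text \<open>\<open>J\<close> is the boundary term in the summation by parts of the monotonicity of the normal vectors at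
  consecutive points \<open>ag k\<close>. The extra factor \<open>k + 1\<close> in its weight cancels the contribution of \<open>v\<close>.\<close>

definition J where "J k = W k * (real k + 1) * (e k \<bullet> e k + 2 * (e k \<bullet> v k))"

lemma contG: "continuous_on S G"
  unfolding continuous_on_iff
proof (intro ballI allI impI)
  fix x and r :: real assume x: "x \<in> S" and r: "0 < r"
  show "\<exists>d>0. \<forall>x'\<in>S. dist x' x < d \<longrightarrow> dist (G x') (G x) < r"
    using r lip[OF _ x] by (intro exI[of _ r]) (auto simp: dist_norm intro: order.strict_trans1)
qed

lemma budget_nonneg: "0 \<le> budget k"
  using \<kappa> \<epsilon> by (auto simp: budget_def intro!: add_nonneg_nonneg mult_nonneg_nonneg)

text \<open>3/4 is a rational upper bound of 1 / sqrt 2. This and the next distance estimates serve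
  to control the boundary term \<open>J N\<close>.\<close>

lemma dist_\<theta>: assumes "k \<le> N" shows "norm (\<theta> k - xs) \<le> 3/4 * sqrt (budget N)"
proof -
  have "(\<Sum>j=1..k. W (Suc j) * cost j) \<ge> 0"
    by (intro sum_nonneg mult_nonneg_nonneg W_nonneg cost_nonneg)
  then have "2 * (norm (\<theta> k - xs))\<^sup>2 \<le> budget N"
    using cost_sum_le[OF assms] budget_mono[OF assms] by (simp add: power2_norm_eq_inner)
  then have "(norm (\<theta> k - xs))\<^sup>2 \<le> (3/4 * sqrt (budget N))\<^sup>2"
    using budget_nonneg[of N] by (simp add: power_mult_distrib power2_eq_square)
  then show ?thesis by (rule power2_le_imp_le) (use budget_nonneg in auto)
qed

lemma cost_le: assumes "1 \<le> k" "k \<le> N" shows "W (Suc k) * cost k \<le> budget N"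
proof -
  have "W (Suc k) * cost k \<le> (\<Sum>j=1..k. W (Suc j) * cost j)"
    using assms by (intro member_le_sum mult_nonneg_nonneg W_nonneg cost_nonneg) auto
  moreover have "0 \<le> 2 * ((\<theta> k - xs) \<bullet> (\<theta> k - xs))" by simp
  ultimately show ?thesis using cost_sum_le[OF assms(2)] budget_mono[OF assms(2)] by linarith
qed

lemma norm_e: assumes "k < N" shows "norm (e (Suc k)) \<le> 3 / (real k + 2) * sqrt (budget N)"
proof -
  have W: "W (Suc (Suc k)) = (real k + 1) * (real k + 2) / 2" by (simp add: W_def algebra_simps)
  have "(e (Suc k) \<bullet> e (Suc k)) / 2 \<le> cost (Suc k)"
    unfolding cost_def by simp
  then have "W (Suc (Suc k)) * ((e (Suc k) \<bullet> e (Suc k)) / 2) \<le> W (Suc (Suc k)) * cost (Suc k)"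
    by (intro mult_left_mono W_nonneg)
  from order_trans[OF this cost_le] have 1: "(real k + 1) * (real k + 2) / 2 * ((e (Suc k) \<bullet> e (Suc k)) / 2) \<le> budget N"
    using assms unfolding W by simp
  \<comment> \<open>4/9 (k + 2) <= k + 1 makes the weight a perfect square, with equal decay in
    \<open>k\<close>.\<close>
  have "4/9 * (real k + 2) * (real k + 2) \<le> (real k + 1) * (real k + 2)"
    by (intro mult_right_mono) auto
  then have "4/9 * (real k + 2) * (real k + 2) * (e (Suc k) \<bullet> e (Suc k)) \<le> (real k + 1) * (real k + 2) * (e (Suc k) \<bullet> e (Suc k))"
    by (rule mult_right_mono) simp
  then have "(real k + 2) * (real k + 2) * (e (Suc k) \<bullet> e (Suc k)) \<le> 9 * budget N"
    using 1 by argo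
  then have "(real k + 2)\<^sup>2 * (norm (e (Suc k)))\<^sup>2 \<le> 9 * budget N"
    by (simp add: power2_norm_eq_inner power2_eq_square[of "real k + 2"])
  then have "((real k + 2) * norm (e (Suc k)))\<^sup>2 \<le> (3 * sqrt (budget N))\<^sup>2"
    using budget_nonneg by (simp add: power_mult_distrib)
  then have "(real k + 2) * norm (e (Suc k)) \<le> 3 * sqrt (budget N)"
    by (rule power2_le_imp_le) (use budget_nonneg in auto)
  then show ?thesis by (simp add: field_simps)
qed

text \<open>Each iteration averages with weight \<open>t\<close> towards a point at distance at most
  3/4 and adds an error of at most 3/2 t, in units of \<open>sqrt (budget N)\<close>. The recursion
  has the fixed point 3/4 + 3/2 = 9/4.\<close>

lemma dist_ag: "k \<le> N \<Longrightarrow> norm (ag k - xs) \<le> 9/4 * sqrt (budget N)"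
proof (induction k)
  case 0
  have "0 \<le> sqrt (budget N)" using budget_nonneg by simp
  then show ?case using dist_\<theta>[of 0] unfolding start by linarith
next
  case (Suc k)
  define t where "t = 2 / (real k + 2)"
  have t: "0 \<le> t" "t \<le> 1" by (auto simp: t_def)
  have "ag (Suc k) - xs = (1 - t) *\<^sub>R (ag k - xs) + t *\<^sub>R (\<theta> k - xs) + e (Suc k)"
    using md_eq[of k] Suc.prems by (simp add: e_def t_def algebra_simps)
  then have "norm (ag (Suc k) - xs) \<le> norm ((1 - t) *\<^sub>R (ag k - xs)) + norm (t *\<^sub>R (\<theta> k - xs)) + norm (e (Suc k))"
    by (metis norm_triangle_ineq norm_triangle_le add_right_mono)
  also have "\<dots> \<le> (1 - t) * (9/4 * sqrt (budget N)) + t * (3/4 * sqrt (budget N)) + 3/2 * t * sqrt (budget N)"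
  proof -
    have "norm ((1 - t) *\<^sub>R (ag k - xs)) \<le> (1 - t) * (9/4 * sqrt (budget N))"
      using Suc t by (simp del: times_divide_eq_left add: mult_left_mono)
    moreover have "norm (t *\<^sub>R (\<theta> k - xs)) \<le> t * (3/4 * sqrt (budget N))"
      using dist_\<theta>[of k] Suc.prems t by (simp del: times_divide_eq_left add: mult_left_mono)
    moreover have "norm (e (Suc k)) \<le> 3/2 * t * sqrt (budget N)"
      using norm_e[of k] Suc.prems by (simp add: t_def)
    ultimately show ?thesis by linarith
  qed
  also have "\<dots> = 9/4 * sqrt (budget N)" by (simp add: field_simps)
  finally show ?case .
qed

lemma dist_\<theta>_ag: assumes "k \<le> N" shows "(\<theta> k - ag k) \<bullet> (\<theta> k - ag k) \<le> 9 * budget N"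
proof -
  have "norm (\<theta> k - ag k) \<le> norm (\<theta> k - xs) + norm (ag k - xs)"
    using norm_triangle_ineq4[of "\<theta> k - xs" "ag k - xs"] by simp
  also have "\<dots> \<le> 3 * sqrt (budget N)" using dist_\<theta>[OF assms] dist_ag[OF assms] by linarith
  finally have "(norm (\<theta> k - ag k))\<^sup>2 \<le> (3 * sqrt (budget N))\<^sup>2" by (rule power_mono) simp
  then show ?thesis using budget_nonneg by (simp add: power_mult_distrib power2_norm_eq_inner)
qed

text \<open>Eliminates \<open>\<theta>\<close> and \<open>ag\<close>, so that the summation by parts
  involves only \<open>e\<close>, \<open>v\<close> and \<open>A\<close>.\<close>

lemma v_rec: assumes "Suc j < N"
  shows "(real j + 3) *\<^sub>R v (Suc (Suc j)) = real j *\<^sub>R v (Suc j) + (real j + 2) *\<^sub>R A (Suc j) - 2 *\<^sub>R e (Suc j)"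
proof -
  have 1: "(real j + 3) *\<^sub>R v (Suc (Suc j)) = 2 *\<^sub>R (\<theta> (Suc j) - ag (Suc j))"
  proof -
    have "v (Suc (Suc j)) = (2 / (real j + 3)) *\<^sub>R (\<theta> (Suc j) - ag (Suc j))"
      using v_eq[OF assms] by (simp add: add.commute)
    moreover have "(real j + 3) * (2 / (real j + 3)) = 2" by (simp add: field_simps)
    ultimately show ?thesis by (simp only: scaleR_scaleR)
  qed
  have 2: "(real j + 2) *\<^sub>R v (Suc j) = 2 *\<^sub>R (\<theta> j - ag j)"
  proof -
    have "v (Suc j) = (2 / (real j + 2)) *\<^sub>R (\<theta> j - ag j)" using v_eq[of j] assms by simp
    moreover have "(real j + 2) * (2 / (real j + 2)) = 2" by (simp add: field_simps)
    ultimately show ?thesis by (simp only: scaleR_scaleR)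
  qed
  have 3: "(real j + 2) *\<^sub>R A (Suc j) = 2 *\<^sub>R (\<theta> (Suc j) - \<theta> j)"
  proof -
    have "A (Suc j) = (2 / (real j + 2)) *\<^sub>R (\<theta> (Suc j) - \<theta> j)" by (simp add: A_def add.commute)
    moreover have "(real j + 2) * (2 / (real j + 2)) = 2" by (simp add: field_simps)
    ultimately show ?thesis by (simp only: scaleR_scaleR)
  qed
  have 4: "ag (Suc j) = ag j + v (Suc j) + e (Suc j)" by (simp add: e_def v_def)
  have "2 *\<^sub>R (\<theta> (Suc j) - ag (Suc j)) = 2 *\<^sub>R (\<theta> j - ag j) + 2 *\<^sub>R (\<theta> (Suc j) - \<theta> j) - 2 *\<^sub>R v (Suc j) - 2 *\<^sub>R e (Suc j)"
    unfolding 4 by (simp add: algebra_simps)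
  then show ?thesis unfolding 1 2[symmetric] 3[symmetric] by (simp add: algebra_simps)
qed

text \<open>The variational inequalities at \<open>ag (Suc j)\<close> and \<open>ag k\<close> are
  tested against each other and added. The products \<open>e \<bullet> v\<close> go into the
  difference of \<open>J\<close>, and \<open>m + D\<close> is the displacement from
  \<open>ag (Suc j)\<close> to \<open>ag k\<close>.\<close>

lemma abel_step:
  assumes j: "Suc j < N"
  defines "k \<equiv> Suc (Suc j)"
  defines "D \<equiv> e k - e (Suc j)" and "m \<equiv> e (Suc j) + v k"
  shows "W k * (real k + 1) * (\<delta> k \<bullet> m + \<delta> k \<bullet> D + D \<bullet> D) + J k - J (Suc j)
    + W k * (e (Suc j) \<bullet> e (Suc j)) - 2 * W k * real k * (e (Suc j) \<bullet> A (Suc j)) \<le> 2 * \<epsilon> * (W k * (real k + 1))"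
proof -
  define e0 e1 v1 a g0 g1 where "e0 = e (Suc j)" "e1 = e k" "v1 = v k" "a = A (Suc j)"
    "g0 = G (md (Suc j))" "g1 = G (md k)"
  note defs = this
  have ag_diff: "ag k - ag (Suc j) = v1 + e1" by (simp add: defs v_def e_def k_def)
  have "(g1 + 2 *\<^sub>R e1) \<bullet> (ag k - ag (Suc j)) \<le> \<epsilon>"
    using ag_opt[OF j ag_mem[of "Suc j"]] j by (simp add: defs k_def e_def)
  moreover have "(g0 + 2 *\<^sub>R e0) \<bullet> (ag (Suc j) - ag k) \<le> \<epsilon>"
    using ag_opt[of j "ag k"] ag_mem[of k] j by (simp add: defs k_def e_def)
  moreover have "ag (Suc j) - ag k = - (v1 + e1)" using ag_diff by (metis minus_diff_eq)
  ultimately have "(g1 - g0) \<bullet> (v1 + e1) + 2 * ((e1 - e0) \<bullet> (v1 + e1)) \<le> 2 * \<epsilon>"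
    unfolding ag_diff by (simp add: inner_simps)
  then have mono: "W k * (real k + 1) * ((g1 - g0) \<bullet> (v1 + e1) + 2 * ((e1 - e0) \<bullet> (v1 + e1))) \<le> W k * (real k + 1) * (2 * \<epsilon>)"
    by (intro mult_left_mono) (auto intro: mult_nonneg_nonneg W_nonneg)
  \<comment> \<open>The third identity shows the effect of the factor \<open>k + 1\<close>: the
    previous weight is \<open>W k * j\<close>, and \<open>j\<close> is the coefficient of
    \<open>v (Suc j)\<close> in \<open>v_rec\<close>, so \<open>J (Suc j)\<close> can be expressed
    through \<open>v k\<close>.\<close>
  have Wj: "W k = (real j + 1) * (real j + 2) / 2" "real k = real j + 2" "W (Suc j) * (real (Suc j) + 1) = W k * real j"
    by (auto simp: W_def k_def algebra_simps)
  have "e0 \<bullet> ((real j + 3) *\<^sub>R v1) = e0 \<bullet> (real j *\<^sub>R v (Suc j) + (real j + 2) *\<^sub>R a - 2 *\<^sub>R e0)"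
    using v_rec[OF j] by (simp add: defs k_def)
  then have rec: "(real j + 3) * (e0 \<bullet> v1) = real j * (e0 \<bullet> v (Suc j)) + (real j + 2) * (e0 \<bullet> a) - 2 * (e0 \<bullet> e0)"
    by (simp add: inner_simps)
  have "J (Suc j) = W k * real j * (e0 \<bullet> e0 + 2 * (e0 \<bullet> v (Suc j)))"
    unfolding J_def Wj(3) by (simp add: defs)
  also have "\<dots> = W k * (real j * (e0 \<bullet> e0) + 2 * ((real j + 3) * (e0 \<bullet> v1) - (real j + 2) * (e0 \<bullet> a) + 2 * (e0 \<bullet> e0)))"
    unfolding rec by (simp add: algebra_simps)
  finally have J0: "J (Suc j) = W k * (real j * (e0 \<bullet> e0) + 2 * ((real j + 3) * (e0 \<bullet> v1) - (real j + 2) * (e0 \<bullet> a) + 2 * (e0 \<bullet> e0)))" .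
  have J1: "J k = W k * (real j + 3) * (e1 \<bullet> e1 + 2 * (e1 \<bullet> v1))"
    by (simp add: J_def defs Wj(2))
  have "W k * (real k + 1) * (\<delta> k \<bullet> m + \<delta> k \<bullet> D + D \<bullet> D) + J k - J (Suc j)
      + W k * (e0 \<bullet> e0) - 2 * W k * real k * (e0 \<bullet> a)
     = W k * (real k + 1) * ((g1 - g0) \<bullet> (v1 + e1) + 2 * ((e1 - e0) \<bullet> (v1 + e1)))"
  proof -
    have 1: "\<delta> k \<bullet> m + \<delta> k \<bullet> D = (g1 - g0) \<bullet> (v1 + e1)"
      by (simp add: \<delta>_def m_def D_def defs k_def inner_simps)
    have 2: "D \<bullet> D = e1 \<bullet> e1 - 2 * (e0 \<bullet> e1) + e0 \<bullet> e0"
      by (simp add: D_def defs inner_simps inner_commute)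
    have 3: "(e1 - e0) \<bullet> (v1 + e1) = e1 \<bullet> v1 + e1 \<bullet> e1 - e0 \<bullet> v1 - e0 \<bullet> e1"
      by (simp add: inner_simps inner_commute)
    show ?thesis unfolding 1 2 3 J0 J1 Wj(2) by (simp add: algebra_simps)
  qed
  then show ?thesis using mono by (simp add: defs mult_ac)
qed

text \<open>\<open>\<psi>\<close> of the new iteration is compared with the step of
  \<open>\<theta>\<close> in the previous one, each being the test point of the other. The gradients
  belong to consecutive \<open>md\<close>, so only their increment remains.\<close>

lemma prox_ineq:
  assumes j: "Suc j < N"
  shows "2 * (P (Suc (Suc j)) \<bullet> P (Suc (Suc j)))
    \<le> \<delta> (Suc (Suc j)) \<bullet> P (Suc (Suc j)) - 2 * (1 + 1 / (real j + 1)) * (A (Suc j) \<bullet> P (Suc (Suc j))) + \<epsilon>"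
proof -
  define p where "p = P (Suc (Suc j))"
  have p: "\<psi> (Suc (Suc j)) - \<theta> (Suc j) = - p" "\<theta> (Suc j) - \<psi> (Suc (Suc j)) = p"
    by (auto simp: p_def P_def)
  have "(G (md (Suc (Suc j))) + 2 *\<^sub>R (- p)) \<bullet> (- p) \<le> 0"
    using \<psi>_opt[OF j \<theta>_mem[of "Suc j"]] j unfolding p by simp
  moreover have "(G (md (Suc j)) + (4 / (real j + 1)) *\<^sub>R (\<theta> (Suc j) - \<theta> j)) \<bullet> p \<le> \<epsilon>"
    using \<theta>_opt[of j "\<psi> (Suc (Suc j))"] \<psi>_mem[OF j] j unfolding p by simp
  moreover have "(4 / (real j + 1)) *\<^sub>R (\<theta> (Suc j) - \<theta> j) = (2 * (1 + 1 / (real j + 1))) *\<^sub>R A (Suc j)"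
  proof -
    have "4 / (real j + 1) = 2 * (1 + 1 / (real j + 1)) * (2 / (real (Suc j) + 1))"
    proof -
      have "1 + 1 / (real j + 1) = (real j + 2) / (real j + 1)" by (simp add: field_simps)
      moreover have "4 / a = 2 * ((a + 1) / a) * (2 / (a + 1))" if "a > 0" for a :: real
        using that by (simp add: divide_simps)
      from this[of "real j + 1"] have "4 / (real j + 1) = 2 * ((real j + 2) / (real j + 1)) * (2 / (real (Suc j) + 1))"
        by (simp add: add.assoc add.commute)
      ultimately show ?thesis by (simp only:)
    qed
    then show ?thesis by (simp add: A_def)
  qed
  ultimately show ?thesis
    unfolding p_def[symmetric] by (simp add: \<delta>_def inner_simps)
qed

end

section \<open>Inequalities for a single iteration\<close>

lemma ln_21_le: "ln (1 + 20) / 20 \<le> (77/500 :: real)"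
proof -
  have "ln ((2 :: real) ^ 4) = real 4 * ln 2" by (rule ln_realpow)
  \<comment> \<open>The factors 5/4 and 21/20 are close enough to 1 for
    \<open>ln x <= x - 1\<close>.\<close>
  moreover have "ln (21 :: real) = ln (2 ^ 4 * (5/4) * (21/20))" by simp
  moreover have "\<dots> = ln (2 ^ 4) + ln (5/4) + ln (21/20)"
    by (simp only: ln_mult_pos mult_pos_pos zero_less_power zero_less_divide_iff zero_less_numeral simp_thms)
  ultimately have "ln (21 :: real) = 4 * ln 2 + ln (5/4) + ln (21/20)" by simp
  also have "\<dots> \<le> 4 * (25/36) + (5/4 - 1) + (21/20 - 1)"
    using ln2_le_25_over_36 ln_le_minus_one[of "5/4"] ln_le_minus_one[of "21/20"] by linarith
  finally show ?thesis by simp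
qed

context ncgs_normalized
begin

definition potential where "potential k = energy k + W (Suc k) * cost k + J k / (25 * (real N + 1))"

text \<open>All multipliers are scaled by \<open>\<phi> <= 1\<close>, except that of
  \<open>cost\<close>; writing 1 as \<open>\<phi> * (1 + s)\<close> brings the cost into the form.
  With \<open>q = P / K\<close> the prox inequality gains 2 K |q|^2, of which the form consumes one
  half and the other half is the result.\<close>

lemma main_step:
  assumes j: "Suc j < N" and N: "5 \<le> N" and \<kappa>2: "\<kappa> \<le> 1/2"
  defines "k \<equiv> Suc (Suc j)"
  defines "\<phi> \<equiv> (real k + 1) / (real N + 1)" and "K \<equiv> 261/100 + 37/25 * \<kappa>"
  shows "potential k + W k * \<phi> * (P k \<bullet> P k) / K \<le> potential (Suc j)
    + \<kappa> * (real k * (xs \<bullet> xs + M\<^sup>2)) + (W (Suc k) + real k) * \<epsilon> + W k * \<phi> * (2/25 + 1 / K) * \<epsilon>"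
proof -
  define n where "n = real j + 1"
  define \<tau> where "\<tau> = 1 / n"
  define s where "s = 1 / \<phi> - 1"
  define h where "h = 1 / (real N + 1)"
  define e0 a D vv q d u where "e0 = e (Suc j)" "a = A (Suc j)" "D = e k - e (Suc j)" "vv = v k"
    "q = (1 / K) *\<^sub>R P k" "d = \<delta> k" "u = e (Suc j) + v k"
  note vec = this
  have n: "1 \<le> n" "real k = n + 1" by (auto simp: n_def k_def)
  have K: "K > 0" using \<kappa> by (auto simp: K_def)
  have \<phi>: "0 < \<phi>" "\<phi> \<le> 1" "\<phi> = (real k + 1) * h"
    using j by (auto simp: \<phi>_def h_def k_def field_simps)
  have h: "h > 0" by (simp add: h_def)
  have Pq: "P k = K *\<^sub>R q" using K by (simp add: vec)
  have \<tau>: "0 \<le> \<tau>" "\<tau> \<le> 1" using n by (auto simp: \<tau>_def)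
  have s0: "0 \<le> s" using \<phi> by (simp add: s_def)
  \<comment> \<open>For \<open>j >= 3\<close> the left-hand side is not positive. For smaller
    \<open>j\<close>, 5 <= N gives \<open>1 / \<phi> >= 6 / (j + 3)\<close>; the extreme case
    \<open>j = 0\<close>, \<open>N = 5\<close> is the corner \<open>\<tau> = s = 1\<close>.\<close>
  have s1: "4 * \<tau> - 1 \<le> 3 * s"
  proof (cases "j \<ge> 3")
    case True
    then have "4 * \<tau> \<le> 1" by (simp add: \<tau>_def n_def field_simps)
    then show ?thesis using s0 by linarith
  next
    case False
    then have "j = 0 \<or> j = 1 \<or> j = 2" by auto
    moreover have "1 / \<phi> = (real N + 1) / (real j + 3)" by (simp add: \<phi>_def k_def add.commute)
    moreover have "(5 + 1) / (real j + 3) \<le> (real N + 1) / (real j + 3)" using N by (intro divide_right_mono) auto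
    ultimately show ?thesis by (auto simp: s_def \<tau>_def n_def)
  qed
  have form: "0 \<le> \<phi> * step_form \<kappa> \<tau> s K a e0 D vv q"
    unfolding K_def using \<phi>(1) by (intro mult_nonneg_nonneg step_form_nonneg[OF \<kappa>(1) \<kappa>2 \<tau> s0 s1]) simp
  \<comment> \<open>The multiplier of \<open>d\<close> in the combined inequality is
    \<open>w / 25\<close>, apart from the part along \<open>u\<close>: 1/25 on \<open>D\<close> from
    \<open>abel_step\<close>, -4/5 on \<open>e0\<close> from \<open>model_eq\<close>, -1 on
    \<open>q\<close> from \<open>prox_ineq\<close>.\<close>
  define w where "w = D - 20 *\<^sub>R e0 - 25 *\<^sub>R q"
  have mem: "md (Suc j) \<in> S" "md k \<in> S" "e k = ag k - md k" "ag k \<in> S" "ag (Suc j) \<in> S"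
    "\<theta> (Suc j) \<in> S" "\<psi> k \<in> S"
    using j by (auto simp: k_def md_mem ag_mem \<theta>_mem \<psi>_mem e_def)
  have "two_sided S (e k)" "two_sided S (e (Suc j))" "two_sided S (P k)"
    using mem conv by (auto simp: e_def P_def k_def intro!: two_sided_diff)
  then have "two_sided S (e k + (- 21) *\<^sub>R e (Suc j) + (- 25 / K) *\<^sub>R P k)"
    using conv by (intro two_sided_add two_sided_scaleR)
  moreover have "e k + (- 21) *\<^sub>R e (Suc j) + (- 25 / K) *\<^sub>R P k = w"
    using scaleR_add_left[of 20 1 "e (Suc j)"] by (simp add: w_def vec)
  ultimately have w: "two_sided S w" by simp
  have mdu: "md k - md (Suc j) = u" by (simp add: vec e_def v_def k_def)
  have coco: "20 * Q k + d \<bullet> u + d \<bullet> w \<ge> - ((1 + \<kappa>) * (77/2000) * (w \<bullet> w) + \<kappa> * (u \<bullet> w) + 11 * \<kappa> * (u \<bullet> u))"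
  proof -
    have "(1 + \<kappa>) * (ln (1 + 20) / 20) / 4 * (w \<bullet> w) \<le> (1 + \<kappa>) * (77/500) / 4 * (w \<bullet> w)"
      using \<kappa> ln_21_le by (intro mult_right_mono divide_right_mono mult_left_mono) auto
    moreover have "Q k = f (md (Suc j)) - f (md k) - G (md k) \<bullet> (md (Suc j) - md k)" "d = G (md k) - G (md (Suc j))"
      by (simp_all add: Q_def vec \<delta>_def k_def)
    then have "- (1 + \<kappa>) * (ln (1 + 20) / 20) / 4 * (w \<bullet> w) - \<kappa> * (u \<bullet> w) - \<kappa> * (20 / 2 + 1) * (u \<bullet> u)
        \<le> 20 * Q k + d \<bullet> u + d \<bullet> w"
      using weighted_cocoercive[OF conv up low contf contG \<kappa>(1) _ mem(1,2) w, of 20] by (simp only: mdu)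
    ultimately show ?thesis by argo
  qed
  have dw: "d \<bullet> w = d \<bullet> D - 20 * (d \<bullet> e0) - 25 * (d \<bullet> q)"
    by (simp add: w_def inner_simps)
  have "0 \<le> \<phi> * ((1 + s) * ((a - e0) \<bullet> (a - e0) + e0 \<bullet> e0 / 2) + 2/5 * (e0 \<bullet> e0) + 24/25 * \<tau> * (a \<bullet> a) - 2/25 * (e0 \<bullet> a)
     + (D \<bullet> D) / 25 + 9/10 * \<kappa> * (vv \<bullet> vv) + 2 * (1 + \<tau>) * (a \<bullet> q) + K * (q \<bullet> q)
     + (20 * Q k + d \<bullet> u + d \<bullet> w) / 25)"
  proof -
    have u: "e0 + vv = u" by (simp add: vec)
    have "step_form \<kappa> \<tau> s K a e0 D vv q \<le> (1 + s) * ((a - e0) \<bullet> (a - e0) + e0 \<bullet> e0 / 2) + 2/5 * (e0 \<bullet> e0) + 24/25 * \<tau> * (a \<bullet> a) - 2/25 * (e0 \<bullet> a)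
     + (D \<bullet> D) / 25 + 9/10 * \<kappa> * (vv \<bullet> vv) + 2 * (1 + \<tau>) * (a \<bullet> q) + K * (q \<bullet> q)
     + (20 * Q k + d \<bullet> u + d \<bullet> w) / 25"
    proof -
      have gen: "- z \<le> y \<Longrightarrow> c - z / 25 \<le> c + y / 25" for c y z :: real by simp
      show ?thesis unfolding step_form_def Let_def w_def[symmetric] u by (rule gen[OF coco])
    qed
    from order_trans[OF form mult_left_mono[OF this less_imp_le[OF \<phi>(1)]]] show ?thesis .
  qed
  moreover have "\<phi> * ((1 + s) * z + r) = z + \<phi> * r" for z r
    using \<phi>(1) by (simp add: s_def field_simps)
  ultimately have F: "0 \<le> ((a - e0) \<bullet> (a - e0) + e0 \<bullet> e0 / 2) + \<phi> * (2/5 * (e0 \<bullet> e0) + 24/25 * \<tau> * (a \<bullet> a) - 2/25 * (e0 \<bullet> a)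
     + (D \<bullet> D) / 25 + 9/10 * \<kappa> * (vv \<bullet> vv) + 2 * (1 + \<tau>) * (a \<bullet> q) + K * (q \<bullet> q)
     + (20 * Q k + d \<bullet> u + d \<bullet> w) / 25)"
    by (simp only: add.assoc add_diff_eq[symmetric] diff_conv_add_uminus)
  have prox: "2 * K * (q \<bullet> q) \<le> d \<bullet> q - 2 * (1 + \<tau>) * (a \<bullet> q) + \<epsilon> / K"
  proof -
    have "K * (2 * K * (q \<bullet> q)) \<le> K * (d \<bullet> q - 2 * (1 + \<tau>) * (a \<bullet> q)) + \<epsilon>"
    proof -
      have da: "\<delta> k = d" "A (Suc j) = a" by (simp_all only: vec)
      have "1 / (real j + 1) = \<tau>" by (simp add: \<tau>_def n_def)
      then have "2 * ((K *\<^sub>R q) \<bullet> (K *\<^sub>R q)) \<le> d \<bullet> (K *\<^sub>R q) - 2 * (1 + \<tau>) * (a \<bullet> (K *\<^sub>R q)) + \<epsilon>"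
        using prox_ineq[OF j] unfolding k_def[symmetric] Pq da by (simp only:)
      then show ?thesis by (simp add: algebra_simps)
    qed
    then have "K * (2 * K * (q \<bullet> q)) \<le> K * (d \<bullet> q - 2 * (1 + \<tau>) * (a \<bullet> q) + \<epsilon> / K)"
      using K by (simp add: distrib_left)
    then show ?thesis using K by (rule mult_left_le_imp_le)
  qed
  then have prox: "\<phi> * (2 * K * (q \<bullet> q)) \<le> \<phi> * (d \<bullet> q - 2 * (1 + \<tau>) * (a \<bullet> q) + \<epsilon> / K)"
    using \<phi> by (intro mult_left_mono) auto
  \<comment> \<open>\<open>abel_step\<close> supplies the factor \<open>k\<close> in
    \<open>e0 \<bullet> a\<close>, whereas \<open>\<phi>\<close> contains \<open>k + 1\<close>. The
    surplus is split by Young's inequality; its part in \<open>a\<close> costs 1/25 of the available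
    |a|^2 term, which is why the form has 24/25.\<close>
  have small: "\<phi> * (24/25 * \<tau> * (a \<bullet> a) - 2/25 * (e0 \<bullet> a)) \<le> \<tau> * (a \<bullet> a) + h / 25 * (e0 \<bullet> e0 - 2 * real k * (e0 \<bullet> a))"
  proof -
    have "h / 25 \<le> \<tau> * \<phi> / 25" using h n by (simp add: \<tau>_def \<phi>(3) field_simps)
    also have "\<dots> \<le> \<tau> * (1 - 24/25 * \<phi>)" using \<tau>(1) \<phi>(2) mult_left_mono[of \<phi> 1 \<tau>] by (simp add: algebra_simps)
    finally have "h / 25 * (a \<bullet> a) \<le> \<tau> * (1 - 24/25 * \<phi>) * (a \<bullet> a)" by (rule mult_right_mono) simp
    moreover have "0 \<le> h / 25 * ((e0 + a) \<bullet> (e0 + a))" using h by simp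
    then have "0 \<le> h / 25 * (e0 \<bullet> e0 + 2 * (e0 \<bullet> a) + a \<bullet> a)"
      by (simp add: inner_simps inner_commute algebra_simps)
    ultimately show ?thesis unfolding \<phi>(3) by (simp add: algebra_simps add_divide_distrib)
  qed
  have cost0: "cost (Suc j) = (a - e0) \<bullet> (a - e0) + e0 \<bullet> e0 / 2 + \<tau> * (a \<bullet> a)"
    by (simp add: cost_def vec \<tau>_def n_def add.commute)
  have I: "\<phi> * (K * (q \<bullet> q)) \<le> cost (Suc j) + 4/5 * \<phi> * (e0 \<bullet> e0 / 2 - d \<bullet> e0 + Q k)
     + \<phi> / 25 * (d \<bullet> u + d \<bullet> D + D \<bullet> D) + h / 25 * (e0 \<bullet> e0 - 2 * real k * (e0 \<bullet> a))
     + 9/10 * \<phi> * \<kappa> * (vv \<bullet> vv) + \<phi> * \<epsilon> / K"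
    using F prox small unfolding cost0 dw by (simp add: algebra_simps add_divide_distrib diff_divide_distrib)
  define w1 where "w1 = W k"
  have w1: "0 \<le> w1" by (simp add: w1_def W_nonneg)
  have I': "w1 * (\<phi> * (K * (q \<bullet> q))) \<le> w1 * (cost (Suc j) + 4/5 * \<phi> * (e0 \<bullet> e0 / 2 - d \<bullet> e0 + Q k)
     + \<phi> / 25 * (d \<bullet> u + d \<bullet> D + D \<bullet> D) + h / 25 * (e0 \<bullet> e0 - 2 * real k * (e0 \<bullet> a))
     + 9/10 * \<phi> * \<kappa> * (vv \<bullet> vv) + \<phi> * \<epsilon> / K)"
    using I w1 by (rule mult_left_mono)
  have step: "energy k + W (Suc k) * cost k \<le> w1 * (model k - f xs) + 2 * ((\<theta> (Suc j) - xs) \<bullet> (\<theta> (Suc j) - xs))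
    + real k * (\<kappa> / 2 * ((xs - md k) \<bullet> (xs - md k))) + (W (Suc k) + real k) * \<epsilon>"
    using energy_step[OF j] by (simp add: k_def w1_def add.commute)
  have m1: "model k \<le> B (Suc j) + \<kappa> / 2 * (vv \<bullet> vv)"
    using model_le[OF j] by (simp add: vec k_def)
  have m2: "model k = B (Suc j) - (e0 \<bullet> e0 / 2 - d \<bullet> e0 + Q k)"
    using model_eq[of j] by (simp add: vec k_def)
  \<comment> \<open>Convex combination of \<open>model_le\<close> and \<open>model_eq\<close>. The
    share 4/5 = 20/25 makes the coefficient of \<open>Q\<close> agree with cocoercivity for
    \<open>R = 20\<close>.\<close>
  have "model k = (1 - 4/5 * \<phi>) * model k + 4/5 * \<phi> * model k" by (simp add: algebra_simps)
  also have "\<dots> \<le> (1 - 4/5 * \<phi>) * (B (Suc j) + \<kappa> / 2 * (vv \<bullet> vv)) + 4/5 * \<phi> * (B (Suc j) - (e0 \<bullet> e0 / 2 - d \<bullet> e0 + Q k))"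
    using m1 \<phi> unfolding m2[symmetric] by (intro add_mono mult_left_mono) auto
  finally have "model k \<le> B (Suc j) + (1 - 4/5 * \<phi>) * (\<kappa> / 2 * (vv \<bullet> vv)) - 4/5 * \<phi> * (e0 \<bullet> e0 / 2 - d \<bullet> e0 + Q k)"
    by (simp add: algebra_simps add_divide_distrib diff_divide_distrib)
  then have m: "w1 * model k \<le> w1 * (B (Suc j) + (1 - 4/5 * \<phi>) * (\<kappa> / 2 * (vv \<bullet> vv)) - 4/5 * \<phi> * (e0 \<bullet> e0 / 2 - d \<bullet> e0 + Q k))"
    using w1 by (rule mult_left_mono)
  have ch: "real k * (\<kappa> / 2 * ((xs - md k) \<bullet> (xs - md k))) + (1 + \<phi>) * (\<kappa> / 2) * (w1 * (vv \<bullet> vv)) \<le> \<kappa> * (real k * (xs \<bullet> xs + M\<^sup>2))"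
    using charge[OF j, of "1 + \<phi>"] \<phi> by (simp add: k_def w1_def vec add.commute)
  have "h / 25 * (w1 * (real k + 1) * (d \<bullet> u + d \<bullet> D + D \<bullet> D) + J k - J (Suc j)
    + w1 * (e0 \<bullet> e0) - 2 * w1 * real k * (e0 \<bullet> a)) \<le> h / 25 * (2 * \<epsilon> * (w1 * (real k + 1)))"
    using abel_step[OF j] h unfolding k_def[symmetric] by (intro mult_left_mono) (auto simp: vec w1_def)
  then have ab: "w1 * (\<phi> / 25 * (d \<bullet> u + d \<bullet> D + D \<bullet> D)) + h / 25 * J k - h / 25 * J (Suc j)
    + w1 * (h / 25 * (e0 \<bullet> e0 - 2 * real k * (e0 \<bullet> a))) \<le> w1 * \<phi> * (2/25) * \<epsilon>"
    unfolding \<phi>(3) by (simp add: algebra_simps add_divide_distrib)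
  have PP: "w1 * \<phi> * (P k \<bullet> P k) / K = w1 * (\<phi> * (K * (q \<bullet> q)))" using K by (simp add: Pq)
  have pot: "potential i = energy i + W (Suc i) * cost i + h / 25 * J i" for i
    by (simp add: potential_def h_def)
  have en: "energy (Suc j) = w1 * (B (Suc j) - f xs) + 2 * ((\<theta> (Suc j) - xs) \<bullet> (\<theta> (Suc j) - xs))"
    by (simp add: energy_def w1_def k_def)
  have "potential k + w1 * (\<phi> * (K * (q \<bullet> q))) \<le> potential (Suc j)
    + \<kappa> * (real k * (xs \<bullet> xs + M\<^sup>2)) + (W (Suc k) + real k) * \<epsilon> + w1 * \<phi> * (2/25 + 1 / K) * \<epsilon>"
    using I' step m ch ab unfolding pot en w1_def[symmetric] k_def[symmetric]
    by (simp add: algebra_simps add_divide_distrib diff_divide_distrib)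
  then show ?thesis unfolding w1_def[symmetric] PP .
qed

text \<open>Here \<open>model_eq\<close> has share 3/10 and \<open>model_le\<close> 7/10, and 2/25
  is the multiplier of |d|^2 <= |e + v|^2. The full charge \<open>c = 2\<close> leaves 1 - 7/20 =
  13/20 of \<open>\<kappa>\<close> |v|^2. The normals are not compared, so there is no boundary
  term.\<close>

lemma coarse_step:
  assumes j: "Suc j < N" and \<kappa>2: "1/2 \<le> \<kappa>"
  defines "k \<equiv> Suc (Suc j)"
  defines "K \<equiv> 197/50 + \<kappa> / 2 + (6/5 - \<kappa> / 2) * (1 / (real j + 1))"
  shows "energy k + W (Suc k) * cost k + W k * (P k \<bullet> P k) / K \<le> energy (Suc j) + W k * cost (Suc j)
    + \<kappa> * (real k * (xs \<bullet> xs + M\<^sup>2)) + (W (Suc k) + real k) * \<epsilon> + W k / K * \<epsilon>"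
proof -
  define \<tau> where "\<tau> = 1 / (real j + 1)"
  define e0 a vv q d where "e0 = e (Suc j)" "a = A (Suc j)" "vv = v k" "q = (1 / K) *\<^sub>R P k" "d = \<delta> k"
  note vec = this
  have \<tau>: "0 \<le> \<tau>" "\<tau> \<le> 1" by (auto simp: \<tau>_def)
  have "(6/5 - \<kappa> / 2) * \<tau> \<ge> 0" using \<kappa> \<tau> by (intro mult_nonneg_nonneg) auto
  then have K: "K > 0" unfolding K_def \<tau>_def[symmetric] using \<kappa> by linarith
  have Pq: "P k = K *\<^sub>R q" using K by (simp add: vec)
  have form: "0 \<le> coarse_form \<kappa> \<tau> K a e0 d vv q"
    unfolding K_def \<tau>_def[symmetric] by (rule coarse_form_nonneg[OF \<kappa>2 \<kappa>(2) \<tau>])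
  have dd: "d \<bullet> d \<le> (e0 + vv) \<bullet> (e0 + vv)"
  proof -
    have "md k - md (Suc j) = e0 + vv" by (simp add: vec e_def v_def k_def)
    then have "norm d \<le> norm (e0 + vv)"
      using lip[OF md_mem[OF j] md_mem[of j]] j by (simp add: vec \<delta>_def k_def)
    then show ?thesis by (simp add: norm_le)
  qed
  have Qk: "- (\<kappa> / 2 * ((e0 + vv) \<bullet> (e0 + vv))) \<le> Q k"
    using Q_ge[OF j] by (simp add: vec k_def)
  have "K * (2 * K * (q \<bullet> q)) \<le> K * (d \<bullet> q - 2 * (1 + \<tau>) * (a \<bullet> q) + \<epsilon> / K)"
  proof -
    have da: "\<delta> k = d" "A (Suc j) = a" by (simp_all only: vec)
    have "2 * ((K *\<^sub>R q) \<bullet> (K *\<^sub>R q)) \<le> d \<bullet> (K *\<^sub>R q) - 2 * (1 + \<tau>) * (a \<bullet> (K *\<^sub>R q)) + \<epsilon>"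
      using prox_ineq[OF j] unfolding k_def[symmetric] Pq da \<tau>_def .
    then show ?thesis using K by (simp add: algebra_simps)
  qed
  then have prox: "2 * K * (q \<bullet> q) \<le> d \<bullet> q - 2 * (1 + \<tau>) * (a \<bullet> q) + \<epsilon> / K"
    using K by (rule mult_left_le_imp_le)
  have cost0: "cost (Suc j) = (a - e0) \<bullet> (a - e0) + e0 \<bullet> e0 / 2 + \<tau> * (a \<bullet> a)"
    by (simp add: cost_def vec \<tau>_def add.commute)
  have "K * (q \<bullet> q) \<le> cost (Suc j) + 3/10 * (e0 \<bullet> e0 / 2 - d \<bullet> e0 + Q k) + 13/20 * \<kappa> * (vv \<bullet> vv) + \<epsilon> / K"
    using form prox dd Qk unfolding coarse_form_def cost0 by (simp add: algebra_simps add_divide_distrib diff_divide_distrib)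
  then have I: "W k * (K * (q \<bullet> q)) \<le> W k * (cost (Suc j) + 3/10 * (e0 \<bullet> e0 / 2 - d \<bullet> e0 + Q k) + 13/20 * \<kappa> * (vv \<bullet> vv) + \<epsilon> / K)"
    by (intro mult_left_mono W_nonneg)
  have step: "energy k + W (Suc k) * cost k \<le> W k * (model k - f xs) + 2 * ((\<theta> (Suc j) - xs) \<bullet> (\<theta> (Suc j) - xs))
    + real k * (\<kappa> / 2 * ((xs - md k) \<bullet> (xs - md k))) + (W (Suc k) + real k) * \<epsilon>"
    using energy_step[OF j] by (simp add: k_def add.commute)
  have m1: "model k \<le> B (Suc j) + \<kappa> / 2 * (vv \<bullet> vv)"
    using model_le[OF j] by (simp add: vec k_def)
  have m2: "model k = B (Suc j) - (e0 \<bullet> e0 / 2 - d \<bullet> e0 + Q k)"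
    using model_eq[of j] by (simp add: vec k_def)
  have "model k \<le> B (Suc j) + 7/20 * \<kappa> * (vv \<bullet> vv) - 3/10 * (e0 \<bullet> e0 / 2 - d \<bullet> e0 + Q k)"
    using m1 m2 by argo
  then have m: "W k * model k \<le> W k * (B (Suc j) + 7/20 * \<kappa> * (vv \<bullet> vv) - 3/10 * (e0 \<bullet> e0 / 2 - d \<bullet> e0 + Q k))"
    by (intro mult_left_mono W_nonneg)
  have ch: "real k * (\<kappa> / 2 * ((xs - md k) \<bullet> (xs - md k))) + 2 * (\<kappa> / 2) * (W k * (vv \<bullet> vv)) \<le> \<kappa> * (real k * (xs \<bullet> xs + M\<^sup>2))"
    using charge[OF j, of 2] by (simp add: k_def vec add.commute)
  have en: "energy (Suc j) = W k * (B (Suc j) - f xs) + 2 * ((\<theta> (Suc j) - xs) \<bullet> (\<theta> (Suc j) - xs))"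
    by (simp add: energy_def k_def)
  have PP: "W k * (P k \<bullet> P k) / K = W k * (K * (q \<bullet> q))" using K by (simp add: Pq)
  show ?thesis
    using I step m ch unfolding en PP by (simp add: algebra_simps add_divide_distrib diff_divide_distrib)
qed

section \<open>Displacements of \<theta>\<close>

text \<open>\<open>\<theta> k\<close> and \<open>\<psi> k\<close> solve subproblems with the same
  gradient and the regularisations \<open>c = 4 / k\<close> and 2. From \<open>k = 2\<close> on
  \<open>c <= 2\<close>, and then |p| exceeds |d| by at most sqrt (\<epsilon> / 2). Young's
  inequality with parameter 1/25 gives the two constants.\<close>

lemma P_le_displacement:
  assumes "Suc j < N"
  shows "P (Suc (Suc j)) \<bullet> P (Suc (Suc j))
    \<le> 26/25 * ((\<theta> (Suc (Suc j)) - \<theta> (Suc j)) \<bullet> (\<theta> (Suc (Suc j)) - \<theta> (Suc j))) + 13 * \<epsilon>"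
proof -
  define k where "k = Suc (Suc j)"
  define c where "c = 4 / real k"
  define d where "d = \<theta> k - \<theta> (Suc j)"
  define p where "p = P k"
  have c: "0 < c" "c \<le> 2" by (auto simp: c_def k_def field_simps)
  have "(G (md k) + c *\<^sub>R d) \<bullet> (d + p) \<le> \<epsilon>"
    using \<theta>_opt[OF assms \<psi>_mem[OF assms]] by (simp add: c_def d_def p_def P_def k_def add.commute)
  moreover have "(G (md k) + 2 *\<^sub>R (- p)) \<bullet> (- (d + p)) \<le> 0"
    using \<psi>_opt[OF assms \<theta>_mem[of k]] assms by (simp add: p_def P_def d_def k_def)
  ultimately have "c * (d \<bullet> d) + 2 * (p \<bullet> p) + (c + 2) * (d \<bullet> p) \<le> \<epsilon>"
    by (simp add: inner_simps inner_commute algebra_simps)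
  moreover have "(c + 2) * (d \<bullet> p) \<ge> - ((c + 2) * (norm d * norm p))"
    using c Cauchy_Schwarz_ineq2[of d p] mult_left_mono[of "- (d \<bullet> p)" "norm d * norm p" "c + 2"] by (simp add: abs_le_iff)
  ultimately have le: "(norm p - norm d) * (2 * norm p - c * norm d) \<le> \<epsilon>"
    by (simp add: power2_norm_eq_inner[symmetric] power2_eq_square algebra_simps)
  have "(norm p)\<^sup>2 \<le> 26/25 * (norm d)\<^sup>2 + 13 * \<epsilon>"
  proof (cases "norm p \<le> norm d")
    case True
    then have "(norm p)\<^sup>2 \<le> (norm d)\<^sup>2" by (intro power_mono) auto
    moreover have "0 \<le> (norm d)\<^sup>2" by simp
    ultimately show ?thesis using \<epsilon> by linarith
  next
    case False
    define t where "t = norm p - norm d"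
    have t: "t > 0" "norm p = norm d + t" using False by (auto simp: t_def)
    have "c * norm d \<le> 2 * norm d" using c by (intro mult_right_mono) auto
    then have "t * (2 * t) \<le> t * (2 * norm p - c * norm d)"
      using t by (intro mult_left_mono) auto
    also have "\<dots> \<le> \<epsilon>" using le by (simp only: t_def)
    finally have "2 * (t * t) \<le> \<epsilon>" by (simp add: mult.left_commute)
    moreover have "0 \<le> (norm d / 5 - 5 * t)\<^sup>2" by simp
    ultimately show ?thesis unfolding t(2) by (simp add: power2_eq_square algebra_simps)
  qed
  then show ?thesis by (simp add: power2_norm_eq_inner p_def d_def k_def)
qed

text \<open>In the first iteration \<open>4 / k\<close> exceeds 2, so \<open>\<psi> 1\<close> is
  compared with \<open>ag 1\<close> instead: since \<open>md 1 = \<theta> 0\<close>, both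
  approximate the same prox point.\<close>

lemma P1_le: assumes "0 < N" shows "P 1 \<bullet> P 1 \<le> 26/25 * (e 1 \<bullet> e 1) + 13 * \<epsilon>"
proof -
  have md1: "md 1 = \<theta> 0" using md_eq[of 0] assms start by simp
  have eq: "ag 1 - \<psi> 1 = e 1 + P 1" "\<psi> 1 - ag 1 = - (e 1 + P 1)" by (simp_all add: e_def P_def md1[simplified])
  have "(G (md 1) + 2 *\<^sub>R e 1) \<bullet> (e 1 + P 1) \<le> \<epsilon>"
    using ag_opt[OF assms \<psi>_mem[OF assms]] unfolding eq[symmetric] by (simp add: e_def)
  moreover have "(G (md 1) + 2 *\<^sub>R (- P 1)) \<bullet> (- (e 1 + P 1)) \<le> 0"
    using \<psi>_opt[OF assms ag_mem[of 1]] assms unfolding eq[symmetric] by (simp add: P_def)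
  ultimately have "2 * ((e 1 + P 1) \<bullet> (e 1 + P 1)) \<le> \<epsilon>"
    by (simp add: inner_simps inner_commute algebra_simps)
  moreover define u where "u = e 1 + P 1"
  moreover have "0 \<le> ((1/5) *\<^sub>R e 1 + 5 *\<^sub>R u) \<bullet> ((1/5) *\<^sub>R e 1 + 5 *\<^sub>R u)" by simp
  moreover have "P 1 = u - e 1" by (simp add: u_def)
  ultimately show ?thesis by (simp add: inner_simps inner_commute algebra_simps)
qed

text \<open>For fixed \<open>a\<close> the cost is least at \<open>e = 2/3 a\<close>, which leaves
  1/3 of |a|^2 besides the term |a|^2 / (k + 1).\<close>

lemma cost_ge_displacement:
  "W (Suc (Suc k)) * cost (Suc k) \<ge>
    2 * (real k + 4) / (3 * (real k + 2)) * ((\<theta> (Suc k) - \<theta> k) \<bullet> (\<theta> (Suc k) - \<theta> k))"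
proof -
  define a x where "a = A (Suc k)" "x = e (Suc k)"
  define d where "d = \<theta> (Suc k) - \<theta> k"
  have "0 \<le> 2/3 * ((a - (3/2) *\<^sub>R x) \<bullet> (a - (3/2) *\<^sub>R x))" by simp
  then have "(1/3 + 1 / (real k + 1)) * (a \<bullet> a) \<le> cost (Suc k)"
    unfolding cost_def a_x_def[symmetric] by (simp add: inner_simps inner_commute algebra_simps)
  then have "W (Suc (Suc k)) * ((1/3 + 1 / (real k + 1)) * (a \<bullet> a)) \<le> W (Suc (Suc k)) * cost (Suc k)"
    by (intro mult_left_mono W_nonneg)
  moreover have "a \<bullet> a = (2 / (real k + 2))\<^sup>2 * (d \<bullet> d)"
    by (simp add: a_x_def A_def d_def power2_eq_square add.commute)
  moreover have "W (Suc (Suc k)) * ((1/3 + 1 / (real k + 1)) * (2 / (real k + 2))\<^sup>2) = 2 * (real k + 4) / (3 * (real k + 2))"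
    by (simp add: W_def power2_eq_square divide_simps) (simp add: algebra_simps)
  ultimately show ?thesis unfolding d_def[symmetric] by (simp add: mult.assoc[symmetric])
qed

lemma cost1_ge: "W 2 * cost 1 \<ge> e 1 \<bullet> e 1"
proof -
  have "0 \<le> 2 * ((A 1 - (1/2) *\<^sub>R e 1) \<bullet> (A 1 - (1/2) *\<^sub>R e 1))" by simp
  then show ?thesis by (simp add: W_def cost_def inner_simps inner_commute algebra_simps)
qed

text \<open>The weights stay bounded, so their sum grows only linearly in \<open>N\<close>; the
  bound is meant for few iterations.\<close>

lemma displacement_bound:
  assumes "\<And>k. 1 \<le> k \<Longrightarrow> k \<le> N \<Longrightarrow> p \<le> P k \<bullet> P k" "1 \<le> N"
  shows "(1 + (\<Sum>k=2..N. 2 * (real k + 3) / (3 * (real k + 1)))) * (p - 13 * \<epsilon>) \<le> 26/25 * budget N"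
proof -
  have "p - 13 * \<epsilon> \<le> 26/25 * (W 2 * cost 1)"
    using assms(1)[of 1] assms(2) P1_le cost1_ge by simp
  moreover have "(\<Sum>k=2..N. 2 * (real k + 3) / (3 * (real k + 1)) * (p - 13 * \<epsilon>)) \<le> (\<Sum>k=2..N. 26/25 * (W (Suc k) * cost k))"
  proof (rule sum_mono)
    fix k assume k: "k \<in> {2..N}"
    then obtain j where j: "k = Suc (Suc j)" "Suc j < N" by (cases k; cases "k - 1") auto
    define c where "c = 2 * (real k + 3) / (3 * (real k + 1))"
    define dd where "dd = (\<theta> k - \<theta> (Suc j)) \<bullet> (\<theta> k - \<theta> (Suc j))"
    have "c \<ge> 0" by (simp add: c_def)
    moreover have "p - 13 * \<epsilon> \<le> 26/25 * dd"
      using assms(1)[of k] k P_le_displacement[OF j(2)] by (simp add: j dd_def)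
    ultimately have "c * (p - 13 * \<epsilon>) \<le> c * (26/25 * dd)" by (intro mult_left_mono)
    moreover have "c * dd \<le> W (Suc k) * cost k"
      using cost_ge_displacement[of "Suc j"] by (simp add: c_def dd_def j algebra_simps)
    ultimately show "c * (p - 13 * \<epsilon>) \<le> 26/25 * (W (Suc k) * cost k)" by simp
  qed
  moreover have "(\<Sum>k=1..N. W (Suc k) * cost k) = W 2 * cost 1 + (\<Sum>k=2..N. W (Suc k) * cost k)"
    using assms(2) by (subst sum.atLeast_Suc_atMost) (auto simp: numeral_2_eq_2)
  moreover have "(\<Sum>k=1..N. W (Suc k) * cost k) \<le> budget N"
    using cost_sum_le[of N] inner_ge_zero[of "\<theta> N - xs"] by linarith
  ultimately show ?thesis
    unfolding sum_distrib_left[symmetric] sum_distrib_right[symmetric] distrib_right mult_1 by argo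
qed

section \<open>Summation over the iterations\<close>

text \<open>The numbers (k - 1) k (k + 1) / 2 for k = 2, ..., j + 1 add up to j (j + 1) (j + 2) (j +
  3) / 8. The sum starts after the first iteration, where \<open>J 1 = 0\<close>, so
  \<open>energy_bound\<close> supplies the base case.\<close>

lemma main_sum:
  assumes p: "\<And>k. 1 \<le> k \<Longrightarrow> k \<le> N \<Longrightarrow> p \<le> P k \<bullet> P k" and N: "5 \<le> N" and \<kappa>2: "\<kappa> \<le> 1/2"
  defines "K \<equiv> 261/100 + 37/25 * \<kappa>"
  shows "Suc j \<le> N \<Longrightarrow> potential (Suc j) + (real j * (real j + 1) * (real j + 2) * (real j + 3) / (8 * (real N + 1))) * (p / K)
    \<le> budget (Suc j) + (real j * (real j + 1) * (real j + 2) * (real j + 3) / (8 * (real N + 1))) * ((2/25 + 1 / K) * \<epsilon>)"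
proof (induction j)
  case 0
  have "potential 1 = energy 1 + W 2 * cost 1" by (simp add: potential_def J_def W_def numeral_2_eq_2)
  then show ?case using energy_bound[of 1] 0 by (simp add: numeral_2_eq_2)
next
  case (Suc j)
  define k where "k = Suc (Suc j)"
  define z where "z i = i * (i + 1) * (i + 2) * (i + 3) / (8 * (real N + 1))" for i
  have K: "K > 0" using \<kappa> by (simp add: K_def)
  have w: "W k * ((real k + 1) / (real N + 1)) = z (real (Suc j)) - z (real j)"
  proof -
    define c where "c = 1 / (8 * (real N + 1))"
    have "W k * (real k + 1) * 8 = (real j + 1) * (real j + 2) * (real j + 3) * (real j + 4) - real j * (real j + 1) * (real j + 2) * (real j + 3)"
      by (simp add: W_def k_def algebra_simps)
    then have "W k * (real k + 1) * 8 * c = (real j + 1) * (real j + 2) * (real j + 3) * (real j + 4) * c - real j * (real j + 1) * (real j + 2) * (real j + 3) * c"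
      by (simp only: left_diff_distrib)
    moreover have "W k * ((real k + 1) / (real N + 1)) = W k * (real k + 1) * 8 * c" by (simp add: c_def field_simps)
    moreover have "z i = i * (i + 1) * (i + 2) * (i + 3) * c" for i by (simp add: z_def c_def)
    ultimately show ?thesis by (simp add: add.commute)
  qed
  have w0: "0 \<le> W k * ((real k + 1) / (real N + 1))"
    by (intro mult_nonneg_nonneg W_nonneg) auto
  have "(z (real (Suc j)) - z (real j)) * (p / K) \<le> W k * ((real k + 1) / (real N + 1)) * (P k \<bullet> P k) / K"
    using mult_left_mono[OF p[of k] w0] Suc.prems K unfolding w by (simp add: k_def divide_right_mono)
  moreover have "potential k + W k * ((real k + 1) / (real N + 1)) * (P k \<bullet> P k) / K \<le> potential (Suc j)
    + \<kappa> * (real k * (xs \<bullet> xs + M\<^sup>2)) + (W (Suc k) + real k) * \<epsilon> + W k * ((real k + 1) / (real N + 1)) * (2/25 + 1 / K) * \<epsilon>"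
    using main_step[OF _ N \<kappa>2, of j] Suc.prems by (simp add: k_def K_def)
  moreover have "budget k = budget (Suc j) + \<kappa> * (real k * (xs \<bullet> xs + M\<^sup>2)) + (W (Suc k) + real k) * \<epsilon>"
    using budget_Suc[of "Suc j"] by (simp add: k_def)
  ultimately have "potential k + z (real (Suc j)) * (p / K) \<le> budget k + z (real (Suc j)) * ((2/25 + 1 / K) * \<epsilon>)"
    using Suc unfolding w z_def[symmetric] by (simp add: algebra_simps diff_divide_distrib)
  then show ?case unfolding z_def k_def .
qed

text \<open>Only \<open>J N\<close> can be negative, through \<open>e \<bullet> v\<close>. The
  square is completed with the |e|^2 / 2 of the last cost, and the remaining |v|^2 is bounded by
  \<open>dist_\<theta>_ag\<close>. The loss explains the factor 661/625 = 1 + 36/625 in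
  \<open>main_bound\<close>.\<close>

lemma potential_ge: assumes "0 < N" shows "potential N \<ge> - (36/625) * budget N"
proof -
  obtain n where n: "N = Suc n" using assms by (cases N) auto
  define x y where "x = e N" "y = v N"
  define w w' where "w = W N" "w' = W (Suc N)"
  have w: "w = (real n + 1) * real n / 2" "w' = (real n + 1) * (real n + 2) / 2"
    by (auto simp: w_w'_def W_def n algebra_simps)
  have "w' * (x \<bullet> x / 2) \<le> w' * cost N"
    unfolding w_w'_def cost_def x_y_def by (intro mult_left_mono W_nonneg) auto
  moreover have "0 \<le> energy N" using energy_nonneg[of N] by (simp add: energy_def)
  moreover have "J N / (25 * (real N + 1)) = w / 25 * (x \<bullet> x + 2 * (x \<bullet> y))"
    by (simp add: J_def w_w'_def x_y_def field_simps)
  moreover have "0 \<le> w / 25 * (x \<bullet> x)" by (simp add: w)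
  ultimately have "potential N \<ge> w' / 2 * (x \<bullet> x) + 2 * (w / 25) * (x \<bullet> y)"
    unfolding potential_def w_w'_def[symmetric] by (simp add: algebra_simps)
  moreover have "0 \<le> w' / 2 * ((x + (2 * w / (25 * w')) *\<^sub>R y) \<bullet> (x + (2 * w / (25 * w')) *\<^sub>R y))"
    by (intro mult_nonneg_nonneg) (auto simp: w)
  moreover have w'0: "w' > 0" by (simp add: w)
  moreover have "w' / 2 * ((x + (2 * w / (25 * w')) *\<^sub>R y) \<bullet> (x + (2 * w / (25 * w')) *\<^sub>R y))
      = w' / 2 * (x \<bullet> x) + 2 * (w / 25) * (x \<bullet> y) + 2 * w\<^sup>2 / (625 * w') * (y \<bullet> y)"
    using w'0 by (simp add: inner_simps inner_commute power2_eq_square field_simps)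
  ultimately have 1: "potential N \<ge> - (2 * w\<^sup>2 / (625 * w') * (y \<bullet> y))" by linarith
  have "y \<bullet> y = (2 / (real n + 2))\<^sup>2 * ((\<theta> n - ag n) \<bullet> (\<theta> n - ag n))"
    using v_eq[of n] by (simp add: x_y_def n power2_eq_square)
  then have 2: "y \<bullet> y \<le> (2 / (real n + 2))\<^sup>2 * (9 * budget N)"
    using dist_\<theta>_ag[of n] n by (simp add: mult_left_mono)
  have "2 * w\<^sup>2 / (625 * w') * (y \<bullet> y) \<le> 2 * w\<^sup>2 / (625 * w') * ((2 / (real n + 2))\<^sup>2 * (9 * budget N))"
    using 2 w'0 by (intro mult_left_mono) auto
  also have "\<dots> = (2 * w\<^sup>2 / (625 * w') * (2 / (real n + 2))\<^sup>2 * 9) * budget N" by simp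
  also have "\<dots> \<le> 36/625 * budget N"
  proof (intro mult_right_mono budget_nonneg)
    have "real n * real n * (real n + 1) \<le> (real n + 2) * (real n + 2) * (real n + 2)"
      by (intro mult_mono) auto
    then show "2 * w\<^sup>2 / (625 * w') * (2 / (real n + 2))\<^sup>2 * 9 \<le> 36/625"
      unfolding w by (simp add: power2_eq_square divide_simps) (simp add: algebra_simps)
  qed
  finally show ?thesis using 1 by linarith
qed

lemma main_bound:
  assumes p: "\<And>k. 1 \<le> k \<Longrightarrow> k \<le> N \<Longrightarrow> p \<le> P k \<bullet> P k" and N: "5 \<le> N" and \<kappa>2: "\<kappa> \<le> 1/2"
  shows "(real N - 1) * real N * (real N + 2) / 8 * p
    \<le> (261/100 + 37/25 * \<kappa>) * (661/625) * budget N
      + (real N - 1) * real N * (real N + 2) / 8 * (2/25 * (261/100 + 37/25 * \<kappa>) + 1) * \<epsilon>"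
proof -
  define K where "K = 261/100 + 37/25 * \<kappa>"
  define Z where "Z = (real N - 1) * real N * (real N + 2) / 8"
  have K: "K > 0" using \<kappa> by (simp add: K_def)
  have z: "real (N - 1) * (real (N - 1) + 1) * (real (N - 1) + 2) * (real (N - 1) + 3) / (8 * (real N + 1)) = Z"
    using N by (simp add: Z_def of_nat_diff field_simps)
  have "potential N + Z * (p / K) \<le> budget N + Z * ((2/25 + 1 / K) * \<epsilon>)"
    using main_sum[OF p N \<kappa>2, of "N - 1"] N unfolding z K_def[symmetric] by simp
  then have "Z * (p / K) \<le> 661/625 * budget N + Z * ((2/25 + 1 / K) * \<epsilon>)"
    using potential_ge N by simp
  then have "K * (Z * (p / K)) \<le> K * (661/625 * budget N + Z * ((2/25 + 1 / K) * \<epsilon>))"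
    using K by (intro mult_left_mono) auto
  moreover have "K * (Z * (p / K)) = Z * p" "K * (Z * ((2/25 + 1 / K) * \<epsilon>)) = Z * (2/25 * K + 1) * \<epsilon>"
    using K by (simp_all add: field_simps)
  ultimately show ?thesis unfolding K_def[symmetric] Z_def[symmetric] by (simp add: distrib_left)
qed

text \<open>The constant \<open>K'\<close> varies with the iteration. Replacing 1 /
  \<open>K'\<close> by \<open>(1 - r * \<tau>) / K\<close> gives weights with a closed sum;
  \<open>r\<close> is a linear upper bound of \<open>(6/5 - \<kappa>/2) / K\<close> on [1/2, 1]. The
  smaller weight multiplies \<open>p - \<epsilon>\<close>, which therefore has to be
  nonnegative.\<close>

lemma coarse_sum:
  assumes p: "\<And>k. 1 \<le> k \<Longrightarrow> k \<le> N \<Longrightarrow> p \<le> P k \<bullet> P k" and \<kappa>2: "1/2 \<le> \<kappa>" and pe: "\<epsilon> \<le> p"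
  defines "K \<equiv> 197/50 + \<kappa> / 2" and "r \<equiv> 3/10 - 7/50 * \<kappa>"
  shows "Suc j \<le> N \<Longrightarrow> energy (Suc j) + W (Suc (Suc j)) * cost (Suc j)
      + (real j * (real j + 1) * (real j + 2) / 6 - r * (real j * (real j + 3) / 4)) * ((p - \<epsilon>) / K) \<le> budget (Suc j)"
proof (induction j)
  case 0
  then show ?case using energy_bound[of 1] by (simp add: numeral_2_eq_2)
next
  case (Suc j)
  define k where "k = Suc (Suc j)"
  define \<tau> where "\<tau> = 1 / (real j + 1)"
  define K' where "K' = K + (6/5 - \<kappa> / 2) * \<tau>"
  define z where "z i = i * (i + 1) * (i + 2) / 6 - r * (i * (i + 3) / 4)" for i
  have K: "K > 0" using \<kappa> by (simp add: K_def)
  have \<tau>: "0 \<le> \<tau>" by (simp add: \<tau>_def)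
  have "(6/5 - \<kappa> / 2) * \<tau> \<ge> 0" using \<kappa> \<tau> by (intro mult_nonneg_nonneg) auto
  then have K': "K' > 0" "K \<le> K'" using K by (auto simp: K'_def)
  have "6/5 - \<kappa> / 2 \<le> r * K"
  proof -
    have "r * K - (6/5 - \<kappa> / 2) = 7/100 * ((\<kappa> - 1/2) * (1 - \<kappa>)) + (17/1000 - 33/5000 * \<kappa>)"
      by (simp add: r_def K_def field_simps)
    moreover have "0 \<le> 7/100 * ((\<kappa> - 1/2) * (1 - \<kappa>))" using \<kappa> \<kappa>2 by (intro mult_nonneg_nonneg) auto
    ultimately show ?thesis using \<kappa> by linarith
  qed
  then have "(6/5 - \<kappa> / 2) * \<tau> \<le> r * K * \<tau>" using \<tau> by (rule mult_right_mono)
  then have K'le: "K' \<le> K * (1 + r * \<tau>)" by (simp add: K'_def algebra_simps)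
  have "(1 - r * \<tau>) * K' \<le> K"
  proof (cases "r * \<tau> \<le> 1")
    case True
    then have "(1 - r * \<tau>) * K' \<le> (1 - r * \<tau>) * (K * (1 + r * \<tau>))" using K'le by (intro mult_left_mono) auto
    also have "\<dots> = K - K * (r * \<tau>)\<^sup>2" by (simp add: algebra_simps power2_eq_square)
    also have "\<dots> \<le> K" using K by simp
    finally show ?thesis .
  next
    case False
    then have "(1 - r * \<tau>) * K' \<le> 0" using K' by (intro mult_nonpos_nonneg) auto
    then show ?thesis using K by linarith
  qed
  then have inv: "(1 - r * \<tau>) / K \<le> 1 / K'" using K K' by (simp add: field_simps)
  have w: "W k * (1 - r * \<tau>) = z (real (Suc j)) - z (real j)"
    by (simp add: W_def k_def z_def \<tau>_def field_simps)
  have "W k * ((1 - r * \<tau>) / K) * (p - \<epsilon>) \<le> W k * (1 / K') * (p - \<epsilon>)"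
    using inv pe by (intro mult_right_mono mult_left_mono W_nonneg) auto
  moreover have "W k * p / K' \<le> W k * (P k \<bullet> P k) / K'"
    using p[of k] Suc.prems K' by (intro divide_right_mono mult_left_mono W_nonneg) (auto simp: k_def)
  moreover have "energy k + W (Suc k) * cost k + W k * (P k \<bullet> P k) / K' \<le> energy (Suc j) + W k * cost (Suc j)
    + \<kappa> * (real k * (xs \<bullet> xs + M\<^sup>2)) + (W (Suc k) + real k) * \<epsilon> + W k / K' * \<epsilon>"
    using coarse_step[OF _ \<kappa>2, of j] Suc.prems by (simp add: k_def K'_def K_def \<tau>_def)
  moreover have "budget k = budget (Suc j) + \<kappa> * (real k * (xs \<bullet> xs + M\<^sup>2)) + (W (Suc k) + real k) * \<epsilon>"
    using budget_Suc[of "Suc j"] by (simp add: k_def)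
  moreover have "W k * ((1 - r * \<tau>) / K) * (p - \<epsilon>) = (z (real (Suc j)) - z (real j)) * ((p - \<epsilon>) / K)"
    unfolding w[symmetric] by simp
  moreover have "W k * (1 / K') * (p - \<epsilon>) = W k * p / K' - W k / K' * \<epsilon>"
    by (simp add: right_diff_distrib diff_divide_distrib)
  moreover have "energy (Suc j) + W k * cost (Suc j) + z (real j) * ((p - \<epsilon>) / K) \<le> budget (Suc j)"
    using Suc by (simp add: z_def k_def)
  moreover have "(z (real (Suc j)) - z (real j)) * ((p - \<epsilon>) / K) = z (real (Suc j)) * ((p - \<epsilon>) / K) - z (real j) * ((p - \<epsilon>) / K)"
    by (rule left_diff_distrib)
  ultimately have "energy k + W (Suc k) * cost k + z (real (Suc j)) * ((p - \<epsilon>) / K) \<le> budget k"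
    by linarith
  then show ?case unfolding z_def k_def .
qed

lemma coarse_bound:
  assumes p: "\<And>k. 1 \<le> k \<Longrightarrow> k \<le> N \<Longrightarrow> p \<le> P k \<bullet> P k" and \<kappa>2: "1/2 \<le> \<kappa>" and pe: "\<epsilon> \<le> p" and N: "1 \<le> N"
  shows "((real N - 1) * real N * (real N + 1) / 6 - (3/10 - 7/50 * \<kappa>) * ((real N - 1) * (real N + 2) / 4)) * (p - \<epsilon>)
    \<le> (197/50 + \<kappa> / 2) * budget N"
proof -
  have K: "197/50 + \<kappa> / 2 > 0" using \<kappa> by simp
  have "0 \<le> energy N + W (Suc N) * cost N"
    using energy_nonneg[of N] W_nonneg[of "Suc N"] cost_nonneg[of N] by (simp add: energy_def)
  then have "((real N - 1) * real N * (real N + 1) / 6 - (3/10 - 7/50 * \<kappa>) * ((real N - 1) * (real N + 2) / 4)) * ((p - \<epsilon>) / (197/50 + \<kappa> / 2)) \<le> budget N"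
  proof -
    have "real (N - 1) = real N - 1" "Suc (N - 1) = N" using N by auto
    then show ?thesis using coarse_sum[OF p \<kappa>2 pe, of "N - 1"] \<open>0 \<le> energy N + W (Suc N) * cost N\<close>
      by (simp add: add.commute)
  qed
  then show ?thesis using K by (simp add: pos_divide_le_eq mult.commute)
qed

end

section \<open>Comparison with the claimed rate\<close>

text \<open>(n - 1) (n + 2) = S - 2 is at least 28/30 of S for n >= 5, so the claim can carry 6 *
  28/30 = 28/5 of \<open>d\<close>. What exceeds this is proportional to \<open>\<kappa>\<close> and
  is moved to the curvature term, using d <= 4 m.\<close>

lemma rate_from_main:
  fixes n d x m \<kappa> \<epsilon> p :: real
  assumes n: "5 \<le> n" and nn: "0 \<le> d" "0 \<le> x" "x \<le> m" "d \<le> 2 * x + 2 * m" and \<kappa>: "0 \<le> \<kappa>" "\<kappa> \<le> 1/2" and \<epsilon>: "0 \<le> \<epsilon>"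
    and p: "(n - 1) * n * (n + 2) / 8 * p \<le> (261/100 + 37/25 * \<kappa>) * (661/625)
      * (2 * d + \<kappa> * (n * (n + 1) / 2) * (x + m) + \<epsilon> * (n * (n + 1) * (n + 5) / 6))
      + (n - 1) * n * (n + 2) / 8 * (2/25 * (261/100 + 37/25 * \<kappa>) + 1) * \<epsilon>"
  shows "p \<le> 12 * (4 * d / (n\<^sup>2 * (n + 1)) + \<kappa> / n * (x + 2 * m) + 2 * \<epsilon>)"
proof -
  define S q Z K where "S = n * (n + 1)" "q = (n - 1) * (n + 2)" "Z = (n - 1) * n * (n + 2) / 8"
    "K = (261/100 + 37/25 * \<kappa>) * (661/625)"
  note defs = this
  have S: "30 \<le> S" using n mult_mono[of 5 n 6 "n + 1"] by (simp add: defs)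
  have q: "28/30 * S \<le> q" using S by (simp add: defs algebra_simps add_divide_distrib)
  have Z: "Z = n * q / 8" by (simp add: defs)
  have Z0: "Z > 0" using n by (simp add: defs)
  have K: "0 \<le> K" "K \<le> 14/5 + 157/100 * \<kappa>" "K \<le> 71/20" using \<kappa> by (auto simp: defs)
  have xm: "\<kappa> * x \<le> \<kappa> * m" "0 \<le> \<kappa> * m" using nn \<kappa> by (auto intro: mult_left_mono)
  have "2 * K * d \<le> 28/5 * d + 157/50 * (\<kappa> * d)"
    using mult_right_mono[OF K(2) nn(1)] by (simp add: algebra_simps)
  moreover have "\<kappa> * d \<le> 4 * (\<kappa> * m)"
    using mult_left_mono[OF nn(4) \<kappa>(1)] xm by (simp add: algebra_simps)
  moreover have "K * (\<kappa> * (S / 2) * (x + m)) \<le> 71/20 * (\<kappa> * (S / 2) * (x + m))"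
    using K S nn \<kappa> by (intro mult_right_mono) auto
  moreover have "S * (\<kappa> * x) \<le> S * (\<kappa> * m)" "30 * (\<kappa> * m) \<le> S * (\<kappa> * m)"
    using xm S by (auto intro: mult_left_mono mult_right_mono)
  ultimately have 1: "K * (2 * d + \<kappa> * (S / 2) * (x + m)) \<le> 28/5 * d + 7/5 * S * (\<kappa> * (x + 2 * m))"
    using xm by argo
  have dd: "28/5 * d \<le> Z * (48 * d / (n\<^sup>2 * (n + 1)))"
  proof -
    have "Z * (48 * d / (n\<^sup>2 * (n + 1))) = 6 * (q / S) * d"
      using n by (simp add: Z defs power2_eq_square divide_simps)
    moreover have "28/30 \<le> q / S" using q S by (simp add: field_simps)
    then have "6 * (28/30) * d \<le> 6 * (q / S) * d" using nn by (intro mult_right_mono) auto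
    ultimately show ?thesis by simp
  qed
  have kk: "7/5 * S * (\<kappa> * (x + 2 * m)) \<le> Z * (12 * (\<kappa> / n * (x + 2 * m)))"
  proof -
    have "Z * (12 * (\<kappa> / n * (x + 2 * m))) = 3/2 * q * (\<kappa> * (x + 2 * m))"
      using n by (simp add: Z)
    moreover have "7/5 * S * (\<kappa> * (x + 2 * m)) \<le> 3/2 * q * (\<kappa> * (x + 2 * m))"
      using q nn \<kappa> by (intro mult_right_mono mult_nonneg_nonneg) auto
    ultimately show ?thesis by simp
  qed
  have ee: "K * (\<epsilon> * (S * (n + 5) / 6)) + Z * (2/25 * (261/100 + 37/25 * \<kappa>) + 1) * \<epsilon> \<le> Z * (24 * \<epsilon>)"
  proof -
    have "S * (n + 5) \<le> S * (2 * n)" using n S by (intro mult_left_mono) auto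
    moreover have "n * (28/30 * S) \<le> n * q" using q n by (intro mult_left_mono) auto
    moreover have "K * (S * (n + 5) / 6) \<le> 71/20 * (S * (n + 5) / 6)"
      using K S n by (intro mult_right_mono) auto
    moreover have "0 \<le> S * n" using S n by simp
    ultimately have "K * (S * (n + 5) / 6) \<le> Z * 12" unfolding Z by argo
    moreover have "Z * (2/25 * (261/100 + 37/25 * \<kappa>) + 1) \<le> Z * 12"
      using Z0 \<kappa> by (intro mult_left_mono) auto
    ultimately have "(K * (S * (n + 5) / 6) + Z * (2/25 * (261/100 + 37/25 * \<kappa>) + 1)) * \<epsilon> \<le> Z * 24 * \<epsilon>"
      using \<epsilon> by (intro mult_right_mono) auto
    then show ?thesis by (simp add: algebra_simps)
  qed
  have "Z * p \<le> K * (2 * d + \<kappa> * (S / 2) * (x + m)) + (K * (\<epsilon> * (S * (n + 5) / 6)) + Z * (2/25 * (261/100 + 37/25 * \<kappa>) + 1) * \<epsilon>)"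
    using p unfolding defs[symmetric] by (simp only: defs(1)[symmetric] distrib_left[of K])
  also have "\<dots> \<le> Z * (12 * (4 * d / (n\<^sup>2 * (n + 1)) + \<kappa> / n * (x + 2 * m) + 2 * \<epsilon>))"
  proof -
    have "Z * (12 * (4 * a + b + 2 * \<epsilon>)) = Z * (48 * a) + Z * (12 * b) + Z * (24 * \<epsilon>)" for a b
      by (simp add: algebra_simps)
    moreover have "48 * d / (n\<^sup>2 * (n + 1)) = 48 * (d / (n\<^sup>2 * (n + 1)))" "4 * d / (n\<^sup>2 * (n + 1)) = 4 * (d / (n\<^sup>2 * (n + 1)))"
      by simp_all
    ultimately show ?thesis using 1 dd kk ee by (simp only:)
  qed
  finally show ?thesis using Z0 by simp
qed

text \<open>\<open>r\<close> is the quotient Z / V at n = 6. The excess in the coefficient of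
  \<open>d\<close> is not proportional to \<open>\<kappa>\<close> here, but
  \<open>\<kappa> >= 1/2\<close> still lets the curvature term absorb it.\<close>

lemma rate_from_coarse:
  fixes n d x m \<kappa> \<epsilon> p :: real
  assumes n: "6 \<le> n" and nn: "0 \<le> d" "0 \<le> x" "x \<le> m" "d \<le> 2 * x + 2 * m" and \<kappa>: "1/2 \<le> \<kappa>" "\<kappa> \<le> 1" and \<epsilon>: "0 \<le> \<epsilon>"
    and p: "((n - 1) * n * (n + 1) / 6 - (3/10 - 7/50 * \<kappa>) * ((n - 1) * (n + 2) / 4)) * (p - \<epsilon>)
      \<le> (197/50 + \<kappa> / 2) * (2 * d + \<kappa> * (n * (n + 1) / 2) * (x + m) + \<epsilon> * (n * (n + 1) * (n + 5) / 6))"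
  shows "p \<le> 12 * (4 * d / (n\<^sup>2 * (n + 1)) + \<kappa> / n * (x + 2 * m) + 2 * \<epsilon>)"
proof -
  define S Z K V r where "S = n * (n + 1)" "Z = (n - 1) * n * (n + 1) / 6 - (3/10 - 7/50 * \<kappa>) * ((n - 1) * (n + 2) / 4)"
    "K = 197/50 + \<kappa> / 2" "V = n\<^sup>2 * (n + 1)" "r = (64 + 14/5 * \<kappa>) / 504"
  note defs = this
  have S: "42 \<le> S" using n mult_mono[of 6 n 7 "n + 1"] by (simp add: defs)
  have V: "V = n * S" "V > 0" using n by (simp_all add: defs power2_eq_square)
  have r: "r > 0" using \<kappa> by (simp add: defs)
  have Z: "r * V \<le> Z"
  proof -
    have "5/6 * n * S \<le> (n - 1) * S" using n S by (intro mult_right_mono) auto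
    then have 1: "5/36 * V \<le> (n - 1) * n * (n + 1) / 6" by (simp add: V(1) defs(1) algebra_simps add_divide_distrib)
    \<comment> \<open>The cubic expresses that (n - 1) (n + 2) / (4 V) is at most its value 20/504
      at n = 6, hence the root 6.\<close>
    have "0 \<le> (n - 6) * (40 * n\<^sup>2 + 28 * n - 84)"
    proof (intro mult_nonneg_nonneg)
      have "36 \<le> n\<^sup>2" using n mult_mono[of 6 n 6 n] by (simp add: power2_eq_square)
      then show "0 \<le> 40 * n\<^sup>2 + 28 * n - 84" using n by simp
    qed (use n in auto)
    then have "(n - 1) * (n + 2) / 4 \<le> 20/504 * V"
      by (simp add: defs(4) power2_eq_square algebra_simps)
    then have "(3/10 - 7/50 * \<kappa>) * ((n - 1) * (n + 2) / 4) \<le> (3/10 - 7/50 * \<kappa>) * (20/504 * V)"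
      using \<kappa> by (intro mult_left_mono) auto
    then show ?thesis using 1 unfolding defs(2,5) by argo
  qed
  have Z0: "Z > 0" using Z r V by (meson less_le_trans mult_pos_pos)
  have \<kappa>0: "0 \<le> \<kappa>" using \<kappa> by simp
  have k2: "\<kappa> * \<kappa> \<le> 3/2 * \<kappa> - 1/2"
    using mult_nonneg_nonneg[of "\<kappa> - 1/2" "1 - \<kappa>"] \<kappa> by argo
  have main: "K * (2 * d + \<kappa> * (S / 2) * (x + m)) \<le> r * (48 * d + 12 * \<kappa> * S * (x + 2 * m))"
  proof -
    have "(2 * K - 48 * r) * d \<le> (9/5 + 3/4 * \<kappa>) * (4 * m)"
    proof (rule mult_mono)
      show "2 * K - 48 * r \<le> 9/5 + 3/4 * \<kappa>" using \<kappa> unfolding defs by argo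
    qed (use nn \<kappa> in auto)
    moreover have "(9/5 + 3/4 * \<kappa>) * 4 \<le> 42 * \<kappa> * (63/100 - 3/10 * \<kappa>)"
      using k2 \<kappa> by (simp add: algebra_simps)
    then have "(9/5 + 3/4 * \<kappa>) * 4 * m \<le> 42 * \<kappa> * (63/100 - 3/10 * \<kappa>) * m"
      using nn by (intro mult_right_mono) auto
    moreover have "42 * (\<kappa> * (63/100 - 3/10 * \<kappa>) * m) \<le> S * (\<kappa> * (63/100 - 3/10 * \<kappa>) * m)"
      using S nn \<kappa> by (intro mult_right_mono mult_nonneg_nonneg) auto
    moreover have "(\<kappa> * S) * ((63/100 - 3/10 * \<kappa>) * m) \<le> (\<kappa> * S) * (12 * r * (x + 2 * m) - K / 2 * (x + m))"
    proof (rule mult_left_mono)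
      have "(K / 2 - 12 * r) * x \<le> (K / 2 - 12 * r) * m"
        using nn \<kappa> by (intro mult_left_mono) (auto simp: defs)
      moreover have "(63/100 - 3/10 * \<kappa>) * m \<le> (36 * r - K) * m"
      proof (rule mult_right_mono)
        show "63/100 - 3/10 * \<kappa> \<le> 36 * r - K" using \<kappa> unfolding defs by argo
      qed (use nn in auto)
      ultimately show "(63/100 - 3/10 * \<kappa>) * m \<le> 12 * r * (x + 2 * m) - K / 2 * (x + m)"
        by argo
    qed (use \<kappa> S in auto)
    ultimately show ?thesis by (simp add: algebra_simps)
  qed
  have "r * (48 * d + 12 * \<kappa> * S * (x + 2 * m)) = r * V * (48 * d / V + 12 * (\<kappa> / n * (x + 2 * m)))"
    using n S by (simp add: V(1) field_simps)
  also have "\<dots> \<le> Z * (48 * d / V + 12 * (\<kappa> / n * (x + 2 * m)))"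
    using Z nn \<kappa> V n by (intro mult_right_mono add_nonneg_nonneg mult_nonneg_nonneg divide_nonneg_nonneg) auto
  finally have 1: "K * (2 * d + \<kappa> * (S / 2) * (x + m)) \<le> Z * (48 * d / V + 12 * (\<kappa> / n * (x + 2 * m)))"
    using main by simp
  have 2: "K * (\<epsilon> * (S * (n + 5) / 6)) \<le> Z * (23 * \<epsilon>)"
  proof -
    have "S * (n + 5) \<le> S * (2 * n)" using n S by (intro mult_left_mono) auto
    moreover have "K * (S * (n + 5) / 6) \<le> 5 * (S * (n + 5) / 6)"
      using S n \<kappa> by (intro mult_right_mono) (auto simp: defs)
    moreover have "1/10 * V \<le> r * V" using V \<kappa> by (intro mult_right_mono) (auto simp: defs)
    moreover have "V = S * n" using V by simp
    moreover have "0 \<le> S * n" using S n by simp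
    ultimately have "K * (S * (n + 5) / 6) \<le> Z * 23" using Z by linarith
    from mult_right_mono[OF this \<epsilon>] show ?thesis by (simp add: algebra_simps)
  qed
  have "Z * (p - \<epsilon>) \<le> K * (2 * d + \<kappa> * (S / 2) * (x + m)) + K * (\<epsilon> * (S * (n + 5) / 6))"
    using p unfolding defs[symmetric] by (simp only: defs(1)[symmetric] distrib_left[of K])
  also have "\<dots> \<le> Z * (48 * d / V + 12 * (\<kappa> / n * (x + 2 * m)) + 23 * \<epsilon>)"
    using 1 2 unfolding distrib_left[of Z] by linarith
  finally have "p - \<epsilon> \<le> 48 * d / V + 12 * (\<kappa> / n * (x + 2 * m)) + 23 * \<epsilon>" using Z0 by simp
  then show ?thesis by (simp add: defs(4) algebra_simps)
qed

context ncgs_normalized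
begin

lemma accelerated_rate:
  assumes p: "\<And>k. 1 \<le> k \<Longrightarrow> k \<le> N \<Longrightarrow> p \<le> P k \<bullet> P k" and N: "1 \<le> N"
  shows "p \<le> 12 * (4 * ((\<theta> 0 - xs) \<bullet> (\<theta> 0 - xs)) / ((real N)\<^sup>2 * (real N + 1))
      + \<kappa> / real N * (xs \<bullet> xs + 2 * M\<^sup>2) + 2 * \<epsilon>)"
proof -
  define d x m where "d = (\<theta> 0 - xs) \<bullet> (\<theta> 0 - xs)" "x = xs \<bullet> xs" "m = M\<^sup>2"
  note dxm = this
  have nn: "0 \<le> d" "0 \<le> x" "x \<le> m" "d \<le> 2 * x + 2 * m"
  proof -
    have "0 \<le> (\<theta> 0 + xs) \<bullet> (\<theta> 0 + xs)" by simp
    then show "d \<le> 2 * x + 2 * m"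
      using inner_le_M[OF \<theta>_mem[of 0]] by (simp add: dxm inner_simps inner_commute)
  qed (auto simp: dxm inner_le_M xs_mem)
  have budget: "budget N = 2 * d + \<kappa> * (real N * (real N + 1) / 2) * (x + m) + \<epsilon> * (real N * (real N + 1) * (real N + 5) / 6)"
    by (simp add: budget_def dxm)
  consider "N \<le> 4 \<or> N = 5 \<and> 1/2 \<le> \<kappa>" | "5 \<le> N" "\<kappa> \<le> 1/2" | "6 \<le> N" "1/2 \<le> \<kappa>" by linarith
  then have "p \<le> 12 * (4 * d / ((real N)\<^sup>2 * (real N + 1)) + \<kappa> / real N * (x + 2 * m) + 2 * \<epsilon>)"
  proof cases
    case 1
    define kx km where "kx = \<kappa> * x" "km = \<kappa> * m"
    have kxm: "0 \<le> kx" "kx \<le> km" using nn \<kappa> by (auto simp: kx_km_def intro: mult_left_mono)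
    have b: "budget N = 2 * d + (real N * (real N + 1) / 2) * (kx + km) + (real N * (real N + 1) * (real N + 5) / 6) * \<epsilon>"
      by (simp add: budget kx_km_def algebra_simps)
    have g: "\<kappa> / real N * (x + 2 * m) = (kx + 2 * km) / real N"
      by (simp add: kx_km_def distrib_left add_divide_distrib)
    note D = displacement_bound[OF p N, unfolded b]
    from 1 N consider "N = 1" | "N = 2" | "N = 3" | "N = 4" | "N = 5" "1/2 \<le> \<kappa>" by linarith
    then have "p \<le> 12 * (4 * d / ((real N)\<^sup>2 * (real N + 1)) + (kx + 2 * km) / real N + 2 * \<epsilon>)"
    proof cases
      case 5
      \<comment> \<open>Converts the part of \<open>d\<close> that exceeds the claim, bounded by a
        multiple of \<open>m\<close>, into curvature.\<close>
      have "m \<le> 2 * km" using mult_right_mono[OF 5(2), of m] nn by (simp add: kx_km_def)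
      then show ?thesis
        using D nn kxm \<epsilon> unfolding 5(1) by (simp add: eval_nat_numeral sum.atLeast_Suc_atMost) argo
    next
      case 1
      then show ?thesis using D nn kxm \<epsilon> by (simp add: eval_nat_numeral sum.atLeast_Suc_atMost)
    next
      case 2
      then show ?thesis using D nn kxm \<epsilon> by (simp add: eval_nat_numeral sum.atLeast_Suc_atMost) argo
    next
      case 3
      then show ?thesis using D nn kxm \<epsilon> by (simp add: eval_nat_numeral sum.atLeast_Suc_atMost) argo
    next
      case 4
      then show ?thesis using D nn kxm \<epsilon> by (simp add: eval_nat_numeral sum.atLeast_Suc_atMost) argo
    qed
    then show ?thesis unfolding g .
  next
    case 2
    show ?thesis
      by (rule rate_from_main[OF _ nn \<kappa>(1) 2(2) \<epsilon>])
         (use main_bound[OF p 2] 2 in \<open>simp_all only: budget of_nat_le_iff[symmetric] of_nat_numeral\<close>)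
  next
    case 3
    show ?thesis
    proof (cases "\<epsilon> \<le> p")
      case True
      show ?thesis
        by (rule rate_from_coarse[OF _ nn 3(2) \<kappa>(2) \<epsilon>])
           (use coarse_bound[OF p 3(2) True N] 3 in \<open>simp_all only: budget of_nat_le_iff[symmetric] of_nat_numeral\<close>)
    next
      case False
      moreover have "0 \<le> 4 * d / ((real N)\<^sup>2 * (real N + 1)) + \<kappa> / real N * (x + 2 * m)"
        using nn \<kappa> by (intro add_nonneg_nonneg mult_nonneg_nonneg divide_nonneg_nonneg) auto
      ultimately show ?thesis using \<epsilon> by simp
    qed
  qed
  then show ?thesis by (simp add: dxm)
qed

end

section \<open>Reduction to the normalised iteration\<close>

text \<open>Completing the square turns the objective into the squared distance to
  \<open>x - \<gamma> \<omega>\<close>, up to scaling and a constant. Uniqueness of the projection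
  identifies the point chosen by \<open>arg_min_on\<close>.\<close>

lemma prox_point_variational:
  fixes \<Omega> :: "'a::euclidean_space set"
  assumes \<Omega>: "closed \<Omega>" "convex \<Omega>" "\<Omega> \<noteq> {}" and \<gamma>: "\<gamma> > 0"
  shows "prox_point \<Omega> x \<omega> \<gamma> \<in> \<Omega>"
    and "\<And>y. y \<in> \<Omega> \<Longrightarrow> (\<omega> + (1 / \<gamma>) *\<^sub>R (prox_point \<Omega> x \<omega> \<gamma> - x)) \<bullet> (prox_point \<Omega> x \<omega> \<gamma> - y) \<le> 0"
proof -
  define h where "h = (\<lambda>\<theta>. inner \<omega> \<theta> + 1 / (2 * \<gamma>) * (norm (\<theta> - x))\<^sup>2)"
  define a where "a = x - \<gamma> *\<^sub>R \<omega>"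
  define c where "c = closest_point \<Omega> a"
  have h: "h y = (1 / (2 * \<gamma>)) * (norm (y - a))\<^sup>2 + (inner \<omega> x - \<gamma> / 2 * (norm \<omega>)\<^sup>2)" for y
    using \<gamma> unfolding h_def a_def power2_norm_eq_inner
    by (simp add: inner_simps inner_commute field_simps)
  have h_le: "h y \<le> h z \<longleftrightarrow> norm (y - a) \<le> norm (z - a)" for y z
  proof -
    have "h y \<le> h z \<longleftrightarrow> (norm (y - a))\<^sup>2 \<le> (norm (z - a))\<^sup>2"
      using \<gamma> by (simp add: h divide_le_cancel)
    then show ?thesis by (simp add: power2_le_iff_abs_le)
  qed
  have cS: "c \<in> \<Omega>" "\<And>y. y \<in> \<Omega> \<Longrightarrow> dist a c \<le> dist a y"
    using \<Omega> by (auto simp: c_def closest_point_in_set closest_point_le)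
  have "is_arg_min h (\<lambda>y. y \<in> \<Omega>) c"
    using cS by (simp add: is_arg_min_linorder h_le dist_norm norm_minus_commute)
  then have "is_arg_min h (\<lambda>y. y \<in> \<Omega>) (arg_min_on h \<Omega>)"
    unfolding arg_min_on_def arg_min_def by (rule someI)
  then have p: "arg_min_on h \<Omega> \<in> \<Omega>" "\<And>y. y \<in> \<Omega> \<Longrightarrow> dist a (arg_min_on h \<Omega>) \<le> dist a y"
    by (auto simp: is_arg_min_linorder h_le dist_norm norm_minus_commute)
  then have "arg_min_on h \<Omega> = c"
    unfolding c_def using \<Omega> by (intro closest_point_unique) auto
  then have eq: "prox_point \<Omega> x \<omega> \<gamma> = c" by (simp add: prox_point_def h_def)
  show "prox_point \<Omega> x \<omega> \<gamma> \<in> \<Omega>" using cS(1) by (simp add: eq)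
  show "(\<omega> + (1 / \<gamma>) *\<^sub>R (prox_point \<Omega> x \<omega> \<gamma> - x)) \<bullet> (prox_point \<Omega> x \<omega> \<gamma> - y) \<le> 0" if "y \<in> \<Omega>" for y
  proof -
    have "(a - c) \<bullet> (y - c) \<le> 0"
      unfolding c_def using \<Omega> that by (intro closest_point_dot) auto
    moreover have "(\<omega> + (1 / \<gamma>) *\<^sub>R (c - x)) \<bullet> (c - y) = (1 / \<gamma>) * ((a - c) \<bullet> (y - c))"
      using \<gamma> by (simp add: a_def inner_simps field_simps)
    ultimately show ?thesis using \<gamma> by (simp add: eq divide_nonpos_pos)
  qed
qed

text \<open>For \<open>\<omega> = 0\<close> a point of \<open>\<Omega>\<close> is its own prox
  point, so the bound on prox points is a bound on all of \<open>\<Omega>\<close>.\<close>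

lemma norm_le_if_prox_bounded:
  fixes \<Omega> :: "'a::euclidean_space set"
  assumes \<Omega>: "closed \<Omega>" "convex \<Omega>" and M: "\<forall>\<gamma>>0. \<forall>x\<in>\<Omega>. \<forall>\<omega>. norm (prox_point \<Omega> x \<omega> \<gamma>) \<le> M" and x: "x \<in> \<Omega>"
  shows "norm x \<le> M"
proof -
  have "(0 + (1 / 1) *\<^sub>R (prox_point \<Omega> x 0 1 - x)) \<bullet> (prox_point \<Omega> x 0 1 - x) \<le> 0"
    using \<Omega> x by (intro prox_point_variational(2)) auto
  then have "(prox_point \<Omega> x 0 1 - x) \<bullet> (prox_point \<Omega> x 0 1 - x) \<le> 0" by simp
  then have "prox_point \<Omega> x 0 1 = x" by (metis inner_eq_zero_iff inner_ge_zero order_antisym right_minus_eq)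
  then show ?thesis using M x by (metis zero_less_one)
qed

text \<open>The numerator of the step length is the linear objective at a maximiser, hence at least
  its value 0 at \<open>ut\<close>. So the step length lies in [0, 1]; if \<open>v = ut\<close> the
  quotient is 0 / 0 = 0.\<close>

lemma condg_mem:
  assumes "convex \<Omega>" "u \<in> \<Omega>" "condg \<Omega> w u lam \<eta> u'" "lam > 0"
  shows "u' \<in> \<Omega>"
proof -
  have "condg_iterate \<Omega> w u lam \<eta> ut \<Longrightarrow> ut \<in> \<Omega>" for ut
  proof (induction rule: condg_iterate.induct)
    case (step ut v \<xi>)
    have v: "v \<in> \<Omega>" "condg_obj w u lam ut ut \<le> condg_obj w u lam ut v"
      using step by (auto simp: is_arg_max_linorder)
    have "inner ((1 / lam) *\<^sub>R (u - ut) - w) (v - ut) = condg_obj w u lam ut v"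
      by (simp add: condg_obj_def inner_simps algebra_simps)
    then have "0 \<le> inner ((1 / lam) *\<^sub>R (u - ut) - w) (v - ut)"
      using v(2) by (simp add: condg_obj_def)
    then have "0 \<le> \<xi>" "\<xi> \<le> 1" using step.hyps(4) assms(4) by (auto simp: condg_step_def)
    then show ?case using step.IH v(1) assms(1) by (intro convexD) auto
  qed (use assms in auto)
  then show ?thesis using assms(3) by (simp add: condg_def)
qed

text \<open>The stopping test bounds a supremum; boundedness of \<open>\<Omega>\<close> ensures that
  it dominates each single value.\<close>

lemma condg_variational:
  assumes bd: "\<And>x. x \<in> \<Omega> \<Longrightarrow> norm x \<le> M" and "condg \<Omega> w u lam \<eta> u'" and x: "x \<in> \<Omega>"
  shows "(w + (1 / lam) *\<^sub>R (u' - u)) \<bullet> (u' - x) \<le> \<eta>"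
proof -
  define z where "z = w + (1 / lam) *\<^sub>R (u' - u)"
  have "condg_obj w u lam u' y \<le> norm z * (norm u' + M)" if "y \<in> \<Omega>" for y
  proof -
    have "z \<bullet> (u' - y) \<le> norm z * norm (u' - y)" by (rule norm_cauchy_schwarz)
    also have "\<dots> \<le> norm z * (norm u' + M)"
      using norm_triangle_ineq4[of u' y] bd[OF that] by (intro mult_left_mono) auto
    finally show ?thesis by (simp add: condg_obj_def z_def)
  qed
  then have "condg_obj w u lam u' x \<le> condg_V \<Omega> w u lam u'"
    unfolding condg_V_def using x by (intro cSUP_upper bdd_aboveI2) auto
  then show ?thesis using assms(2) by (simp add: condg_def condg_obj_def)
qed

section \<open>Quadratic bounds from smoothness\<close>

lemma descent:
  fixes S :: "'a::real_inner set" and F :: "'a \<Rightarrow> real"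
  assumes "convex S" and der: "\<And>z. z \<in> S \<Longrightarrow> (F has_derivative (\<lambda>h. h \<bullet> G z)) (at z)"
    and lip: "\<And>y z. y \<in> S \<Longrightarrow> z \<in> S \<Longrightarrow> norm (G y - G z) \<le> L * norm (y - z)"
    and x: "x \<in> S" and y: "y \<in> S"
  shows "F y \<le> F x + G x \<bullet> (y - x) + L / 2 * (norm (y - x))\<^sup>2"
proof -
  define h where "h = y - x"
  define q where "q t = F (x + t *\<^sub>R h) - t * (G x \<bullet> h) - L / 2 * t\<^sup>2 * (norm h)\<^sup>2" for t
  have "q 1 \<le> q 0"
  proof (rule DERIV_nonpos_imp_nonincreasing[of 0 1 q])
    fix t :: real assume t: "0 \<le> t" "t \<le> 1"
    define z where "z = x + t *\<^sub>R h"
    have z: "z \<in> S"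
      using convexD[OF assms(1) x y, of "1 - t" t] t by (simp add: z_def h_def algebra_simps)
    have "((\<lambda>t. x + t *\<^sub>R h) has_derivative (\<lambda>s. s *\<^sub>R h)) (at t)"
      by (auto intro!: derivative_eq_intros)
    from has_derivative_compose[OF this der[OF z, unfolded z_def]]
    have "((\<lambda>t. F (x + t *\<^sub>R h)) has_derivative (\<lambda>s. (s *\<^sub>R h) \<bullet> G z)) (at t)"
      by (simp add: z_def)
    then have "((\<lambda>t. F (x + t *\<^sub>R h)) has_real_derivative (h \<bullet> G z)) (at t)"
      unfolding has_field_derivative_def by (simp add: mult_commute_abs)
    then have "(q has_real_derivative (h \<bullet> G z - G x \<bullet> h - L * t * (norm h)\<^sup>2)) (at t)"
      unfolding q_def by (auto intro!: derivative_eq_intros)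
    moreover have "(G z - G x) \<bullet> h \<le> L * t * (norm h)\<^sup>2"
    proof -
      have "(G z - G x) \<bullet> h \<le> norm (G z - G x) * norm h" by (rule norm_cauchy_schwarz)
      also have "\<dots> \<le> (L * norm (z - x)) * norm h" using lip[OF z x] by (rule mult_right_mono) simp
      finally show ?thesis using t by (simp add: z_def power2_eq_square)
    qed
    ultimately show "\<exists>y. (q has_real_derivative y) (at t) \<and> y \<le> 0"
      by (intro exI conjI) (auto simp: inner_simps inner_commute)
  qed simp
  then show ?thesis by (simp add: q_def h_def)
qed

lemma has_derivative_gradient:
  fixes F :: "'a::euclidean_space \<Rightarrow> real"
  shows "F differentiable (at x) \<Longrightarrow> (F has_derivative (\<lambda>h. h \<bullet> gradient F x)) (at x)"
  using GDERIV_gradient[of F x] by (simp add: gderiv_def)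

lemma L_smooth_upper:
  fixes F :: "'a::euclidean_space \<Rightarrow> real"
  assumes "convex \<Omega>" "\<forall>x\<in>\<Omega>. F differentiable (at x)" "L_smooth_on \<Omega> F L" "x \<in> \<Omega>" "y \<in> \<Omega>"
  shows "F y \<le> F x + gradient F x \<bullet> (y - x) + L / 2 * (norm (y - x))\<^sup>2"
  using assms by (intro descent[of \<Omega>]) (auto intro: has_derivative_gradient simp: L_smooth_on_def)

text \<open>The upper bound for the negative of \<open>F\<close>. It allows \<open>l\<close> to be
  replaced by \<open>min l L\<close>, so that the normalised curvature is at most 1.\<close>

lemma L_smooth_lower:
  fixes F :: "'a::euclidean_space \<Rightarrow> real"
  assumes "convex \<Omega>" "\<forall>x\<in>\<Omega>. F differentiable (at x)" "L_smooth_on \<Omega> F L"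
  shows "lower_smooth_on \<Omega> F L"
  unfolding lower_smooth_on_def
proof (intro ballI)
  fix x y assume xy: "x \<in> \<Omega>" "y \<in> \<Omega>"
  have "- F x \<le> - F y + (- gradient F y) \<bullet> (x - y) + L / 2 * (norm (x - y))\<^sup>2"
  proof (rule descent[OF assms(1), where G = "\<lambda>z. - gradient F z"])
    show "((\<lambda>z. - F z) has_derivative (\<lambda>h. h \<bullet> - gradient F z)) (at z)" if "z \<in> \<Omega>" for z
      using has_derivative_minus[OF has_derivative_gradient, of F z] assms(2) that by simp
    show "norm (- gradient F z - - gradient F w) \<le> L * norm (z - w)" if "z \<in> \<Omega>" "w \<in> \<Omega>" for z w
      using assms(3) that by (simp add: L_smooth_on_def norm_minus_commute)
  qed (use xy in auto)
  then show "- (L / 2) * (norm (x - y))\<^sup>2 \<le> F x - F y - gradient F y \<bullet> (x - y)"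
    by simp
qed

section \<open>The two options\<close>

lemma Min_le_average:
  fixes a :: "nat \<Rightarrow> real"
  assumes "N \<ge> 1"
  shows "real N * (MIN k\<in>{1..N}. a k) \<le> (\<Sum>k=1..N. a k)"
proof -
  have "(\<Sum>k=1..N. MIN k\<in>{1..N}. a k) \<le> (\<Sum>k=1..N. a k)"
    by (intro sum_mono Min_le) auto
  then show ?thesis by simp
qed

lemma option_I_rate:
  fixes \<Omega> :: "'a::euclidean_space set"
  assumes \<Omega>: "closed \<Omega>" "convex \<Omega>" and bd: "\<And>x. x \<in> \<Omega> \<Longrightarrow> norm x \<le> M"
    and F: "\<forall>x\<in>\<Omega>. F differentiable (at x)" and L: "L > 0" "L_smooth_on \<Omega> F L"
    and opt: "is_arg_min F (\<lambda>x. x \<in> \<Omega>) \<theta>star" and \<theta>0: "\<theta>0 \<in> \<Omega>" and N: "N \<ge> 1"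
    and par: "\<forall>k\<in>{1..N}. \<alpha> k = 2 / (real k + 1) \<and> \<beta> k = 1 / (2 * L) \<and> lam k = \<beta> k \<and> \<eta> k = 1 / real N"
    and run: "ncgs_run Option_I \<Omega> F \<alpha> lam \<beta> \<eta> chi N \<theta>0 \<theta> md ag"
  shows "(MIN k\<in>{1..N}. (norm (grad_map \<Omega> (\<theta> (k - 1)) (gradient F (md k)) (lam k)))\<^sup>2)
            \<le> (12 * L * (F \<theta>0 - F \<theta>star) + 16 * L) / real N"
proof -
  have \<beta>: "\<beta> (Suc k) = 1 / (2 * L)" "lam (Suc k) = 1 / (2 * L)" "\<eta> (Suc k) = 1 / real N" "\<alpha> (Suc k) = 2 / (real k + 2)"
    if "k < N" for k
    using par[rule_format, of "Suc k"] that by auto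
  have md: "md (Suc k) = (1 - \<alpha> (Suc k)) *\<^sub>R ag k + \<alpha> (Suc k) *\<^sub>R \<theta> k"
    and cg: "condg \<Omega> (gradient F (md (Suc k))) (\<theta> k) (lam (Suc k)) (\<eta> (Suc k)) (\<theta> (Suc k))"
    and ag: "ag (Suc k) = md (Suc k) - \<beta> (Suc k) *\<^sub>R ((1 / lam (Suc k)) *\<^sub>R (\<theta> k - \<theta> (Suc k)))"
    if "k < N" for k
    using run[unfolded ncgs_run_def, THEN conjunct2, THEN conjunct2, rule_format, of "Suc k"] that by auto
  have \<theta>_0: "\<theta> 0 = \<theta>0" "ag 0 = \<theta>0" using run by (auto simp: ncgs_run_def)
  have iter: "k \<le> N \<Longrightarrow> ag k = \<theta> k \<and> \<theta> k \<in> \<Omega>" for k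
  proof (induction k)
    case (Suc k)
    then have k: "k < N" "ag k = \<theta> k" "\<theta> k \<in> \<Omega>" by auto
    have "md (Suc k) = \<theta> k" using md[OF k(1)] k(2) by (simp add: scaleR_left_diff_distrib)
    then show ?case
      using ag[OF k(1)] \<beta>[OF k(1)] L(1) condg_mem[OF \<Omega>(2) k(3) cg[OF k(1)]] by simp
  qed (use \<theta>_0 \<theta>0 in auto)
  have mdk: "md (Suc k) = \<theta> k" if "k < N" for k
    using md[OF that] iter[of k] that by (simp add: scaleR_left_diff_distrib)
  have step: "(norm (grad_map \<Omega> (\<theta> (k - 1)) (gradient F (md k)) (lam k)))\<^sup>2
     \<le> 16 * L / 3 * (F (\<theta> (k - 1)) - F (\<theta> k) + 1 / real N) + 4 * L / real N" if "k \<in> {1..N}" for k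
  proof -
    obtain j where j: "k = Suc j" "j < N" using \<open>k \<in> {1..N}\<close> by (cases k) auto
    define g where "g = gradient F (\<theta> j)"
    define d where "d = \<theta> k - \<theta> j"
    define \<psi> where "\<psi> = prox_point \<Omega> (\<theta> j) g (1 / (2 * L))"
    define r where "r = \<theta> k - \<psi>"
    have mem: "\<theta> j \<in> \<Omega>" "\<theta> k \<in> \<Omega>" using iter[of j] iter[of k] j by auto
    have \<psi>: "\<psi> \<in> \<Omega>" "(g + (2 * L) *\<^sub>R (\<psi> - \<theta> j)) \<bullet> (\<psi> - \<theta> k) \<le> 0"
      unfolding \<psi>_def using prox_point_variational[OF \<Omega>, of "1 / (2 * L)"] mem L(1) by force+
    have VI: "(g + (2 * L) *\<^sub>R d) \<bullet> (\<theta> k - x) \<le> 1 / real N" if "x \<in> \<Omega>" for x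
      using condg_variational[OF bd cg[OF j(2)] that] \<beta>[OF j(2)] mdk[OF j(2)] by (simp add: g_def d_def j)
    have "(g + (2 * L) *\<^sub>R d) \<bullet> d \<le> 1 / real N" using VI[OF mem(1)] by (simp add: d_def)
    moreover have "F (\<theta> k) \<le> F (\<theta> j) + g \<bullet> d + L / 2 * (d \<bullet> d)"
      using L_smooth_upper[OF \<Omega>(2) F L(2) mem] by (simp add: g_def d_def power2_norm_eq_inner)
    ultimately have dd: "3/2 * L * (d \<bullet> d) \<le> F (\<theta> j) - F (\<theta> k) + 1 / real N"
      by (simp add: inner_simps)
    have "(g + (2 * L) *\<^sub>R d) \<bullet> r \<le> 1 / real N" using VI[OF \<psi>(1)] by (simp add: r_def)
    moreover have "(g + (2 * L) *\<^sub>R (d - r)) \<bullet> (- r) \<le> 0"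
      using \<psi>(2) by (simp add: d_def r_def)
    \<comment> \<open>The inexact inequality at \<open>\<theta> k\<close> and the exact one at
      \<open>\<psi>\<close>, tested against each other, bound the error of the inner loop.\<close>
    moreover have "2 * L * (r \<bullet> r) = (g + (2 * L) *\<^sub>R d) \<bullet> r + (g + (2 * L) *\<^sub>R (d - r)) \<bullet> (- r)"
      by (simp add: inner_simps algebra_simps)
    ultimately have rr: "2 * L * (r \<bullet> r) \<le> 1 / real N" by linarith
    have eq: "grad_map \<Omega> (\<theta> (k - 1)) (gradient F (md k)) (lam k) = (2 * L) *\<^sub>R (r - d)"
      by (simp add: grad_map_def j \<beta>[OF j(2)] mdk[OF j(2)] g_def[symmetric] \<psi>_def[symmetric])
         (simp add: r_def d_def j)
    have "0 \<le> (r + d) \<bullet> (r + d)" by simp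
    then have "(r - d) \<bullet> (r - d) \<le> 2 * (d \<bullet> d) + 2 * (r \<bullet> r)"
      by (simp add: inner_simps inner_commute)
    then have "4 * L\<^sup>2 * ((r - d) \<bullet> (r - d)) \<le> 4 * L\<^sup>2 * (2 * (d \<bullet> d) + 2 * (r \<bullet> r))"
      by (intro mult_left_mono) auto
    \<comment> \<open>Each coefficient 8 L^2 is split so that the brackets are the left-hand sides
      of \<open>dd\<close> and \<open>rr\<close>.\<close>
    also have "\<dots> = 16 * L / 3 * (3/2 * L * (d \<bullet> d)) + 4 * L * (2 * L * (r \<bullet> r))"
      by (simp add: power2_eq_square algebra_simps)
    also have "\<dots> \<le> 16 * L / 3 * (F (\<theta> j) - F (\<theta> k) + 1 / real N) + 4 * L * (1 / real N)"
      using dd rr L(1) by (intro add_mono mult_left_mono) auto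
    also have "4 * L\<^sup>2 * ((r - d) \<bullet> (r - d)) = (norm ((2 * L) *\<^sub>R (r - d)))\<^sup>2"
      by (simp add: power_mult_distrib power2_norm_eq_inner)
    finally show ?thesis unfolding eq by (simp add: j)
  qed
  define gm where "gm k = (norm (grad_map \<Omega> (\<theta> (k - 1)) (gradient F (md k)) (lam k)))\<^sup>2" for k
  have "(\<Sum>k=1..n. F (\<theta> (k - 1)) - F (\<theta> k)) = F \<theta>0 - F (\<theta> n)" for n
    by (induction n) (auto simp: \<theta>_0)
  then have "(\<Sum>k=1..N. 16 * L / 3 * (F (\<theta> (k - 1)) - F (\<theta> k) + 1 / real N) + 4 * L / real N)
      = 16 * L / 3 * (F \<theta>0 - F (\<theta> N) + 1) + 4 * L"
    using N by (simp only: sum.distrib sum_distrib_left[symmetric]) simp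
  moreover have "real N * (MIN k\<in>{1..N}. gm k) \<le> (\<Sum>k=1..N. gm k)"
    by (rule Min_le_average[OF N])
  moreover have "(\<Sum>k=1..N. gm k) \<le> (\<Sum>k=1..N. 16 * L / 3 * (F (\<theta> (k - 1)) - F (\<theta> k) + 1 / real N) + 4 * L / real N)"
    unfolding gm_def by (rule sum_mono, rule step)
  ultimately have "real N * (MIN k\<in>{1..N}. gm k) \<le> 16 * L / 3 * (F \<theta>0 - F (\<theta> N) + 1) + 4 * L"
    by linarith
  also have "\<dots> \<le> 12 * L * (F \<theta>0 - F \<theta>star) + 16 * L"
  proof -
    have "F \<theta>star \<le> F (\<theta> N)" "F \<theta>star \<le> F \<theta>0" using opt iter[of N] \<theta>0 by (auto simp: is_arg_min_linorder)
    then have "0 \<le> L * (F (\<theta> N) - F \<theta>star)" "0 \<le> L * (F \<theta>0 - F \<theta>star)" using L(1) by simp_all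
    moreover have "12 * L * (F \<theta>0 - F \<theta>star) + 16 * L - (16 * L / 3 * (F \<theta>0 - F (\<theta> N) + 1) + 4 * L)
      = 16 / 3 * (L * (F (\<theta> N) - F \<theta>star)) + 20 / 3 * (L * (F \<theta>0 - F \<theta>star)) + 20 / 3 * L"
      by (simp add: field_simps)
    ultimately show ?thesis using L(1) by linarith
  qed
  finally show ?thesis unfolding gm_def using N by (simp add: pos_le_divide_eq mult.commute)
qed

lemma option_II_rate:
  fixes \<Omega> :: "'a::euclidean_space set"
  assumes \<Omega>: "closed \<Omega>" "convex \<Omega>" and bd: "\<And>x. x \<in> \<Omega> \<Longrightarrow> norm x \<le> M"
    and F: "\<forall>x\<in>\<Omega>. F differentiable (at x)" and L: "L > 0" "L_smooth_on \<Omega> F L"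
    and l: "l \<ge> 0" "lower_smooth_on \<Omega> F l"
    and opt: "is_arg_min F (\<lambda>x. x \<in> \<Omega>) \<theta>star" and \<theta>0: "\<theta>0 \<in> \<Omega>" and N: "N \<ge> 1"
    and par: "\<forall>k\<in>{1..N}. \<alpha> k = 2 / (real k + 1) \<and> \<beta> k = 1 / (2 * L) \<and> lam k = real k * \<beta> k / 2
      \<and> \<eta> k = 1 / real N \<and> chi k = 1 / real N"
    and run: "ncgs_run Option_II \<Omega> F \<alpha> lam \<beta> \<eta> chi N \<theta>0 \<theta> md ag"
  shows "(MIN k\<in>{1..N}. (norm (grad_map \<Omega> (\<theta> (k - 1)) (gradient F (md k)) (\<beta> k)))\<^sup>2)
            \<le> 48 * L * (4 * L * (norm (\<theta>0 - \<theta>star))\<^sup>2 / ((real N)\<^sup>2 * (real N + 1))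
                + l / real N * ((norm \<theta>star)\<^sup>2 + 2 * M\<^sup>2) + 2 / real N)"
proof -
  define \<kappa> where "\<kappa> = min l L / L"
  define \<epsilon> where "\<epsilon> = 1 / (real N * L)"
  define f where "f x = F x / L" for x
  define G where "G x = (1 / L) *\<^sub>R gradient F x" for x
  define \<psi> where "\<psi> k = prox_point \<Omega> (\<theta> (k - 1)) (gradient F (md k)) (\<beta> k)" for k
  have \<beta>: "\<beta> (Suc k) = 1 / (2 * L)" "lam (Suc k) = (real k + 1) / (4 * L)" "\<eta> (Suc k) = 1 / real N"
    "\<alpha> (Suc k) = 2 / (real k + 2)" "chi (Suc k) = 1 / real N" if "k < N" for k
  proof -
    note p = par[rule_format, of "Suc k"]
    show "\<beta> (Suc k) = 1 / (2 * L)" "\<eta> (Suc k) = 1 / real N" "\<alpha> (Suc k) = 2 / (real k + 2)" "chi (Suc k) = 1 / real N"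
      using p that by auto
    have "lam (Suc k) = real (Suc k) * \<beta> (Suc k) / 2" "\<beta> (Suc k) = 1 / (2 * L)" using p that by auto
    then have "lam (Suc k) = real (Suc k) * (1 / (2 * L)) / 2" by (simp only:)
    then show "lam (Suc k) = (real k + 1) / (4 * L)" by (simp add: add.commute)
  qed
  have md: "md (Suc k) = (1 - \<alpha> (Suc k)) *\<^sub>R ag k + \<alpha> (Suc k) *\<^sub>R \<theta> k"
    and cg: "condg \<Omega> (gradient F (md (Suc k))) (\<theta> k) (lam (Suc k)) (\<eta> (Suc k)) (\<theta> (Suc k))"
    and cg': "condg \<Omega> (gradient F (md (Suc k))) (md (Suc k)) (\<beta> (Suc k)) (chi (Suc k)) (ag (Suc k))"
    if "k < N" for k
    using run[unfolded ncgs_run_def, THEN conjunct2, THEN conjunct2, rule_format, of "Suc k"] that by auto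
  have init: "\<theta> 0 = \<theta>0" "ag 0 = \<theta>0" using run by (auto simp: ncgs_run_def)
  have md': "md (Suc k) = (1 - 2 / (real k + 2)) *\<^sub>R ag k + (2 / (real k + 2)) *\<^sub>R \<theta> k" if "k < N" for k
    using md[OF that] \<beta>[OF that] by simp
  have mem: "k \<le> N \<Longrightarrow> \<theta> k \<in> \<Omega> \<and> ag k \<in> \<Omega>" for k
  proof (induction k)
    case (Suc k)
    then have k: "k < N" "ag k \<in> \<Omega>" "\<theta> k \<in> \<Omega>" by auto
    have "md (Suc k) \<in> \<Omega>"
      unfolding md'[OF k(1)] by (rule convexD[OF \<Omega>(2) k(2,3)]) auto
    then show ?case
      using condg_mem[OF \<Omega>(2) k(3) cg[OF k(1)]] condg_mem[OF \<Omega>(2) _ cg'[OF k(1)]] \<beta>[OF k(1)] L(1) by simp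
  qed (use init \<theta>0 in auto)
  have lower: "F x + gradient F x \<bullet> (y - x) - min l L / 2 * ((y - x) \<bullet> (y - x)) \<le> F y" if "x \<in> \<Omega>" "y \<in> \<Omega>" for x y
  proof -
    have "lower_smooth_on \<Omega> F (min l L)"
      using l(2) L_smooth_lower[OF \<Omega>(2) F L(2)] by (simp add: min_def)
    then show ?thesis using that by (force simp: lower_smooth_on_def power2_norm_eq_inner)
  qed
  have scale: "G (md (Suc k)) \<bullet> z + c * (w \<bullet> z) \<le> b"
    if "gradient F (md (Suc k)) \<bullet> z + L * c * (w \<bullet> z) \<le> L * b" for k c b and w z :: 'a
  proof -
    have "L * (G (md (Suc k)) \<bullet> z + c * (w \<bullet> z)) \<le> L * b" using that L(1) by (simp add: G_def distrib_left mult.assoc)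
    then show ?thesis using L(1) by simp
  qed
  interpret ncgs_normalized \<Omega> f G \<kappa> M \<epsilon> N \<theta> md ag \<psi> \<theta>star
  proof
    show "convex \<Omega>" by (fact \<Omega>(2))
    show "f y \<le> f x + G x \<bullet> (y - x) + (y - x) \<bullet> (y - x) / 2" if "x \<in> \<Omega>" "y \<in> \<Omega>" for x y
      using divide_right_mono[OF L_smooth_upper[OF \<Omega>(2) F L(2) that], of L] L(1)
      by (simp add: f_def G_def add_divide_distrib power2_norm_eq_inner)
    show "f x + G x \<bullet> (y - x) - \<kappa> / 2 * ((y - x) \<bullet> (y - x)) \<le> f y" if "x \<in> \<Omega>" "y \<in> \<Omega>" for x y
      using divide_right_mono[OF lower[OF that], of L] L(1)
      by (simp add: f_def G_def \<kappa>_def add_divide_distrib diff_divide_distrib)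
    show "norm (G x - G y) \<le> norm (x - y)" if "x \<in> \<Omega>" "y \<in> \<Omega>" for x y
    proof -
      have "G x - G y = (1 / L) *\<^sub>R (gradient F x - gradient F y)" by (simp add: G_def scaleR_diff_right)
      moreover have "norm (gradient F x - gradient F y) \<le> L * norm (x - y)"
        using L(2) that by (simp add: L_smooth_on_def)
      ultimately show ?thesis using L(1) by (simp add: pos_divide_le_eq mult.commute)
    qed
    show "continuous_on \<Omega> f"
      unfolding f_def using F L(1)
      by (intro continuous_intros continuous_at_imp_continuous_on) (auto intro: differentiable_imp_continuous_within)
    show "0 \<le> \<kappa>" "\<kappa> \<le> 1" using l L(1) by (auto simp: \<kappa>_def)
    show "0 \<le> \<epsilon>" using L(1) by (simp add: \<epsilon>_def)
    show "norm x \<le> M" if "x \<in> \<Omega>" for x by (rule bd[OF that])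
    show "ag 0 = \<theta> 0" using init by simp
    show "\<theta> k \<in> \<Omega>" "ag k \<in> \<Omega>" if "k \<le> N" for k using mem[OF that] by auto
    show "md (Suc k) = (1 - 2 / (real k + 2)) *\<^sub>R ag k + (2 / (real k + 2)) *\<^sub>R \<theta> k" if "k < N" for k
      by (rule md'[OF that])
    show "(G (md (Suc k)) + (4 / (real k + 1)) *\<^sub>R (\<theta> (Suc k) - \<theta> k)) \<bullet> (\<theta> (Suc k) - x) \<le> \<epsilon>" if "k < N" "x \<in> \<Omega>" for k x
      using condg_variational[OF bd cg[OF that(1)] that(2)] \<beta>[OF that(1)] L(1) unfolding inner_add_left inner_scaleR_left
      by (intro scale) (simp add: \<epsilon>_def mult.commute)
    show "(G (md (Suc k)) + 2 *\<^sub>R (ag (Suc k) - md (Suc k))) \<bullet> (ag (Suc k) - x) \<le> \<epsilon>" if "k < N" "x \<in> \<Omega>" for k x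
      using condg_variational[OF bd cg'[OF that(1)] that(2)] \<beta>[OF that(1)] L(1) unfolding inner_add_left inner_scaleR_left
      by (intro scale) (simp add: \<epsilon>_def mult.commute)
    have ne: "\<Omega> \<noteq> {}" using \<theta>0 by auto
    show "\<psi> (Suc k) \<in> \<Omega>" if "k < N" for k
      unfolding \<psi>_def using \<beta>[OF that] L(1) by (intro prox_point_variational(1)[OF \<Omega> ne]) simp
    show "(G (md (Suc k)) + 2 *\<^sub>R (\<psi> (Suc k) - \<theta> k)) \<bullet> (\<psi> (Suc k) - x) \<le> 0" if "k < N" "x \<in> \<Omega>" for k x
      using prox_point_variational(2)[OF \<Omega> ne _ that(2), of "\<beta> (Suc k)" "gradient F (md (Suc k))" "\<theta> k"] \<beta>[OF that(1)] L(1)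
      unfolding inner_add_left inner_scaleR_left by (intro scale) (simp add: \<psi>_def mult.commute)
    show "f \<theta>star \<le> f x" if "x \<in> \<Omega>" for x
      using opt that L(1) by (auto simp: is_arg_min_linorder f_def divide_right_mono)
    show "\<theta>star \<in> \<Omega>" using opt by (simp add: is_arg_min_def)
  qed
  define m where "m = (MIN k\<in>{1..N}. (norm (grad_map \<Omega> (\<theta> (k - 1)) (gradient F (md k)) (\<beta> k)))\<^sup>2)"
  have "m / (4 * L\<^sup>2) \<le> P k \<bullet> P k" if k: "1 \<le> k" "k \<le> N" for k
  proof -
    have "\<beta> k = 1 / (2 * L)" using par k by auto
    \<comment> \<open>The gradient mapping is 2 L times \<open>P\<close>, so its square carries 4
      L^2, which turns the 12 of \<open>accelerated_rate\<close> into 48.\<close>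
    then have "grad_map \<Omega> (\<theta> (k - 1)) (gradient F (md k)) (\<beta> k) = (2 * L) *\<^sub>R P k"
      by (simp add: grad_map_def P_def \<psi>_def)
    then have "(norm (grad_map \<Omega> (\<theta> (k - 1)) (gradient F (md k)) (\<beta> k)))\<^sup>2 = 4 * L\<^sup>2 * (P k \<bullet> P k)"
      by (simp add: power_mult_distrib power2_norm_eq_inner)
    moreover have "m \<le> (norm (grad_map \<Omega> (\<theta> (k - 1)) (gradient F (md k)) (\<beta> k)))\<^sup>2"
      unfolding m_def using k by (intro Min_le) auto
    ultimately show ?thesis using L(1) by (simp add: field_simps)
  qed
  from accelerated_rate[OF this N]
  have "m \<le> 4 * L\<^sup>2 * (12 * (4 * ((\<theta> 0 - \<theta>star) \<bullet> (\<theta> 0 - \<theta>star)) / ((real N)\<^sup>2 * (real N + 1))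
      + \<kappa> / real N * (\<theta>star \<bullet> \<theta>star + 2 * M\<^sup>2) + 2 * \<epsilon>))"
    using L(1) by (simp add: pos_divide_le_eq mult.commute)
  also have "\<dots> = 48 * L * (4 * L * (norm (\<theta>0 - \<theta>star))\<^sup>2 / ((real N)\<^sup>2 * (real N + 1))
                + min l L / real N * ((norm \<theta>star)\<^sup>2 + 2 * M\<^sup>2) + 2 / real N)"
    using L(1) N by (simp add: \<kappa>_def \<epsilon>_def init power2_norm_eq_inner power2_eq_square[of L] algebra_simps)
  also have "\<dots> \<le> 48 * L * (4 * L * (norm (\<theta>0 - \<theta>star))\<^sup>2 / ((real N)\<^sup>2 * (real N + 1))
                + l / real N * ((norm \<theta>star)\<^sup>2 + 2 * M\<^sup>2) + 2 / real N)"
    using L(1) by (intro mult_left_mono add_mono mult_right_mono divide_right_mono) auto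
  finally show ?thesis by (simp add: m_def)
qed

theorem theorem1:
  fixes \<Omega> :: "(real ^ 'p) set"
    and F :: "real ^ 'p \<Rightarrow> real"
    and L l M :: real
    and N :: nat
    and \<theta>0 \<theta>star :: "real ^ 'p"
    and \<alpha> lam \<beta> \<eta> chi :: "nat \<Rightarrow> real"
    and \<theta> md ag :: "nat \<Rightarrow> real ^ 'p"
  assumes "closed \<Omega>" and "convex \<Omega>"
    and "\<forall>\<gamma>>0. \<forall>x\<in>\<Omega>. \<forall>\<omega>. norm (prox_point \<Omega> x \<omega> \<gamma>) \<le> M"
    and "\<forall>x\<in>\<Omega>. F differentiable (at x)"
    and "L > 0" and "L_smooth_on \<Omega> F L"
    and "l \<ge> 0" and "lower_smooth_on \<Omega> F l"
    and "is_arg_min F (\<lambda>x. x \<in> \<Omega>) \<theta>star"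
    and "\<theta>0 \<in> \<Omega>" and "N \<ge> 1"
  shows
    "((\<forall>k\<in>{1..N}. \<alpha> k = 2 / (real k + 1) \<and> \<beta> k = 1 / (2 * L) \<and> lam k = \<beta> k
          \<and> \<eta> k = 1 / real N)
      \<and> ncgs_run Option_I \<Omega> F \<alpha> lam \<beta> \<eta> chi N \<theta>0 \<theta> md ag
      \<longrightarrow> (MIN k\<in>{1..N}. (norm (grad_map \<Omega> (\<theta> (k - 1)) (gradient F (md k)) (lam k)))\<^sup>2)
            \<le> (12 * L * (F \<theta>0 - F \<theta>star) + 16 * L) / real N)
     \<and>
     ((\<forall>k\<in>{1..N}. \<alpha> k = 2 / (real k + 1) \<and> \<beta> k = 1 / (2 * L) \<and> lam k = real k * \<beta> k / 2
          \<and> \<eta> k = 1 / real N \<and> chi k = 1 / real N)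
      \<and> ncgs_run Option_II \<Omega> F \<alpha> lam \<beta> \<eta> chi N \<theta>0 \<theta> md ag
      \<longrightarrow> (MIN k\<in>{1..N}. (norm (grad_map \<Omega> (\<theta> (k - 1)) (gradient F (md k)) (\<beta> k)))\<^sup>2)
            \<le> 48 * L * (4 * L * (norm (\<theta>0 - \<theta>star))\<^sup>2 / ((real N)\<^sup>2 * (real N + 1))
                + l / real N * ((norm \<theta>star)\<^sup>2 + 2 * M\<^sup>2) + 2 / real N))"
proof (intro conjI impI; elim conjE)
  have bd: "norm x \<le> M" if "x \<in> \<Omega>" for x
    using assms(1,2,3) that by (rule norm_le_if_prox_bounded)
  show "(MIN k\<in>{1..N}. (norm (grad_map \<Omega> (\<theta> (k - 1)) (gradient F (md k)) (lam k)))\<^sup>2)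
      \<le> (12 * L * (F \<theta>0 - F \<theta>star) + 16 * L) / real N"
    if "\<forall>k\<in>{1..N}. \<alpha> k = 2 / (real k + 1) \<and> \<beta> k = 1 / (2 * L) \<and> lam k = \<beta> k \<and> \<eta> k = 1 / real N"
      and "ncgs_run Option_I \<Omega> F \<alpha> lam \<beta> \<eta> chi N \<theta>0 \<theta> md ag"
    by (rule option_I_rate[OF assms(1,2) bd assms(4,5,6,9,10,11) that])
  show "(MIN k\<in>{1..N}. (norm (grad_map \<Omega> (\<theta> (k - 1)) (gradient F (md k)) (\<beta> k)))\<^sup>2)
      \<le> 48 * L * (4 * L * (norm (\<theta>0 - \<theta>star))\<^sup>2 / ((real N)\<^sup>2 * (real N + 1))
          + l / real N * ((norm \<theta>star)\<^sup>2 + 2 * M\<^sup>2) + 2 / real N)"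
    if "\<forall>k\<in>{1..N}. \<alpha> k = 2 / (real k + 1) \<and> \<beta> k = 1 / (2 * L) \<and> lam k = real k * \<beta> k / 2
        \<and> \<eta> k = 1 / real N \<and> chi k = 1 / real N"
      and "ncgs_run Option_II \<Omega> F \<alpha> lam \<beta> \<eta> chi N \<theta>0 \<theta> md ag"
    by (rule option_II_rate[OF assms(1,2) bd assms(4-11) that])
qed

end
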